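(* Let $\alpha \in \overline{\mathbb{Q}}^{\times}$ be a non-zero algebraic number that is not a root of unity. Then $$M_\infty(\alpha) \geq \inf\{H(\gamma) : \gamma \in \mathbb{Q}(\alpha)\ \text{and}\ H(\gamma) > 1\}.$$
   Context: For a number field $K$ and a place $v$ of $K$ dividing the place $p$ of $\mathbb{Q}$ (including $p=\infty$), let $\|\cdot\|_v$ be the unique absolute value on the completion $K_v$ extending the $p$-adic (usual, if $p=\infty$) absolute value on $\mathbb{Q}_p$, and put $|\alpha|_v = \|\alpha\|_v^{[K_v:\mathbb{Q}_p]/[K:\mathbb{Q}]}$ for $\alpha\in K$. The (absolute, multiplicative) Weil height of $\alpha \in K$ is $H(\alpha) = \prod_v \max\{1,|\alpha|_v\}$, the product being over all places $v$ of $K$; it does not depend on the choice of $K$ containing $\alpha$, so $H$ is a function on $\overline{\mathbb{Q}}$. The Mahler measure of $\alpha\in\overline{\mathbb{Q}}$ is $M(\alpha) = H(\alpha)^{\deg\alpha}$, where $\deg\alpha = [\mathbb{Q}(\alpha):\mathbb{Q}]$. Let $\mathcal{X}(\overline{\mathbb{Q}}^{\times})$ be the group of sequences $(\alpha_1,\alpha_2,\ldots)$ with $\alpha_n\in\overline{\mathbb{Q}}^{\times}$ and $\alpha_n = 1$ for all but finitely many $n$, and let $\tau:\mathcal{X}(\overline{\mathbb{Q}}^{\times})\to\overline{\mathbb{Q}}^{\times}$ be $\tau(\alpha_1,\alpha_2,\ldots) = \alpha_1\alpha_2\cdots$. For $\alpha\in\overline{\mathbb{Q}}^{\times}$ define the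 non-Archimedean (strong) metric Mahler measure $$M_\infty(\alpha) = \inf\left\{\max_{n\geq 1} M(\alpha_n) : (\alpha_1,\alpha_2,\ldots)\in\tau^{-1}(\alpha)\right\}.$$ *)

theory Defs
  imports
    Complex_Main
    "HOL-Library.FuncSet"
    "HOL-Library.Groups_Big_Fun"
    "HOL-Computational_Algebra.Computational_Algebra"
    "HOL-Algebra.Algebra"
    "HOL-Algebra.Algebraic_Closure_Type"
begin

text \<open>
  The field of algebraic numbers is taken to be the set of \<^const>\<open>Polynomial.algebraic\<close>
  complex numbers, and number fields are subfields of the complex numbers.
\<close>

abbreviation complex_ring :: "complex ring" where
  "complex_ring \<equiv> ring_of_type_algebra"

definition adjoin_rat :: "complex \<Rightarrow> complex set" where
  "adjoin_rat \<alpha> = generate_field complex_ring (insert \<alpha> \<rat>)"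

definition vs_dim :: "('a, 'b) ring_scheme \<Rightarrow> 'a set \<Rightarrow> 'a set \<Rightarrow> nat" where
  "vs_dim R F E = (THE n. ring.dimension R n F E)"

definition field_degree :: "complex set \<Rightarrow> nat" where
  "field_degree K = vs_dim complex_ring \<rat> K"

definition absolute_value_on :: "complex set \<Rightarrow> (complex \<Rightarrow> real) \<Rightarrow> bool" where
  "absolute_value_on K v \<longleftrightarrow>
     (\<forall>x\<in>K. 0 \<le> v x \<and> (v x = 0 \<longleftrightarrow> x = 0)) \<and>
     (\<forall>x\<in>K. \<forall>y\<in>K. v (x * y) = v x * v y \<and> v (x + y) \<le> v x + v y)"

definition padic_abs :: "nat \<Rightarrow> rat \<Rightarrow> real" where
  "padic_abs p q =
     (if q = 0 then 0
      else let (a, b) = quotient_of q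
           in real p powi (int (multiplicity (int p) b) - int (multiplicity (int p) a)))"

text \<open>
  Each place of \<open>K\<close> is represented by its unique member \<open>v\<close> that extends the usual or
  a \<open>p\<close>-adic absolute value of the rationals; this is the restriction to \<open>K\<close> of the
  absolute value on the completion that extends the one of \<open>\<rat>\<^sub>p\<close>.  Extensionality makes
  distinct places distinct as HOL functions.
\<close>

definition places :: "complex set \<Rightarrow> (complex \<Rightarrow> real) set" where
  "places K =
     {v \<in> extensional K. absolute_value_on K v \<and>
        ((\<forall>q::rat. v (of_rat q) = \<bar>of_rat q\<bar>) \<or>
         (\<exists>p::nat. normalization_semidom_class.prime p \<and> (\<forall>q::rat. v (of_rat q) = padic_abs p q)))}"

text \<open>
  The completion of \<open>K\<close> at \<open>v\<close> is the ring of Cauchy sequences in \<open>K\<close> modulo the null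
  sequences.
\<close>

definition cauchy_seqs :: "complex set \<Rightarrow> (complex \<Rightarrow> real) \<Rightarrow> (nat \<Rightarrow> complex) set" where
  "cauchy_seqs K v =
     {s. range s \<subseteq> K \<and> (\<forall>e>0. \<exists>N. \<forall>m\<ge>N. \<forall>n\<ge>N. v (s m - s n) < e)}"

definition null_seqs :: "complex set \<Rightarrow> (complex \<Rightarrow> real) \<Rightarrow> (nat \<Rightarrow> complex) set" where
  "null_seqs K v = {s. range s \<subseteq> K \<and> (\<lambda>n. v (s n)) \<longlonglongrightarrow> 0}"

definition cauchy_ring :: "complex set \<Rightarrow> (complex \<Rightarrow> real) \<Rightarrow> (nat \<Rightarrow> complex) ring" where
  "cauchy_ring K v =
     \<lparr>carrier = cauchy_seqs K v, monoid.mult = (\<lambda>s t n. s n * t n), one = (\<lambda>_. 1),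
      ring.zero = (\<lambda>_. 0), add = (\<lambda>s t n. s n + t n)\<rparr>"

definition completion :: "complex set \<Rightarrow> (complex \<Rightarrow> real) \<Rightarrow> (nat \<Rightarrow> complex) set ring" where
  "completion K v = cauchy_ring K v Quot null_seqs K v"

text \<open>
  The completion of \<open>\<rat>\<close> at the restriction of \<open>v\<close>, embedded in the completion of \<open>K\<close>:
  the classes of the Cauchy sequences with rational terms.
\<close>

definition rat_completion :: "complex set \<Rightarrow> (complex \<Rightarrow> real) \<Rightarrow> (nat \<Rightarrow> complex) set set" where
  "rat_completion K v = (\<lambda>s. null_seqs K v +>\<^bsub>cauchy_ring K v\<^esub> s) ` cauchy_seqs \<rat> v"

definition local_degree :: "complex set \<Rightarrow> (complex \<Rightarrow> real) \<Rightarrow> nat" where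
  "local_degree K v =
     vs_dim (completion K v) (rat_completion K v) (carrier (completion K v))"

definition normalized_abs :: "complex set \<Rightarrow> (complex \<Rightarrow> real) \<Rightarrow> complex \<Rightarrow> real" where
  "normalized_abs K v \<alpha> = v \<alpha> powr (real (local_degree K v) / real (field_degree K))"

text \<open>
  All but finitely many factors of the product over the places of \<open>K\<close> equal 1; the
  operator \<^const>\<open>Prod_any\<close> multiplies the factors different from 1.
\<close>

definition height_in :: "complex set \<Rightarrow> complex \<Rightarrow> real" where
  "height_in K \<alpha> = Prod_any (\<lambda>v. if v \<in> places K then max 1 (normalized_abs K v \<alpha>) else 1)"

text \<open>
  The value of \<^term>\<open>height_in K \<alpha>\<close> is the same for all number fields \<open>K\<close> containing
  \<open>\<alpha>\<close>, so the smallest one is used.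
\<close>

definition weil_height :: "complex \<Rightarrow> real" where
  "weil_height \<alpha> = height_in (adjoin_rat \<alpha>) \<alpha>"

definition mahler_measure_alg :: "complex \<Rightarrow> real" where
  "mahler_measure_alg \<alpha> = weil_height \<alpha> ^ field_degree (adjoin_rat \<alpha>)"

definition alg_seqs :: "(nat \<Rightarrow> complex) set" where
  "alg_seqs = {a. (\<forall>n. Polynomial.algebraic (a n) \<and> a n \<noteq> 0) \<and> finite {n. a n \<noteq> 1}}"

definition metric_mahler_inf :: "complex \<Rightarrow> real" where
  "metric_mahler_inf \<alpha> =
     Inf {Max (range (\<lambda>n. mahler_measure_alg (a n))) | a. a \<in> alg_seqs \<and> Prod_any a = \<alpha>}"

end

theory Submission
  imports Defs
begin

text \<open>
  Put \<open>E = \<rat>(\<alpha>)\<close> and let \<open>\<alpha> = \<alpha>\<^sub>1 \<dots> \<alpha>\<^sub>N\<close>.  The product \<open>\<beta>\<^sub>n\<close> of the conjugates of \<open>\<alpha>\<^sub>n\<close> over \<open>E\<close> lies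
  in \<open>E\<close>, and taking norms down to \<open>E\<close> from a field containing all \<open>\<alpha>\<^sub>n\<close> writes a power of \<open>\<alpha>\<close>
  as a product of powers of the \<open>\<beta>\<^sub>n\<close>.  Hence some \<open>\<beta>\<^sub>n\<close> is not a root of unity, so its height
  exceeds 1 by Kronecker's theorem, while subadditivity and conjugation invariance of the height bound
  it by \<open>H(\<alpha>\<^sub>n)\<close> to the power \<open>deg \<alpha>\<^sub>n\<close>.

  These properties of the height follow once the product over the places of \<open>\<rat>(\<alpha>)\<close> is rewritten as
  a product over conjugates: with \<open>u\<^sub>p\<close> a fixed extension of the \<open>p\<close>-adic (or usual) absolute value to
  all algebraic numbers, \<open>H(\<alpha>)\<close> to the power \<open>deg \<alpha>\<close> is the product of \<open>max 1 (u\<^sub>p \<alpha>')\<close> over all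
  places \<open>p\<close> of \<open>\<rat>\<close> and all conjugates \<open>\<alpha>'\<close> of \<open>\<alpha>\<close>.  This amounts to the local degree at a place
  being the number of embeddings that induce it.
\<close>

section \<open>Subfields of the complex numbers and conjugates\<close>

text \<open>The obstacle is the local degree, defined as a dimension over a completion built from
  Cauchy sequences. No embedding of a number field into an algebraically closed complete field is
  constructed, and no polynomial is factored over the completed rationals. Instead all conjugates
  are complex roots of minimal polynomials, each p-adic absolute value is extended at once to all
  algebraic numbers through a valuation ring, and linear independence and density over the
  completion become inequalities between elements of the number field. Galois groups are avoided as
  well: symmetric expressions in the conjugates are shown to lie in the base field by means of power
  sums.

  Taking the conjugates of the factors over E keeps their product in E, while their number is at
  most the degree over the rationals, which is the exponent in the Mahler measure. If all these
  products were roots of unity, a power of \<alpha> would be one too; this is where the hypothesis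
  on \<alpha> enters.\<close>

locale complex_subring =
  fixes F :: "complex set"
  assumes one_closed [simp, intro]: "1 \<in> F"
    and diff_closed [intro]: "x \<in> F \<Longrightarrow> y \<in> F \<Longrightarrow> x - y \<in> F"
    and mult_closed [intro]: "x \<in> F \<Longrightarrow> y \<in> F \<Longrightarrow> x * y \<in> F"
begin

lemma zero_closed [simp, intro]: "0 \<in> F"
  using diff_closed[of 1 1] by simp

lemma uminus_closed [intro]: "x \<in> F \<Longrightarrow> - x \<in> F"
  using diff_closed[of 0 x] by simp

lemma add_closed [intro]: "x \<in> F \<Longrightarrow> y \<in> F \<Longrightarrow> x + y \<in> F"
  using diff_closed[of x "- y"] uminus_closed[of y] by simp

lemma power_closed [intro]: "x \<in> F \<Longrightarrow> x ^ n \<in> F"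
  by (induction n) auto

lemma sum_closed: "(\<And>i. i \<in> I \<Longrightarrow> f i \<in> F) \<Longrightarrow> sum f I \<in> F"
  by (induction I rule: infinite_finite_induct) auto

lemma prod_closed: "(\<And>i. i \<in> I \<Longrightarrow> f i \<in> F) \<Longrightarrow> prod f I \<in> F"
  by (induction I rule: infinite_finite_induct) auto

lemma of_nat_closed [simp, intro]: "of_nat n \<in> F"
  by (induction n) auto

lemma of_int_closed [simp, intro]: "of_int n \<in> F"
  by (cases n) (auto simp del: of_nat_Suc)

end

text \<open>Polynomials over any subring are complex polynomials with restricted coefficients, so
  that roots, division and derivatives over different base fields all live in one type.\<close>

definition polys_over :: "complex set \<Rightarrow> complex poly set" where
  "polys_over F = {p. \<forall>i. coeff p i \<in> F}"

lemma polys_overD: "p \<in> polys_over F \<Longrightarrow> coeff p i \<in> F"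
  by (simp add: polys_over_def)

lemma polys_over_mono: "F \<subseteq> E \<Longrightarrow> polys_over F \<subseteq> polys_over E"
  by (auto simp: polys_over_def)

context complex_subring begin

lemma polys_over_0 [simp, intro]: "0 \<in> polys_over F"
  by (simp add: polys_over_def)

lemma polys_over_pCons [simp]: "pCons a p \<in> polys_over F \<longleftrightarrow> a \<in> F \<and> p \<in> polys_over F"
  by (auto simp: polys_over_def coeff_pCons split: nat.splits)

lemma polys_over_1 [simp, intro]: "1 \<in> polys_over F"
  by (simp add: one_pCons)

lemma polys_over_diff [intro]: "p \<in> polys_over F \<Longrightarrow> q \<in> polys_over F \<Longrightarrow> p - q \<in> polys_over F"
  by (auto simp: polys_over_def)

lemma polys_over_add [intro]: "p \<in> polys_over F \<Longrightarrow> q \<in> polys_over F \<Longrightarrow> p + q \<in> polys_over F"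
  by (auto simp: polys_over_def)

lemma polys_over_mult [intro]: "p \<in> polys_over F \<Longrightarrow> q \<in> polys_over F \<Longrightarrow> p * q \<in> polys_over F"
  by (auto simp: polys_over_def coeff_mult intro!: sum_closed)

lemma polys_over_smult [intro]: "a \<in> F \<Longrightarrow> q \<in> polys_over F \<Longrightarrow> smult a q \<in> polys_over F"
  by (auto simp: polys_over_def)

lemma polys_over_monom [intro]: "a \<in> F \<Longrightarrow> monom a n \<in> polys_over F"
  by (auto simp: polys_over_def coeff_monom)

lemma polys_over_power [intro]: "p \<in> polys_over F \<Longrightarrow> p ^ n \<in> polys_over F"
  by (induction n) auto

lemma polys_over_prod: "(\<And>i. i \<in> I \<Longrightarrow> f i \<in> polys_over F) \<Longrightarrow> prod f I \<in> polys_over F"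
  by (induction I rule: infinite_finite_induct) auto

lemma polys_over_pderiv [intro]: "p \<in> polys_over F \<Longrightarrow> pderiv p \<in> polys_over F"
  by (auto simp: polys_over_def coeff_pderiv simp del: of_nat_Suc)

lemma poly_closed [intro]: "p \<in> polys_over F \<Longrightarrow> x \<in> F \<Longrightarrow> poly p x \<in> F"
  by (induction p) auto

lemma polys_over_pcompose [intro]: "p \<in> polys_over F \<Longrightarrow> q \<in> polys_over F \<Longrightarrow> pcompose p q \<in> polys_over F"
  by (induction p) (auto simp: pcompose_pCons)

text \<open>Since \<open>g\<close> is monic, long division needs no inverses and stays inside the
  coefficient ring: the leading term of \<open>p\<close> is cancelled by a monomial multiple of
  \<open>g\<close>.\<close>

lemma polys_over_divide:
  assumes "g \<in> polys_over F" "lead_coeff g = 1" "p \<in> polys_over F"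
  shows "\<exists>q\<in>polys_over F. \<exists>r\<in>polys_over F. p = q * g + r \<and> (r = 0 \<or> degree r < degree g)"
  using assms(3)
proof (induction "degree p" arbitrary: p rule: less_induct)
  case less
  show ?case
  proof (cases "p = 0 \<or> degree p < degree g")
    case True
    then show ?thesis using less.prems by (intro bexI[of _ 0] bexI[of _ p]) auto
  next
    case False
    define t where "t = monom (lead_coeff p) (degree p - degree g)"
    have t: "t \<in> polys_over F" unfolding t_def using less.prems polys_overD by blast
    have g0: "g \<noteq> 0" using assms(2) by auto
    have t0: "t \<noteq> 0" "degree t = degree p - degree g" "lead_coeff t = lead_coeff p"
      using False unfolding t_def by (simp_all add: degree_monom_eq)
    have tg: "degree (t * g) = degree p"
      using False g0 t0(1,2) by (simp add: degree_mult_eq)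
    have tg': "lead_coeff (t * g) = lead_coeff p"
      unfolding lead_coeff_mult using assms(2) t0 by simp
    have p': "p - t * g \<in> polys_over F" using t assms less.prems by blast
    \<comment> \<open>The degree cannot drop below 0, because the zero polynomial also has degree 0;
      in that case \<open>g\<close> is the constant 1 and divides \<open>p\<close> outright.\<close>
    show ?thesis
    proof (cases "degree p = 0")
      case True
      then have "degree g = 0" using False by auto
      then obtain c where "g = [:c:]" using degree_eq_zeroE by blast
      then have "g = 1" using assms(2) by (simp add: one_pCons)
      then show ?thesis using less.prems by (intro bexI[of _ p] bexI[of _ 0]) auto
    next
      case pos: False
      have "degree (p - t * g) < degree p"
      proof (rule le_neq_implies_less)
        show "degree (p - t * g) \<le> degree p" using tg by (simp add: degree_diff_le)
        have "coeff (p - t * g) (degree p) = 0" using tg tg' by simp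
        then show "degree (p - t * g) \<noteq> degree p"
          using pos leading_coeff_0_iff[of "p - t * g"] by (metis degree_0)
      qed
      from less.hyps[OF this p'] obtain q r where qr: "q \<in> polys_over F" "r \<in> polys_over F"
        "p - t * g = q * g + r" "r = 0 \<or> degree r < degree g" by blast
      show ?thesis
        using qr t by (intro bexI[of _ "q + t"] bexI[of _ r]) (auto simp: algebra_simps)
    qed
  qed
qed

text \<open>Quotient and remainder by a monic \<open>g\<close> are unique: dividing inside
  \<open>F\<close> gives \<open>q'\<close> and \<open>r\<close>, and \<open>(q - q') * g = r\<close>
  is possible only for \<open>r = 0\<close>, by degrees.\<close>

lemma polys_over_cofactor:
  assumes "g \<in> polys_over F" "lead_coeff g = 1" "q * g \<in> polys_over F"
  shows "q \<in> polys_over F"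
proof -
  obtain q' r where qr: "q' \<in> polys_over F" "q * g = q' * g + r" "r = 0 \<or> degree r < degree g"
    using polys_over_divide[OF assms] by blast
  have g0: "g \<noteq> 0" using assms(2) by auto
  have "(q - q') * g = r" using qr by (simp add: algebra_simps)
  then have "q - q' = 0" using qr(3) g0
    by (metis degree_mult_right_le linorder_not_less mult.commute mult_eq_0_iff)
  then show ?thesis using qr by simp
qed

end

locale complex_subfield = complex_subring +
  assumes inverse_closed [intro]: "x \<in> F \<Longrightarrow> inverse x \<in> F"
begin

lemma divide_closed [intro]: "x \<in> F \<Longrightarrow> y \<in> F \<Longrightarrow> x / y \<in> F"
  by (auto simp: divide_inverse)

lemma Rats_subset: "\<rat> \<subseteq> F"
proof
  fix x :: complex assume "x \<in> \<rat>"
  then show "x \<in> F" by (cases rule: Rats_cases') (auto intro!: divide_closed)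
qed

end

definition algebraic_over :: "complex set \<Rightarrow> complex \<Rightarrow> bool" where
  "algebraic_over F x \<longleftrightarrow> (\<exists>p\<in>polys_over F. p \<noteq> 0 \<and> poly p x = 0)"

text \<open>Meaningful only for \<open>x\<close> algebraic over \<open>F\<close>; otherwise
  \<open>ARG_MIN\<close> ranges over an empty set and its value is arbitrary.\<close>

definition min_poly :: "complex set \<Rightarrow> complex \<Rightarrow> complex poly" where
  "min_poly F x = (ARG_MIN degree p. p \<in> polys_over F \<and> lead_coeff p = 1 \<and> poly p x = 0)"

text \<open>A plain set loses no multiplicities: minimal polynomials have simple roots in
  characteristic 0, so the cardinality is the degree.\<close>

definition conjugates :: "complex set \<Rightarrow> complex \<Rightarrow> complex set" where
  "conjugates F x = {y. poly (min_poly F x) y = 0}"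

context complex_subfield begin

lemma monic_annihilator:
  assumes "algebraic_over F x"
  obtains p where "p \<in> polys_over F" "lead_coeff p = 1" "poly p x = 0"
proof -
  obtain p where p: "p \<in> polys_over F" "p \<noteq> 0" "poly p x = 0"
    using assms by (auto simp: algebraic_over_def)
  show thesis
    using p by (intro that[of "smult (inverse (lead_coeff p)) p"])
      (auto intro!: polys_over_smult inverse_closed dest: polys_overD)
qed

lemma
  assumes "algebraic_over F x"
  shows min_poly_over: "min_poly F x \<in> polys_over F"
    and min_poly_monic: "lead_coeff (min_poly F x) = 1"
    and poly_min_poly: "poly (min_poly F x) x = 0"
proof -
  obtain p where "p \<in> polys_over F \<and> lead_coeff p = 1 \<and> poly p x = 0"
    using monic_annihilator[OF assms] by blast
  from arg_min_natI[where P = "\<lambda>p. p \<in> polys_over F \<and> lead_coeff p = 1 \<and> poly p x = 0", OF this]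
  show "min_poly F x \<in> polys_over F" "lead_coeff (min_poly F x) = 1" "poly (min_poly F x) x = 0"
    unfolding min_poly_def by blast+
qed

lemma min_poly_nonzero: "algebraic_over F x \<Longrightarrow> min_poly F x \<noteq> 0"
  using min_poly_monic[of x] by auto

lemma degree_min_poly_le:
  assumes "p \<in> polys_over F" "p \<noteq> 0" "poly p x = 0"
  shows "degree (min_poly F x) \<le> degree p"
proof -
  let ?q = "smult (inverse (lead_coeff p)) p"
  have "?q \<in> polys_over F \<and> lead_coeff ?q = 1 \<and> poly ?q x = 0"
    using assms by (auto intro!: polys_over_smult inverse_closed dest: polys_overD)
  from arg_min_nat_le[where P = "\<lambda>p. p \<in> polys_over F \<and> lead_coeff p = 1 \<and> poly p x = 0" and m = degree, OF this]
  have "degree (min_poly F x) \<le> degree ?q" unfolding min_poly_def .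
  then show ?thesis using assms by simp
qed

lemma min_poly_dvd:
  assumes "p \<in> polys_over F" "poly p x = 0"
  shows "min_poly F x dvd p"
proof (cases "p = 0")
  case False
  then have alg: "algebraic_over F x" using assms by (auto simp: algebraic_over_def)
  obtain q r where qr: "q \<in> polys_over F" "r \<in> polys_over F" "p = q * min_poly F x + r"
    "r = 0 \<or> degree r < degree (min_poly F x)"
    using polys_over_divide[OF min_poly_over[OF alg] min_poly_monic[OF alg] assms(1)] by blast
  have "poly r x = 0" using qr(3) assms(2) poly_min_poly[OF alg] by simp
  then have "r = 0" using qr degree_min_poly_le[of r x] by fastforce
  then show ?thesis using qr by simp
qed auto

lemma self_conjugate: "algebraic_over F x \<Longrightarrow> x \<in> conjugates F x"
  by (simp add: conjugates_def poly_min_poly)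

lemma finite_conjugates: "algebraic_over F x \<Longrightarrow> finite (conjugates F x)"
  unfolding conjugates_def using min_poly_nonzero poly_roots_finite by blast

lemma conjugate_algebraic: "algebraic_over F x \<Longrightarrow> y \<in> conjugates F x \<Longrightarrow> algebraic_over F y"
  unfolding algebraic_over_def[of F y] conjugates_def using min_poly_over[of x] min_poly_nonzero[of x] by blast

lemma conjugate_root:
  assumes "p \<in> polys_over F" "poly p x = 0" "y \<in> conjugates F x"
  shows "poly p y = 0"
  using min_poly_dvd[OF assms(1,2)] assms(3) by (auto simp: conjugates_def elim!: dvdE)

lemma degree_min_poly_pos: "algebraic_over F x \<Longrightarrow> degree (min_poly F x) > 0"
proof (rule ccontr)
  assume alg: "algebraic_over F x" and "\<not> 0 < degree (min_poly F x)"
  then obtain c where c: "min_poly F x = [:c:]" using degree_eq_zeroE by blast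
  then show False using min_poly_monic[OF alg] poly_min_poly[OF alg] by simp
qed

text \<open>The minimal polynomial of \<open>y\<close> divides that of \<open>x\<close>, with
  cofactor \<open>q\<close>. The number \<open>x\<close> is a root of one of the two factors, and
  minimality of the degree at \<open>x\<close> leaves only \<open>q = 1\<close>.\<close>

lemma conjugate_min_poly:
  assumes alg: "algebraic_over F x" and y: "y \<in> conjugates F x"
  shows "min_poly F y = min_poly F x"
proof -
  have algy: "algebraic_over F y" by (rule conjugate_algebraic[OF assms])
  have "min_poly F y dvd min_poly F x"
    using min_poly_dvd[OF min_poly_over[OF alg]] y by (simp add: conjugates_def)
  then obtain q where q: "min_poly F x = q * min_poly F y" by (auto simp: dvd_def mult.commute)
  have qF: "q \<in> polys_over F"
    by (rule polys_over_cofactor[OF min_poly_over[OF algy] min_poly_monic[OF algy]])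
      (use q min_poly_over[OF alg] in simp)
  have lq: "lead_coeff q = 1"
    using q min_poly_monic[OF alg] min_poly_monic[OF algy] by (metis lead_coeff_mult mult.right_neutral)
  have nz: "min_poly F x \<noteq> 0" "min_poly F y \<noteq> 0" "q \<noteq> 0"
    using min_poly_nonzero alg algy lq by auto
  have deg: "degree (min_poly F x) = degree q + degree (min_poly F y)"
    using q nz by (simp add: degree_mult_eq)
  have "poly q x = 0 \<or> poly (min_poly F y) x = 0"
    using poly_min_poly[OF alg] q by simp
  then show ?thesis
  proof
    assume "poly q x = 0"
    then have "degree (min_poly F x) \<le> degree q" using degree_min_poly_le[OF qF nz(3)] by blast
    then have "degree (min_poly F y) = 0" using deg by simp
    then show ?thesis using degree_min_poly_pos[OF algy] by simp
  next
    assume "poly (min_poly F y) x = 0"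
    then have "degree (min_poly F x) \<le> degree (min_poly F y)"
      using degree_min_poly_le[OF min_poly_over[OF algy] nz(2)] by blast
    then have "degree q = 0" using deg by simp
    then obtain c where "q = [:c:]" using degree_eq_zeroE by blast
    then have "q = 1" using lq by (simp add: one_pCons)
    then show ?thesis using q by simp
  qed
qed

lemma conjugates_eq: "algebraic_over F x \<Longrightarrow> y \<in> conjugates F x \<Longrightarrow> conjugates F y = conjugates F x"
  using conjugate_min_poly[of x y] by (simp add: conjugates_def)

text \<open>A double root \<open>y\<close> is also a root of the derivative, whose degree is smaller
  than that of the minimal polynomial of \<open>y\<close>, which is the one of
  \<open>x\<close>.\<close>

lemma min_poly_rsquarefree:
  assumes alg: "algebraic_over F x"
  shows "rsquarefree (min_poly F x)"
  unfolding rsquarefree_roots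
proof (intro allI notI, elim conjE)
  fix y assume y: "poly (min_poly F x) y = 0" "poly (pderiv (min_poly F x)) y = 0"
  then have yc: "y \<in> conjugates F x" by (simp add: conjugates_def)
  have nz: "pderiv (min_poly F x) \<noteq> 0"
    using degree_min_poly_pos[OF alg] by (simp add: pderiv_eq_0_iff)
  have "degree (min_poly F y) \<le> degree (pderiv (min_poly F x))"
    by (rule degree_min_poly_le) (use y nz min_poly_over[OF alg] in auto)
  then show False
    using conjugate_min_poly[OF alg yc] degree_min_poly_pos[OF alg] by (simp add: degree_pderiv)
qed

lemma min_poly_eq_prod:
  assumes alg: "algebraic_over F x"
  shows "min_poly F x = (\<Prod>y\<in>conjugates F x. [:- y, 1:])"
proof -
  have "smult 1 (\<Prod>y | poly (min_poly F x) y = 0. [:- y, 1:]) = min_poly F x"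
    using complex_poly_decompose_rsquarefree[OF min_poly_rsquarefree[OF alg]]
    unfolding min_poly_monic[OF alg] .
  then show ?thesis by (simp add: conjugates_def)
qed

lemma card_conjugates:
  assumes alg: "algebraic_over F x"
  shows "card (conjugates F x) = degree (min_poly F x)"
  by (simp add: min_poly_eq_prod[OF alg] degree_prod_eq_sum_degree)

end


section \<open>Power sums and symmetric functions of the conjugates\<close>

lemma fps_deriv_prod_linear:
  fixes y :: "'i \<Rightarrow> complex"
  assumes "finite I"
  shows "fps_deriv (\<Prod>i\<in>I. 1 - fps_const (y i) * fps_X) =
           - (\<Prod>i\<in>I. 1 - fps_const (y i) * fps_X) * Abs_fps (\<lambda>k. \<Sum>i\<in>I. y i ^ Suc k)"
  using assms
proof (induction I)
  case empty
  then show ?case by (auto simp: fps_eq_iff)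
next
  case (insert a I)
  let ?E = "\<Prod>i\<in>I. 1 - fps_const (y i) * fps_X"
  let ?S = "Abs_fps (\<lambda>k. \<Sum>i\<in>I. y i ^ Suc k)"
  let ?l = "1 - fps_const (y a) * fps_X"
  let ?G = "Abs_fps (\<lambda>k. y a ^ Suc k)"
  \<comment> \<open>The geometric series of the new factor. It turns the product rule into the
    logarithmic derivative of the product, \<open>E' / E = - S\<close>.\<close>
  have geo: "?l * ?G = fps_const (y a)"
  proof (rule fps_ext)
    fix n show "(?l * ?G) $ n = fps_const (y a) $ n"
      by (cases n) (simp_all add: algebra_simps)
  qed
  have S: "Abs_fps (\<lambda>k. \<Sum>i\<in>insert a I. y i ^ Suc k) = ?G + ?S"
    using insert.hyps by (auto simp: fps_eq_iff)
  have P: "(\<Prod>i\<in>insert a I. 1 - fps_const (y i) * fps_X) = ?l * ?E"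
    using insert.hyps by simp
  have "fps_deriv (?l * ?E) = - fps_const (y a) * ?E + ?l * (- ?E * ?S)"
    using insert.IH by (simp add: algebra_simps fps_const_neg[symmetric] del: fps_const_neg)
  also have "\<dots> = - (?l * ?E) * (?G + ?S)"
  proof -
    have "- (l * E) * (G + S) = - c * E + l * (- E * S)" if "l * G = c" for l G S E c :: "complex fps"
      unfolding that[symmetric] by (simp add: algebra_simps)
    from this[OF geo] show ?thesis by simp
  qed
  finally show ?case unfolding S P .
qed

lemma reflect_poly_linear: "reflect_poly [:- c, 1:] = [:1, - c:]" for c :: complex
  by (rule poly_eqI) (auto simp: coeff_reflect_poly coeff_pCons split: nat.splits)

context complex_subfield begin

text \<open>Newton's identities, read off from \<open>E' = - E * S\<close> for \<open>E = \<Prod>(1 - y\<^sub>i X)\<close> and the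
  generating function \<open>S\<close> of the power sums.\<close>

lemma prod_over_iff_power_sums:
  fixes y :: "'i \<Rightarrow> complex"
  assumes fin: "finite I"
  shows "(\<Prod>i\<in>I. [:- y i, 1:]) \<in> polys_over F \<longleftrightarrow> (\<forall>k. (\<Sum>i\<in>I. y i ^ k) \<in> F)"
proof -
  define P where "P = (\<Prod>i\<in>I. [:- y i, 1:])"
  define Q where "Q = (\<Prod>i\<in>I. [:1, - y i:])"
  define E where "E = (\<Prod>i\<in>I. 1 - fps_const (y i) * fps_X)"
  define S where "S = Abs_fps (\<lambda>k. \<Sum>i\<in>I. y i ^ Suc k)"
  have dE: "fps_deriv E = - E * S"
    unfolding E_def S_def by (rule fps_deriv_prod_linear[OF fin])
  have QE: "fps_of_poly Q = E"
    unfolding Q_def E_def by (simp add: fps_of_poly_prod fps_of_poly_pCons fps_const_neg[symmetric] del: fps_const_neg)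
  \<comment> \<open>The series \<open>E\<close> lists the coefficients of \<open>P\<close> in
    reverse order, so the two have their coefficients in \<open>F\<close> together.\<close>
  have QP: "Q = reflect_poly P"
    unfolding Q_def P_def by (simp add: reflect_poly_prod reflect_poly_linear)
  have PF: "P \<in> polys_over F \<longleftrightarrow> (\<forall>n. E $ n \<in> F)"
  proof
    assume "P \<in> polys_over F"
    then show "\<forall>n. E $ n \<in> F"
      unfolding QE[symmetric] QP by (auto simp: coeff_reflect_poly polys_overD)
  next
    assume E: "\<forall>n. E $ n \<in> F"
    show "P \<in> polys_over F" unfolding polys_over_def
    proof (intro CollectI allI)
      fix i show "coeff P i \<in> F"
      proof (cases "i \<le> degree P")
        case True
        then have "coeff P i = E $ (degree P - i)"
          unfolding QE[symmetric] QP by (auto simp: coeff_reflect_poly)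
        then show ?thesis using E by simp
      qed (simp add: coeff_eq_0)
    qed
  qed
  have E0: "E $ 0 = 1" unfolding E_def using fin by (induction I) auto
  \<comment> \<open>Newton's identities: solving for \<open>E $ Suc n\<close> divides by
    \<open>Suc n\<close>, which needs characteristic 0, and solving for \<open>S $ n\<close> uses
    \<open>E $ 0 = 1\<close>.\<close>
  have step: "of_nat (Suc n) * E $ Suc n = - (\<Sum>i=0..n. E $ i * S $ (n - i))" for n
    using arg_cong[OF dE, of "\<lambda>f. f $ n"] by (simp add: fps_mult_nth sum_negf)
  have "(\<forall>n. E $ n \<in> F) \<longleftrightarrow> (\<forall>n. S $ n \<in> F)"
  proof
    assume SF: "\<forall>n. S $ n \<in> F"
    show "\<forall>n. E $ n \<in> F"
    proof
      fix n show "E $ n \<in> F"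
      proof (induction n rule: less_induct)
        case (less n)
        show ?case
        proof (cases n)
          case (Suc m)
          have "E $ Suc m = - (\<Sum>i=0..m. E $ i * S $ (m - i)) / of_nat (Suc m)"
            using step[of m] by (simp add: field_simps del: of_nat_Suc)
          also have "\<dots> \<in> F"
            using less SF Suc by (intro divide_closed uminus_closed sum_closed mult_closed) auto
          finally show ?thesis using Suc by simp
        qed (simp add: E0)
      qed
    qed
  next
    assume EF: "\<forall>n. E $ n \<in> F"
    show "\<forall>n. S $ n \<in> F"
    proof
      fix n show "S $ n \<in> F"
      proof (induction n rule: less_induct)
        case (less n)
        have "S $ n = - of_nat (Suc n) * E $ Suc n - (\<Sum>i=Suc 0..n. E $ i * S $ (n - i))"
        proof -
          have "(\<Sum>i=0..n. E $ i * S $ (n - i)) = S $ n + (\<Sum>i=Suc 0..n. E $ i * S $ (n - i))"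
            by (simp add: sum.atLeast_Suc_atMost E0)
          moreover have "a = - b \<Longrightarrow> b = s + t \<Longrightarrow> s = - a - t" for a b s t :: complex
            by simp
          ultimately show ?thesis using step[of n] by (metis mult_minus_left)
        qed
        also have "\<dots> \<in> F"
          using less EF by (intro diff_closed uminus_closed sum_closed mult_closed of_nat_closed) auto
        finally show ?case .
      qed
    qed
  qed
  also have "\<dots> \<longleftrightarrow> (\<forall>k. (\<Sum>i\<in>I. y i ^ k) \<in> F)"
  proof
    assume *: "\<forall>n. S $ n \<in> F"
    show "\<forall>k. (\<Sum>i\<in>I. y i ^ k) \<in> F"
    proof
      \<comment> \<open>The series \<open>S\<close> starts with first powers; the power sum for
        \<open>k = 0\<close> is the number of indices.\<close>
      fix k show "(\<Sum>i\<in>I. y i ^ k) \<in> F"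
        using * by (cases k) (auto simp: S_def)
    qed
  qed (auto simp: S_def simp del: power_Suc)
  finally show ?thesis using PF by (simp add: P_def)
qed

lemma sum_conjugates_over:
  assumes alg: "algebraic_over F t" and P: "P \<in> polys_over F"
  shows "(\<Sum>s\<in>conjugates F t. poly P s) \<in> F"
proof -
  have "(\<Prod>s\<in>conjugates F t. [:- s, 1:]) \<in> polys_over F"
    using min_poly_over[OF alg] min_poly_eq_prod[OF alg] by simp
  then have ps: "(\<Sum>s\<in>conjugates F t. s ^ k) \<in> F" for k
    using prod_over_iff_power_sums[OF finite_conjugates[OF alg], of "\<lambda>s. s"] by auto
  have "(\<Sum>s\<in>conjugates F t. poly P s) =
      (\<Sum>i\<le>degree P. coeff P i * (\<Sum>s\<in>conjugates F t. s ^ i))"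
    unfolding poly_altdef sum_distrib_left by (rule sum.swap)
  also have "\<dots> \<in> F" by (rule sum_closed) (auto intro!: mult_closed ps polys_overD[OF P])
  finally show ?thesis .
qed

text \<open>By the criterion on power sums: the \<open>k\<close>-th power sum of the values
  \<open>poly P s\<close> is the sum of \<open>P ^ k\<close> over the conjugates, which lies in
  \<open>F\<close>. The product is the characteristic polynomial of \<open>poly P t\<close>.\<close>

lemma prod_conjugates_over:
  assumes alg: "algebraic_over F t" and P: "P \<in> polys_over F"
  shows "(\<Prod>s\<in>conjugates F t. [:- poly P s, 1:]) \<in> polys_over F"
  unfolding prod_over_iff_power_sums[OF finite_conjugates[OF alg]] poly_power[symmetric]
  using sum_conjugates_over[OF alg polys_over_power[OF P]] by blast

lemma algebraic_over_poly:
  assumes alg: "algebraic_over F t" and P: "P \<in> polys_over F"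
  shows "algebraic_over F (poly P t)"
  unfolding algebraic_over_def
proof (intro bexI conjI)
  show "(\<Prod>s\<in>conjugates F t. [:- poly P s, 1:]) \<in> polys_over F"
    by (rule prod_conjugates_over[OF assms])
  show "(\<Prod>s\<in>conjugates F t. [:- poly P s, 1:]) \<noteq> 0"
    using finite_conjugates[OF alg] by auto
  show "poly (\<Prod>s\<in>conjugates F t. [:- poly P s, 1:]) (poly P t) = 0"
    using finite_conjugates[OF alg] self_conjugate[OF alg] by (auto simp: poly_prod)
qed

lemma poly_conjugate:
  assumes alg: "algebraic_over F t" and P: "P \<in> polys_over F" and s: "s \<in> conjugates F t"
  shows "poly P s \<in> conjugates F (poly P t)"
proof -
  let ?m = "min_poly F (poly P t)"
  have "poly (pcompose ?m P) s = 0"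
    by (rule conjugate_root[OF _ _ s])
      (use min_poly_over poly_min_poly algebraic_over_poly[OF alg P] P in \<open>auto simp: poly_pcompose\<close>)
  then show ?thesis by (simp add: conjugates_def poly_pcompose)
qed

text \<open>Every root of \<open>g\<close> has the same minimal polynomial as \<open>x\<close>, so
  one copy of it can be split off as long as \<open>g\<close> is not constant.\<close>

lemma power_of_min_poly:
  assumes alg: "algebraic_over F x" and "g \<in> polys_over F" "lead_coeff g = 1"
    and "\<And>y. poly g y = 0 \<Longrightarrow> y \<in> conjugates F x"
  shows "\<exists>e. g = min_poly F x ^ e"
  using assms(2-)
proof (induction "degree g" arbitrary: g rule: less_induct)
  case less
  show ?case
  proof (cases "degree g = 0")
    case True
    then obtain c where "g = [:c:]" using degree_eq_zeroE by blast
    then have "g = min_poly F x ^ 0" using less.prems by (simp add: one_pCons)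
    then show ?thesis ..
  next
    case False
    then obtain y where y: "poly g y = 0"
      using fundamental_theorem_of_algebra[of g] by (auto simp: constant_degree)
    have yc: "y \<in> conjugates F x" using less.prems y by blast
    have "min_poly F x dvd g"
      using min_poly_dvd[OF less.prems(1) y] conjugate_min_poly[OF alg yc] by simp
    then obtain q where q: "g = q * min_poly F x" by (auto simp: dvd_def mult.commute)
    have qF: "q \<in> polys_over F"
      by (rule polys_over_cofactor[OF min_poly_over[OF alg] min_poly_monic[OF alg]])
        (use q less.prems in simp)
    have lq: "lead_coeff q = 1"
      using q less.prems(2) min_poly_monic[OF alg] by (metis lead_coeff_mult mult.right_neutral)
    have nz: "q \<noteq> 0" using lq by auto
    have "degree q < degree g"
      using q nz min_poly_nonzero[OF alg] degree_min_poly_pos[OF alg] by (simp add: degree_mult_eq)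
    from less.hyps[OF this qF lq] obtain e where "q = min_poly F x ^ e"
      using less.prems(3) q by auto
    then have "g = min_poly F x ^ Suc e" using q by (simp add: mult.commute)
    then show ?thesis ..
  qed
qed

text \<open>The characteristic polynomial of \<open>poly P t\<close> has only conjugates of
  \<open>poly P t\<close> as roots, hence is a power of the minimal polynomial. Comparing roots with
  multiplicity shows that each conjugate is hit equally often; \<open>e\<close> is the degree of
  F(t) over the subfield generated by \<open>poly P t\<close>.\<close>

lemma conjugates_image_mset:
  assumes alg: "algebraic_over F t" and P: "P \<in> polys_over F"
  obtains e where "e > 0" "image_mset (poly P) (mset_set (conjugates F t)) =
    repeat_mset e (mset_set (conjugates F (poly P t)))"
proof -
  let ?x = "poly P t"
  let ?g = "\<Prod>s\<in>conjugates F t. [:- poly P s, 1:]"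
  have fin: "finite (conjugates F t)" by (rule finite_conjugates[OF alg])
  have algx: "algebraic_over F ?x" by (rule algebraic_over_poly[OF assms])
  have finx: "finite (conjugates F ?x)" by (rule finite_conjugates[OF algx])
  have g0: "?g \<noteq> 0" using fin by auto
  obtain e where e: "?g = min_poly F ?x ^ e"
  proof -
    have "\<exists>e. ?g = min_poly F ?x ^ e"
    proof (rule power_of_min_poly[OF algx prod_conjugates_over[OF assms]])
      show "lead_coeff ?g = 1" unfolding lead_coeff_prod by simp
      fix y assume "poly ?g y = 0"
      then obtain s where "s \<in> conjugates F t" "y = poly P s"
        using fin by (auto simp: poly_prod)
      then show "y \<in> conjugates F ?x" using poly_conjugate[OF alg P] by simp
    qed
    then show thesis using that by blast
  qed
  have pr: "proots (\<Prod>s\<in>A. [:- f s, 1:]) = image_mset f (mset_set A)" if "finite A" for A and f :: "complex \<Rightarrow> complex"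
    using that by (subst proots_prod) (auto, induction A rule: finite_induct, auto)
  have "image_mset (poly P) (mset_set (conjugates F t)) = proots ?g"
    by (rule pr[OF fin, symmetric])
  also have "\<dots> = repeat_mset e (proots (min_poly F ?x))"
    unfolding e by (rule proots_power)
  also have "proots (min_poly F ?x) = mset_set (conjugates F ?x)"
    using pr[OF finx, of "\<lambda>x. x"] min_poly_eq_prod[OF algx] by simp
  finally have eq: "image_mset (poly P) (mset_set (conjugates F t)) =
    repeat_mset e (mset_set (conjugates F ?x))" .
  moreover have "e > 0"
    using arg_cong[OF eq, of size] self_conjugate[OF alg] fin
    by (cases e) (auto simp: card_eq_0_iff)
  ultimately show thesis using that by blast
qed

text \<open>Transitivity of norms, for an arbitrary function \<open>f\<close> of the conjugates:
  norms take the identity for \<open>f\<close>, heights take the local factor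
  \<open>max 1 (ext_abs p y)\<close>.\<close>

lemma conjugates_prod:
  assumes "algebraic_over F t" and "P \<in> polys_over F"
  obtains e where "e > 0" "card (conjugates F t) = e * card (conjugates F (poly P t))"
    "\<And>f :: complex \<Rightarrow> 'a :: comm_monoid_mult.
       (\<Prod>s\<in>conjugates F t. f (poly P s)) = (\<Prod>y\<in>conjugates F (poly P t). f y) ^ e"
proof -
  obtain e where e: "e > 0" "image_mset (poly P) (mset_set (conjugates F t)) =
    repeat_mset e (mset_set (conjugates F (poly P t)))"
    by (rule conjugates_image_mset[OF assms])
  show thesis
  proof (rule that[OF e(1)])
    show "card (conjugates F t) = e * card (conjugates F (poly P t))"
      using arg_cong[OF e(2), of size] by simp
    fix f :: "complex \<Rightarrow> 'a"
    have "(\<Prod>s\<in>conjugates F t. f (poly P s)) = prod_mset (image_mset f (image_mset (poly P) (mset_set (conjugates F t))))"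
      by (simp add: prod_unfold_prod_mset multiset.map_comp o_def)
    also have "\<dots> = prod_mset (repeat_mset e (image_mset f (mset_set (conjugates F (poly P t)))))"
      unfolding e(2) by (induction e) auto
    also have "\<dots> = (\<Prod>y\<in>conjugates F (poly P t). f y) ^ e"
      by (induction e) (auto simp: prod_unfold_prod_mset)
    finally show "(\<Prod>s\<in>conjugates F t. f (poly P s)) = (\<Prod>y\<in>conjugates F (poly P t). f y) ^ e" .
  qed
qed

end


section \<open>Primitive elements\<close>

text \<open>Only polynomial expressions in \<open>t\<close> are taken; for \<open>t\<close>
  algebraic over \<open>F\<close> they already form a field.\<close>

definition adjoin :: "complex set \<Rightarrow> complex \<Rightarrow> complex set" where
  "adjoin F t = {poly P t | P. P \<in> polys_over F}"

context complex_subfield begin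

lemma adjoinI: "P \<in> polys_over F \<Longrightarrow> poly P t \<in> adjoin F t"
  by (auto simp: adjoin_def)

lemma subset_adjoin: "F \<subseteq> adjoin F t"
proof
  fix x assume "x \<in> F"
  then show "x \<in> adjoin F t" using adjoinI[of "[:x:]" t] by simp
qed

lemma self_adjoin: "t \<in> adjoin F t"
  using adjoinI[of "[:0, 1:]" t] by simp

lemma adjoin_trans:
  assumes "t \<in> adjoin F s"
  shows "adjoin F t \<subseteq> adjoin F s"
proof
  fix x assume "x \<in> adjoin F t"
  then obtain P Q where "P \<in> polys_over F" "Q \<in> polys_over F" "x = poly P (poly Q s)"
    using assms by (auto simp: adjoin_def)
  then show "x \<in> adjoin F s"
    using adjoinI[of "pcompose P Q" s] by (auto simp: poly_pcompose)
qed

lemma algebraic_over_adjoin: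
  "algebraic_over F t \<Longrightarrow> x \<in> adjoin F t \<Longrightarrow> algebraic_over F x"
  unfolding adjoin_def using algebraic_over_poly by blast

text \<open>Inverses are the point. If the minimal polynomial of \<open>x\<close> is
  \<open>pCons c h\<close>, then \<open>c + x * poly h x = 0\<close>, so a nonzero \<open>x\<close>
  has inverse \<open>- poly h x / c\<close>; here \<open>c\<close> is nonzero because
  \<open>h\<close> has too small a degree to vanish at \<open>x\<close>.\<close>

lemma subfield_adjoin:
  assumes alg: "algebraic_over F t"
  shows "complex_subfield (adjoin F t)"
proof
  show "1 \<in> adjoin F t" using subset_adjoin one_closed by blast
next
  fix x y assume "x \<in> adjoin F t" "y \<in> adjoin F t"
  then obtain P Q where PQ: "P \<in> polys_over F" "Q \<in> polys_over F" "x = poly P t" "y = poly Q t"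
    by (auto simp: adjoin_def)
  show "x - y \<in> adjoin F t" using PQ adjoinI[of "P - Q" t] by auto
  show "x * y \<in> adjoin F t" using PQ adjoinI[of "P * Q" t] by auto
next
  fix x assume "x \<in> adjoin F t"
  then obtain P where P: "P \<in> polys_over F" "x = poly P t"
    by (auto simp: adjoin_def)
  have algx: "algebraic_over F x" using algebraic_over_poly[OF alg] P by simp
  show "inverse x \<in> adjoin F t"
  proof (cases "x = 0")
    case False
    obtain c h where m: "min_poly F x = pCons c h" by (cases "min_poly F x")
    have ch: "c \<in> F" "h \<in> polys_over F" using min_poly_over[OF algx] m by auto
    have eq: "c + x * poly h x = 0" using poly_min_poly[OF algx] m by simp
    have "h \<noteq> 0" using degree_min_poly_pos[OF algx] m by auto
    then have "degree h < degree (min_poly F x)" using m by simp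
    then have "poly h x \<noteq> 0" using degree_min_poly_le[OF ch(2) \<open>h \<noteq> 0\<close>] by fastforce
    then have "c \<noteq> 0" using eq False by auto
    then have "inverse x = poly (smult (- inverse c) (pcompose h P)) t"
      using eq False P(2) by (simp add: poly_pcompose field_simps add_eq_0_iff)
    moreover have "smult (- inverse c) (pcompose h P) \<in> polys_over F"
      using ch P(1) by (intro polys_over_smult polys_over_pcompose uminus_closed inverse_closed)
    ultimately show ?thesis using adjoinI by metis
  qed (use subset_adjoin in auto)
qed

text \<open>The product over all pairs of conjugates is an annihilating polynomial: by the binomial
  theorem its power sums are combinations of products of power sums of the conjugates of
  \<open>a\<close> and of \<open>b\<close>. The factor \<open>c\<close> is what the primitive
  element needs.\<close>

lemma algebraic_over_add:
  assumes a: "algebraic_over F a" and b: "algebraic_over F b"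
  shows "algebraic_over F (a + of_nat c * b)"
proof -
  let ?I = "conjugates F a \<times> conjugates F b"
  let ?y = "\<lambda>p. fst p + of_nat c * snd p"
  have fin: "finite ?I" using finite_conjugates a b by auto
  have ps: "(\<Sum>s\<in>conjugates F t. s ^ k) \<in> F" if "algebraic_over F t" for t k
    using sum_conjugates_over[OF that polys_over_power, of "[:0, 1:]" k] by (simp add: poly_power)
  have "(\<Sum>p\<in>?I. ?y p ^ k) \<in> F" for k
  proof -
    have "(\<Sum>p\<in>?I. ?y p ^ k) = (\<Sum>s\<in>conjugates F a. \<Sum>t\<in>conjugates F b. (s + of_nat c * t) ^ k)"
      by (simp add: sum.cartesian_product case_prod_unfold)
    also have "\<dots> = (\<Sum>s\<in>conjugates F a. \<Sum>t\<in>conjugates F b.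
        \<Sum>i\<le>k. of_nat (k choose i) * s ^ i * (of_nat c * t) ^ (k - i))"
      by (simp add: binomial_ring)
    also have "\<dots> = (\<Sum>s\<in>conjugates F a. \<Sum>i\<le>k. \<Sum>t\<in>conjugates F b.
        of_nat (k choose i) * s ^ i * (of_nat c * t) ^ (k - i))"
      by (intro sum.cong refl sum.swap)
    also have "\<dots> = (\<Sum>i\<le>k. \<Sum>s\<in>conjugates F a. \<Sum>t\<in>conjugates F b.
        of_nat (k choose i) * s ^ i * (of_nat c * t) ^ (k - i))"
      by (rule sum.swap)
    also have "\<dots> = (\<Sum>i\<le>k. of_nat (k choose i) * of_nat c ^ (k - i) *
        ((\<Sum>s\<in>conjugates F a. s ^ i) * (\<Sum>t\<in>conjugates F b. t ^ (k - i))))"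
      by (simp add: sum_product sum_distrib_left power_mult_distrib mult_ac)
        (rule sum.cong[OF refl], rule sum.swap)
    also have "\<dots> \<in> F" by (intro sum_closed mult_closed power_closed of_nat_closed ps a b)
    finally show ?thesis .
  qed
  then have PF: "(\<Prod>p\<in>?I. [:- ?y p, 1:]) \<in> polys_over F"
    using prod_over_iff_power_sums[OF fin, of ?y] by blast
  have "(a, b) \<in> ?I" using self_conjugate a b by auto
  then have "\<exists>p\<in>?I. poly [:- ?y p, 1:] (a + of_nat c * b) = 0"
    by (intro bexI[of _ "(a, b)"]) auto
  then have "poly (\<Prod>p\<in>?I. [:- ?y p, 1:]) (a + of_nat c * b) = 0"
    using fin by (simp only: poly_prod prod_zero_iff)
  moreover have "(\<Prod>p\<in>?I. [:- ?y p, 1:]) \<noteq> 0" using fin by (simp add: prod_zero_iff)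
  ultimately show ?thesis using PF by (auto simp: algebraic_over_def)
qed

text \<open>With \<open>t = a + c * b\<close>, the minimal polynomial of \<open>b\<close> over F(t)
  divides both \<open>min_poly F b\<close> and \<open>min_poly F a\<close> composed with
  \<open>t - c * X\<close>. A suitable \<open>c\<close> leaves \<open>b\<close> as their only common
  root, so this polynomial is linear and \<open>b\<close> lies in F(t).\<close>

lemma primitive_element_two:
  assumes a: "algebraic_over F a" and b: "algebraic_over F b"
  obtains t where "algebraic_over F t" "a \<in> adjoin F t" "b \<in> adjoin F t"
proof -
  \<comment> \<open>These quotients are the bad values of \<open>c\<close>: another common root
    \<open>y\<close> of the two polynomials would give \<open>t - c * y = s\<close> for a conjugate
    \<open>s\<close> of \<open>a\<close>.\<close>
  have "finite ((\<lambda>(s, y). (s - a) / (b - y)) ` (conjugates F a \<times> conjugates F b))"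
    (is "finite ?X") using finite_conjugates a b by auto
  then have "finite {c::nat. of_nat c \<in> ?X}"
    using finite_vimageI[OF _ inj_of_nat, of ?X] by (simp add: vimage_def)
  then obtain c :: nat where c: "of_nat c \<notin> ?X"
    using ex_new_if_finite infinite_UNIV_nat by blast
  define t where "t = a + of_nat c * b"
  have algt: "algebraic_over F t" unfolding t_def by (rule algebraic_over_add[OF a b])
  interpret E: complex_subfield "adjoin F t" by (rule subfield_adjoin[OF algt])
  have FE: "polys_over F \<subseteq> polys_over (adjoin F t)"
    by (rule polys_over_mono[OF subset_adjoin])
  have algbE: "algebraic_over (adjoin F t) b"
    using b FE unfolding algebraic_over_def by blast
  let ?m = "min_poly (adjoin F t) b"
  have dvd1: "?m dvd min_poly F b"
    using E.min_poly_dvd[of "min_poly F b" b] FE min_poly_over[OF b] poly_min_poly[OF b] by auto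
  define q where "q = pcompose (min_poly F a) [:t, - of_nat c:]"
  have qE: "q \<in> polys_over (adjoin F t)"
    unfolding q_def using FE min_poly_over[OF a] self_adjoin E.uminus_closed[OF E.of_nat_closed]
    by (intro E.polys_over_pcompose) (auto simp: E.polys_over_pCons simp del: of_nat_closed)
  have "poly q b = 0" unfolding q_def t_def using poly_min_poly[OF a] by (simp add: poly_pcompose)
  then have dvd2: "?m dvd q" using E.min_poly_dvd[OF qE] by blast
  have root: "y = b" if "poly ?m y = 0" for y
  proof (rule ccontr)
    assume ne: "y \<noteq> b"
    have "y \<in> conjugates F b" using dvd1 that by (auto simp: conjugates_def elim!: dvdE)
    moreover have "poly q y = 0" using dvd2 that by (auto elim!: dvdE)
    then have "t - y * of_nat c \<in> conjugates F a" by (simp add: conjugates_def q_def poly_pcompose)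
    moreover have "of_nat c = ((t - y * of_nat c) - a) / (b - y)"
      using ne by (simp add: t_def field_simps)
    ultimately show False using c by (auto simp: image_iff)
  qed
  have "conjugates (adjoin F t) b = {b}"
    using root E.self_conjugate[OF algbE] by (auto simp: conjugates_def)
  then have "?m = [:- b, 1:]" using E.min_poly_eq_prod[OF algbE] by simp
  then have "- b \<in> adjoin F t" using E.min_poly_over[OF algbE] by (simp add: E.polys_over_pCons)
  then have bE: "b \<in> adjoin F t" using E.uminus_closed by fastforce
  have "a = t - of_nat c * b" by (simp add: t_def)
  then have "a \<in> adjoin F t" using bE self_adjoin E.of_nat_closed by (metis E.diff_closed E.mult_closed)
  then show thesis using that algt bE by blast
qed

lemma primitive_element:
  assumes "finite S" "\<And>x. x \<in> S \<Longrightarrow> algebraic_over F x"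
  obtains t where "algebraic_over F t" "S \<subseteq> adjoin F t"
proof -
  have "\<exists>t. algebraic_over F t \<and> S \<subseteq> adjoin F t"
    using assms
  proof (induction S rule: finite_induct)
    case empty
    have "algebraic_over F 1" unfolding algebraic_over_def
      by (intro bexI[of _ "[:-1, 1:]"]) (auto intro: uminus_closed)
    then show ?case by auto
  next
    case (insert b S)
    then obtain t where t: "algebraic_over F t" "S \<subseteq> adjoin F t" by auto
    obtain s where s: "algebraic_over F s" "t \<in> adjoin F s" "b \<in> adjoin F s"
      using primitive_element_two[OF t(1), of b] insert.prems by auto
    then show ?case using adjoin_trans[OF s(2)] t by auto
  qed
  then show thesis using that by blast
qed

end

interpretation rat: complex_subfield "\<rat> :: complex set"
  by unfold_locales auto

lemma algebraic_over_Rats: "algebraic_over \<rat> x \<longleftrightarrow> algebraic x"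
  unfolding algebraic_over_def algebraic_altdef polys_over_def by auto


section \<open>Extension of p-adic absolute values to the algebraic numbers\<close>

text \<open>Differences and products of two algebraic numbers lie in a field generated by one
  algebraic number, all of whose elements are algebraic.\<close>

lemma algebraic_subfield: "complex_subfield {x. algebraic x}"
proof -
  have cl: "algebraic (f x y)"
    if xy: "algebraic x" "algebraic y" and f: "\<And>E. complex_subfield E \<Longrightarrow> x \<in> E \<Longrightarrow> y \<in> E \<Longrightarrow> f x y \<in> E"
    for x y :: complex and f
  proof -
    obtain t where t: "algebraic_over \<rat> t" "{x, y} \<subseteq> adjoin \<rat> t"
      using rat.primitive_element[of "{x, y}"] xy by (auto simp: algebraic_over_Rats)
    have "f x y \<in> adjoin \<rat> t" using f[OF rat.subfield_adjoin[OF t(1)]] t(2) by auto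
    then show ?thesis using rat.algebraic_over_adjoin[OF t(1)] algebraic_over_Rats by blast
  qed
  show ?thesis
  proof
    fix x y :: complex assume "x \<in> {x. algebraic x}" "y \<in> {x. algebraic x}"
    then have xy: "algebraic x" "algebraic y" by auto
    show "x - y \<in> {x. algebraic x}" "x * y \<in> {x. algebraic x}"
      using cl[OF xy, of "(-)"] cl[OF xy, of "(*)"] complex_subring.diff_closed complex_subring.mult_closed
        complex_subfield.axioms(1) by blast+
  qed auto
qed

interpretation alg: complex_subfield "{x. algebraic x}"
  by (rule algebraic_subfield)

text \<open>A subring of the complex numbers that is maximal among those not containing \<open>1/p\<close> is a
  valuation ring; it defines an absolute value on the algebraic numbers.\<close>

locale maximal_avoiding = complex_subring B for B :: "complex set" +
  fixes p :: nat
  assumes prime: "normalization_semidom_class.prime p"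
    and avoid: "1 / of_nat p \<notin> B"
    and maximal: "\<And>C. complex_subring C \<Longrightarrow> B \<subseteq> C \<Longrightarrow> 1 / of_nat p \<notin> C \<Longrightarrow> C = B"
begin

abbreviation P :: complex where "P \<equiv> of_nat p"

lemma P0: "P \<noteq> 0"
  using prime_gt_0_nat[OF prime] by simp

lemma subring_adjoin: "complex_subring (adjoin B x)"
proof
  show "1 \<in> adjoin B x" unfolding adjoin_def by (intro CollectI exI[of _ 1]) auto
next
  fix u v assume "u \<in> adjoin B x" "v \<in> adjoin B x"
  then obtain R Q where PQ: "R \<in> polys_over B" "Q \<in> polys_over B" "u = poly R x" "v = poly Q x"
    by (auto simp: adjoin_def)
  show "u - v \<in> adjoin B x" unfolding adjoin_def using PQ by (intro CollectI exI[of _ "R - Q"]) auto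
  show "u * v \<in> adjoin B x" unfolding adjoin_def using PQ by (intro CollectI exI[of _ "R * Q"]) auto
qed

text \<open>By maximality, the larger ring generated by \<open>B\<close> and \<open>x\<close>
  contains \<open>1 / P\<close>.\<close>

lemma not_mem_imp_poly:
  assumes "x \<notin> B"
  obtains R where "R \<in> polys_over B" "poly R x = 1 / P"
proof -
  have "B \<subseteq> adjoin B x"
  proof
    fix b assume "b \<in> B"
    then show "b \<in> adjoin B x" unfolding adjoin_def by (intro CollectI exI[of _ "[:b:]"]) auto
  qed
  moreover have "x \<in> adjoin B x" unfolding adjoin_def by (intro CollectI exI[of _ "[:0, 1:]"]) auto
  ultimately have "1 / P \<in> adjoin B x" using maximal[OF subring_adjoin] assms by blast
  then show thesis using that unfolding adjoin_def by auto
qed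

text \<open>Clears denominators in an expression in \<open>inverse x\<close>: \<open>Q\<close> is
  the reversed polynomial, padded by a power of the variable.\<close>

lemma homogenize:
  assumes "R \<in> polys_over B" "degree R \<le> n" "x \<noteq> 0"
  obtains Q where "Q \<in> polys_over B" "degree Q \<le> n" "poly Q x = x ^ n * poly R (inverse x)"
proof
  let ?Q = "monom 1 (n - degree R) * reflect_poly R"
  show "?Q \<in> polys_over B"
    using assms(1) by (intro polys_over_mult polys_over_monom) (auto simp: polys_over_def coeff_reflect_poly)
  show "degree ?Q \<le> n"
    using degree_mult_le[of "monom 1 (n - degree R)" "reflect_poly R"]
      degree_monom_le[of "1::complex" "n - degree R"] degree_reflect_poly_le[of R] assms(2) by linarith
  show "poly ?Q x = x ^ n * poly R (inverse x)"
    using assms(2,3) by (simp add: poly_monom poly_reflect_poly_nz power_add[symmetric] flip: mult.assoc)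
qed

text \<open>The prime lies in every maximal ideal of \<open>B\<close>. If
  \<open>y = 1 + P * b\<close> had no inverse in \<open>B\<close>, then \<open>1 / P\<close> would
  be a polynomial in \<open>inverse y\<close>, hence \<open>y ^ n = P * c\<close> with
  \<open>c\<close> in \<open>B\<close>; but \<open>y ^ n\<close> is 1 modulo \<open>P\<close>, so
  \<open>P\<close> would be invertible in \<open>B\<close>.\<close>

lemma one_plus_unit:
  assumes b: "b \<in> B"
  shows "1 + P * b \<noteq> 0" "inverse (1 + P * b) \<in> B"
proof -
  let ?y = "1 + P * b"
  have *: "1 \<noteq> P * c" if "c \<in> B" for c
    using avoid that P0 by (metis nonzero_mult_div_cancel_left)
  show y0: "?y \<noteq> 0"
  proof
    assume "?y = 0"
    then have "1 = P * (- b)" by (simp add: eq_neg_iff_add_eq_0)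
    then show False using *[OF uminus_closed[OF b]] by blast
  qed
  show "inverse ?y \<in> B"
  proof (rule ccontr)
    assume "inverse ?y \<notin> B"
    then obtain R where R: "R \<in> polys_over B" "poly R (inverse ?y) = 1 / P" by (rule not_mem_imp_poly)
    obtain Q where Q: "Q \<in> polys_over B" "poly Q ?y = ?y ^ degree R * poly R (inverse ?y)"
      using homogenize[OF R(1) order_refl y0] by blast
    have "?y \<in> B" using b by (intro add_closed mult_closed) auto
    then have c: "poly Q ?y \<in> B" using Q by blast
    have "?y ^ degree R = P * poly Q ?y" using Q(2) R(2) P0 by (simp add: field_simps)
    moreover have "\<exists>d\<in>B. ?y ^ n = 1 + P * d" for n
    proof (induction n)
      case (Suc n)
      then obtain d where "d \<in> B" "?y ^ n = 1 + P * d" by blast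
      then show ?case using b
        by (intro bexI[of _ "d + b + P * b * d"]) (auto simp: algebra_simps intro!: add_closed mult_closed)
    qed (auto intro: bexI[of _ 0])
    ultimately obtain d where "d \<in> B" "1 + P * d = P * poly Q ?y" by metis
    then show False using *[of "poly Q ?y - d"] c by (auto simp: algebra_simps)
  qed
qed

text \<open>Chevalley's argument. If neither \<open>x\<close> nor \<open>inverse x\<close> is in
  \<open>B\<close>, then \<open>1 / P\<close> is a polynomial in each of them over \<open>B\<close>;
  let \<open>n\<close> and \<open>m\<close> be the minimal degrees. The relation of smaller or equal
  degree can be used to shorten the other.\<close>

lemma valuation_ring:
  assumes x0: "x \<noteq> 0"
  shows "x \<in> B \<or> inverse x \<in> B"
proof (rule ccontr)
  assume neg: "\<not> (x \<in> B \<or> inverse x \<in> B)"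
  define Good where "Good x n \<longleftrightarrow> (\<exists>R\<in>polys_over B. degree R \<le> n \<and> poly R x = 1 / P)" for x n
  have ex: "\<exists>n. Good y n" if "y \<notin> B" for y
    using not_mem_imp_poly[OF that] unfolding Good_def by blast
  have reduce: "Good x (n - 1)"
    if x: "x \<noteq> 0" "x \<notin> B" "inverse x \<notin> B" and n: "Good x n" and m: "Good (inverse x) m" and mn: "m \<le> n" for x n m
  proof -
    obtain R where R: "R \<in> polys_over B" "degree R \<le> n" "poly R x = 1 / P"
      using n by (auto simp: Good_def)
    obtain Q where Q: "Q \<in> polys_over B" "degree Q \<le> m" "poly Q (inverse x) = 1 / P"
      using m by (auto simp: Good_def)
    obtain c Q1 where Q1: "Q = pCons c Q1" by (cases Q)
    have cB: "c \<in> B" "Q1 \<in> polys_over B" using Q(1) Q1 by auto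
    have Q10: "Q1 \<noteq> 0" using Q(3) Q1 cB avoid by auto
    then have dQ1: "degree Q1 \<le> n - 1" "n \<ge> 1" using Q(2) Q1 mn by auto
    \<comment> \<open>The constant term \<open>c\<close> of the relation for
      \<open>inverse x\<close> is moved to the other side, where \<open>1 - P * c\<close> is a unit.
      Multiplied by \<open>x ^ n\<close>, the relation expresses \<open>x ^ n\<close> by lower
      powers of \<open>x\<close>, which then replace the leading term of \<open>R\<close>.\<close>
    define w where "w = inverse (1 + P * (- c))"
    have w: "w \<in> B" "1 - P * c \<noteq> 0" unfolding w_def
      using one_plus_unit[of "- c"] uminus_closed[OF cB(1)] by auto
    obtain S where S: "S \<in> polys_over B" "degree S \<le> n - 1" "poly S x = x ^ (n - 1) * poly Q1 (inverse x)"
      using homogenize[OF cB(2) dQ1(1) x(1)] by blast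
    have "P * inverse x * poly Q1 (inverse x) = 1 - P * c"
      using Q(3) P0 by (simp add: Q1 field_simps)
    then have "w * (P * inverse x * poly Q1 (inverse x)) = 1"
      using w(2) by (simp add: w_def)
    then have wq: "w * P * poly Q1 (inverse x) = x" using x(1) by (simp add: field_simps)
    have "w * P * poly S x = x ^ (n - 1) * (w * P * poly Q1 (inverse x))"
      by (simp add: S(3) mult_ac)
    also have "\<dots> = x ^ n" unfolding wq using dQ1(2) by (simp add: power_eq_if)
    finally have xn: "w * P * poly S x = x ^ n" .
    define b where "b = coeff R n"
    have bB: "b \<in> B" using R(1) by (simp add: b_def polys_overD)
    define R' where "R' = R - monom b n + smult (b * w * P) S"
    have "R' \<in> polys_over B" unfolding R'_def using R(1) bB w(1) S(1)
      by (intro polys_over_add polys_over_diff polys_over_monom polys_over_smult mult_closed) auto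
    moreover have "poly R' x = 1 / P"
      unfolding R'_def using R(3) xn by (simp add: poly_monom mult.assoc)
    moreover have "degree R' \<le> n - 1"
    proof (rule degree_le, intro allI impI)
      fix i assume i: "n - 1 < i"
      have "coeff (R - monom b n) i = 0"
        using i dQ1(2) R(2) by (cases "i = n") (auto simp: b_def coeff_monom intro!: coeff_eq_0)
      moreover have "coeff S i = 0" using i S(2) by (intro coeff_eq_0) auto
      ultimately show "coeff R' i = 0" by (simp add: R'_def)
    qed
    ultimately show ?thesis unfolding Good_def by blast
  qed
  define n where "n = (LEAST n. Good x n)"
  define m where "m = (LEAST n. Good (inverse x) n)"
  have n: "Good x n" unfolding n_def using ex[of x] neg LeastI_ex by blast
  have m: "Good (inverse x) m" unfolding m_def using ex[of "inverse x"] neg LeastI_ex by blast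
  have pos: "\<not> Good y 0" if "y \<notin> B" for y
    using avoid by (auto simp: Good_def elim!: degree_eq_zeroE)
  have "n > 0" using pos[of x] n neg by (cases n) auto
  have "m > 0" using pos[of "inverse x"] m neg by (cases m) auto
  show False
  proof (cases "m \<le> n")
    case True
    then have "Good x (n - 1)" using reduce[OF x0 _ _ n m] neg by auto
    then have "n \<le> n - 1" unfolding n_def by (rule Least_le)
    then show False using \<open>n > 0\<close> by simp
  next
    case False
    then have "Good (inverse x) (m - 1)" using reduce[of "inverse x" m n] n m x0 neg by auto
    then have "m \<le> m - 1" unfolding m_def by (rule Least_le)
    then show False using \<open>m > 0\<close> by simp
  qed
qed

text \<open>Bezout gives \<open>a * m = 1 - b * p\<close>, a unit of \<open>B\<close>.\<close>

lemma inverse_coprime: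
  assumes "coprime (m::int) (int p)"
  shows "inverse (of_int m) \<in> B"
proof -
  obtain a b where ab: "a * m + b * int p = 1"
    using bezout_int[of m "int p"] assms by (auto simp: coprime_iff_gcd_eq_1)
  have "of_int (a * m + b * int p) = (1::complex)" unfolding ab by simp
  then have am: "of_int a * of_int m = 1 + P * of_int (- b)" by (simp add: algebra_simps)
  have u: "1 + P * of_int (- b) \<noteq> 0" "inverse (1 + P * of_int (- b)) \<in> B"
    by (rule one_plus_unit[OF of_int_closed])+
  have "of_int a * of_int m * inverse (1 + P * of_int (- b)) = (1::complex)"
    unfolding am by (rule right_inverse[OF u(1)])
  then have "inverse (of_int m) = of_int a * inverse (1 + P * of_int (- b))"
    by (metis inverse_unique mult.assoc mult.commute)
  then show ?thesis using u(2) by auto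
qed

text \<open>Otherwise \<open>inverse x\<close> lies in the valuation ring, and dividing the monic
  equation by \<open>x ^ (n - 1)\<close> writes \<open>x\<close> as a polynomial in
  \<open>inverse x\<close> with coefficients in \<open>B\<close>.\<close>

lemma integrally_closed:
  assumes "R \<in> polys_over B" "lead_coeff R = 1" "poly R x = 0"
  shows "x \<in> B"
proof (rule ccontr)
  assume x: "x \<notin> B"
  then have x0: "x \<noteq> 0" by auto
  then have xi: "inverse x \<in> B" using valuation_ring x by blast
  define n where "n = degree R"
  have n0: "n \<noteq> 0"
  proof
    assume "n = 0"
    then obtain c where "R = [:c:]" unfolding n_def using degree_eq_zeroE by blast
    then show False using assms(2,3) by simp
  qed
  have "0 = (\<Sum>i\<le>n. coeff R i * x ^ i)" using assms(3) by (simp add: poly_altdef n_def)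
  also have "\<dots> = x ^ n + (\<Sum>i<n. coeff R i * x ^ i)"
    using assms(2) by (simp add: n_def lessThan_Suc_atMost[symmetric])
  finally have "x ^ n = - (\<Sum>i<n. coeff R i * x ^ i)" by (simp add: add_eq_0_iff)
  moreover have "x = x ^ n * inverse x ^ (n - 1)"
    using n0 x0 by (cases n) (simp_all add: power_inverse)
  ultimately have "x = - (\<Sum>i<n. coeff R i * x ^ i) * inverse x ^ (n - 1)"
    by metis
  also have "\<dots> = - (\<Sum>i<n. coeff R i * (x ^ i * inverse x ^ (n - 1)))"
    by (simp add: sum_distrib_right mult.assoc)
  finally have "x = - (\<Sum>i<n. coeff R i * (x ^ i * inverse x ^ (n - 1)))" .
  moreover have "x ^ i * inverse x ^ (n - 1) = inverse x ^ (n - 1 - i)" if "i \<le> n - 1" for i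
  proof -
    have "inverse x ^ (n - 1) = inverse x ^ i * inverse x ^ (n - 1 - i)"
      using that n0 by (simp flip: power_add)
    then show ?thesis using x0 by (simp add: power_inverse field_simps)
  qed
  ultimately have "x = - (\<Sum>i<n. coeff R i * inverse x ^ (n - 1 - i))" by auto
  also have "\<dots> \<in> B" using xi assms(1)
    by (intro uminus_closed sum_closed mult_closed power_closed) (auto simp: polys_overD)
  finally show False using x by simp
qed

end


section \<open>The absolute value attached to the valuation ring\<close>

context maximal_avoiding begin

text \<open>A pair \<open>(a, b)\<close> witnesses that the order of \<open>x\<close> at
  \<open>p\<close> is at least \<open>a / b\<close>, and its \<open>exponent_value\<close> is the
  corresponding bound on the absolute value. Comparing powers of \<open>x\<close> with powers of
  \<open>p\<close> yields the real number \<open>val x\<close> as an infimum, without a description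
  of the value group of \<open>B\<close>.\<close>

definition exponents :: "complex \<Rightarrow> (int \<times> nat) set" where
  "exponents x = {(a, b). b > 0 \<and> x ^ b * P powi (- a) \<in> B}"

definition exponent_value :: "int \<times> nat \<Rightarrow> real" where
  "exponent_value = (\<lambda>(a, b). real p powr (- (of_int a / of_nat b)))"

definition val :: "complex \<Rightarrow> real" where
  "val x = Inf (exponent_value ` exponents x)"

lemma exponent_value_pos: "exponent_value s > 0"
  using prime_gt_0_nat[OF prime] by (simp add: exponent_value_def split: prod.splits)

lemma exponents_scale:
  assumes "(a, b) \<in> exponents x" "n > 0"
  shows "(int n * a, n * b) \<in> exponents x" "exponent_value (int n * a, n * b) = exponent_value (a, b)"
proof -
  have "(x ^ b * P powi (- a)) ^ n \<in> B" using assms by (auto simp: exponents_def)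
  also have "(x ^ b * P powi (- a)) ^ n = x ^ (n * b) * P powi (- (int n * a))"
    by (simp add: power_mult_distrib power_mult[symmetric] mult.commute power_int_power')
  finally show "(int n * a, n * b) \<in> exponents x" using assms by (simp add: exponents_def)
  show "exponent_value (int n * a, n * b) = exponent_value (a, b)"
    using assms by (simp add: exponent_value_def)
qed

lemma val_le: "s \<in> exponents x \<Longrightarrow> val x \<le> exponent_value s"
  unfolding val_def
  by (intro cInf_lower bdd_belowI2[of _ 0]) (auto intro: less_imp_le exponent_value_pos)

lemma split_prime_power:
  assumes "m \<noteq> 0"
  obtains c where "m = int p ^ multiplicity (int p) m * c" "coprime c (int p)"
proof -
  obtain c where c: "m = int p ^ multiplicity (int p) m * c"
    using multiplicity_dvd[of "int p" m] by (auto simp: dvd_def)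
  have "\<not> int p dvd c"
  proof
    assume "int p dvd c"
    then have "int p ^ Suc (multiplicity (int p) m) dvd m" by (subst c) (simp add: mult.commute)
    then have "Suc (multiplicity (int p) m) \<le> multiplicity (int p) m" using assms prime
      by (intro multiplicity_geI) (auto simp: prime_gt_1_nat)
    then show False by simp
  qed
  then have "coprime c (int p)"
    using prime prime_imp_coprime[of "int p" c] by (simp add: coprime_commute)
  then show thesis using that c by blast
qed

text \<open>Denominators prime to \<open>p\<close> are invertible in \<open>B\<close>, so a power of
  \<open>p\<close> moves the coefficients of the minimal polynomial into \<open>B\<close>. A
  suitable multiple of \<open>x\<close> is then integral over \<open>B\<close>.\<close>

lemma integral_multiple:
  assumes "algebraic x"
  obtains k where "x * P ^ k \<in> B"
proof -
  have alg: "algebraic_over \<rat> x" using assms by (simp add: algebraic_over_Rats)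
  define m where "m = min_poly \<rat> x"
  have rat: "\<exists>k. q * P ^ k \<in> B" if q: "q \<in> \<rat>" for q
  proof -
    obtain a b :: int where ab: "q = of_int a / of_int b" "b > 0" using q by (cases rule: Rats_cases') auto
    define k where "k = multiplicity (int p) b"
    obtain c where c: "b = int p ^ k * c" "coprime c (int p)"
      using split_prime_power[of b] ab(2) by (auto simp: k_def)
    have "of_int a * inverse (of_int c) \<in> B" using inverse_coprime[OF c(2)] by blast
    also have "of_int a * inverse (of_int c) = q * P ^ k"
      using ab P0 by (simp add: c(1) field_simps)
    finally show ?thesis by blast
  qed
  have "\<forall>i. \<exists>k. coeff m i * P ^ k \<in> B"
    using rat rat.min_poly_over[OF alg] by (simp add: m_def polys_over_def)
  then obtain k where k: "coeff m i * P ^ k i \<in> B" for i by metis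
  define n where "n = degree m"
  define K where "K = (\<Sum>i\<le>n. k i)"
  have K: "coeff m i * P ^ K \<in> B" if "i \<le> n" for i
  proof -
    have "k i \<le> K" unfolding K_def using that by (intro member_le_sum) auto
    then have "coeff m i * P ^ K = coeff m i * P ^ k i * P ^ (K - k i)" by (simp flip: power_add)
    then show ?thesis using k[of i] by (metis mult_closed of_nat_closed power_closed)
  qed
  \<comment> \<open>The monic polynomial of \<open>x * P ^ K\<close>: its coefficient at each
    \<open>i < n\<close> carries at least one factor \<open>P ^ K\<close>, enough to bring it into
    \<open>B\<close>.\<close>
  define R where "R = (\<Sum>i\<le>n. monom (coeff m i * P ^ (K * (n - i))) i)"
  have cR: "coeff R j = (if j \<le> n then coeff m j * P ^ (K * (n - j)) else 0)" for j
    unfolding R_def by (simp add: coeff_sum if_distrib)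
  have lm: "coeff m n = 1" using rat.min_poly_monic[OF alg] by (simp add: m_def n_def)
  have "degree R = n" by (intro antisym degree_le le_degree) (auto simp: cR lm)
  then have lR: "lead_coeff R = 1" by (simp add: cR lm)
  have RB: "R \<in> polys_over B" unfolding polys_over_def
  proof (intro CollectI allI)
    fix j show "coeff R j \<in> B"
    proof (cases "j < n")
      case True
      then have "coeff R j = coeff m j * P ^ K * P ^ (K * (n - j - 1))"
        by (simp add: cR mult.assoc flip: power_add)
          (metis Suc_diff_Suc diff_Suc_1 mult_Suc_right)
      then show ?thesis using K[of j] True by (metis less_imp_le mult_closed of_nat_closed power_closed)
    qed (auto simp: cR lm not_less)
  qed
  have "poly R (x * P ^ K) = (\<Sum>i\<le>n. coeff m i * x ^ i * (P ^ (K * (n - i)) * P ^ (K * i)))"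
    unfolding R_def by (simp add: poly_sum poly_monom power_mult_distrib mult_ac flip: power_mult)
  also have "\<dots> = (\<Sum>i\<le>n. coeff m i * x ^ i * P ^ (K * n))"
    by (intro sum.cong refl) (simp add: algebra_simps flip: power_add)
  also have "\<dots> = poly m x * P ^ (K * n)" by (simp add: poly_altdef n_def sum_distrib_right)
  also have "\<dots> = 0" using rat.poly_min_poly[OF alg] by (simp add: m_def)
  finally show thesis using that integrally_closed[OF RB lR] by blast
qed

lemma exponents_nonempty:
  assumes "algebraic x"
  shows "exponents x \<noteq> {}"
proof -
  obtain k where "x * P ^ k \<in> B" using integral_multiple[OF assms] by blast
  then have "(- int k, 1) \<in> exponents x" by (simp add: exponents_def)
  then show ?thesis by blast
qed

lemma val_nonneg: "algebraic x \<Longrightarrow> val x \<ge> 0"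
  unfolding val_def using exponents_nonempty[of x] exponent_value_pos
  by (intro cInf_greatest) (auto intro: less_imp_le)

text \<open>Two exponents are added over the common denominator \<open>b * d\<close>; the product
  bound then passes to the two infima one after the other.\<close>

lemma val_mult_le:
  assumes "algebraic x" "algebraic y"
  shows "val (x * y) \<le> val x * val y"
proof -
  have *: "val (x * y) \<le> exponent_value s * exponent_value t"
    if st: "s \<in> exponents x" "t \<in> exponents y" for s t
  proof -
    obtain a b c d where s: "s = (a, b)" and t: "t = (c, d)" by (cases s, cases t)
    have b: "b > 0" and d: "d > 0" using st s t by (auto simp: exponents_def)
    have "x ^ (d * b) * P powi (- (int d * a)) * (y ^ (b * d) * P powi (- (int b * c))) \<in> B"
      using exponents_scale(1)[of a b x d] exponents_scale(1)[of c d y b] st s t b d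
      by (intro mult_closed[of "x ^ (d * b) * P powi (- (int d * a))"]) (auto simp: exponents_def)
    also have "x ^ (d * b) * P powi (- (int d * a)) * (y ^ (b * d) * P powi (- (int b * c))) =
        (x * y) ^ (b * d) * P powi (- (int d * a + int b * c))"
      using P0 power_int_add[of P "- (int d * a)" "- (int b * c)"]
      by (simp add: power_mult_distrib mult_ac)
    finally have mem: "(int d * a + int b * c, b * d) \<in> exponents (x * y)"
      using b d by (simp add: exponents_def)
    have "val (x * y) \<le> exponent_value (int d * a + int b * c, b * d)" by (rule val_le[OF mem])
    also have "\<dots> = exponent_value s * exponent_value t"
    proof -
      have "- (real_of_int (int d * a + int b * c) / real (b * d)) = - (of_int a / of_nat b) + - (of_int c / of_nat d)"
        using b d by (simp add: field_simps)
      then show ?thesis unfolding exponent_value_def s t prod.case powr_add[symmetric] by (rule arg_cong)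
    qed
    finally show ?thesis .
  qed
  have "val (x * y) / exponent_value t \<le> val x" if t: "t \<in> exponents y" for t
    unfolding val_def[of x] using *[OF _ t] exponent_value_pos[of t] exponents_nonempty[OF assms(1)]
    by (intro cInf_greatest) (auto simp: field_simps)
  note h = this
  have **: "val (x * y) \<le> val x * exponent_value t" if "t \<in> exponents y" for t
    using h[OF that] exponent_value_pos[of t] by (simp add: pos_divide_le_eq)
  show ?thesis
  proof (cases "val x = 0")
    case True
    obtain t where "t \<in> exponents y" using exponents_nonempty[OF assms(2)] by blast
    then show ?thesis using **[of t] True by simp
  next
    case False
    then have pos: "val x > 0" using val_nonneg[OF assms(1)] by simp
    have "val (x * y) / val x \<le> val y"
      unfolding val_def[of y] using ** pos exponents_nonempty[OF assms(2)]
      by (intro cInf_greatest) (auto simp: field_simps)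
    then show ?thesis using pos by (simp add: field_simps)
  qed
qed

lemma val_le_1: "x \<in> B \<Longrightarrow> val x \<le> 1"
  using val_le[of "(0, 1)" x] prime_gt_0_nat[OF prime] by (simp add: exponents_def exponent_value_def)

text \<open>A positive exponent \<open>a\<close> of 1 would put \<open>P powi (- a)\<close>, and
  hence \<open>1 / P\<close>, into \<open>B\<close>.\<close>

lemma val_1: "val 1 = 1"
proof (rule antisym)
  have "1 \<le> exponent_value s" if "s \<in> exponents 1" for s
  proof -
    obtain a b where s: "s = (a, b)" by (cases s)
    have "a \<le> 0"
    proof (rule ccontr)
      assume "\<not> a \<le> 0"
      then obtain n where a: "a = int (Suc n)" by (metis zero_less_imp_eq_int not_le gr0_implies_Suc of_nat_0_less_iff)
      have "P powi (- int (Suc n)) * P ^ n \<in> B" using that s a by (auto simp: exponents_def)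
      also have "P powi (- int (Suc n)) * P ^ n = 1 / P"
        using P0 by (simp add: power_int_minus field_simps del: of_nat_Suc)
      finally show False using avoid by simp
    qed
    then show ?thesis using prime_gt_1_nat[OF prime] s that
      by (auto simp: exponent_value_def exponents_def intro!: ge_one_powr_ge_zero divide_nonpos_pos)
  qed
  then show "1 \<le> val 1" unfolding val_def using exponents_nonempty[of 1]
    by (intro cInf_greatest) auto
qed (use val_le_1[of 1] in simp)

text \<open>If the product exceeded 1, a rational \<open>a / n\<close> would fit strictly between
  \<open>- log p (val x)\<close> and \<open>log p (val (inverse x))\<close>. Then
  \<open>x ^ n * P powi (- a)\<close> and its inverse would both lie outside \<open>B\<close>,
  against the valuation ring property.\<close>

lemma val_inverse_le:
  assumes x: "algebraic x" "x \<noteq> 0"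
  shows "val x * val (inverse x) \<le> 1"
proof (rule ccontr)
  have xi: "algebraic (inverse x)" using x by auto
  have "1 \<le> val x * val (inverse x)" using val_mult_le[OF x(1) xi] x(2) by (simp add: val_1)
  then have pos: "val x > 0" "val (inverse x) > 0"
    using val_nonneg[OF x(1)] val_nonneg[OF xi] by (auto simp: zero_less_mult_iff less_le)
  assume "\<not> ?thesis"
  then have "1 / val (inverse x) < val x" using pos by (simp add: field_simps)
  moreover have p1: "real p > 1" using prime_gt_1_nat[OF prime] by simp
  ultimately have "log p (inverse (val (inverse x))) < log p (val x)"
    using pos by (subst log_less_cancel_iff) (auto simp: inverse_eq_divide)
  then have "- log p (val x) < log p (val (inverse x))" by (simp add: log_inverse)
  then obtain q where "q \<in> \<rat>" and q: "- log p (val x) < q" "q < log p (val (inverse x))"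
    using Rats_dense_in_real by blast
  then obtain a b where ab: "q = of_int a / of_int b" "b > 0" by (cases q rule: Rats_cases') auto
  define n where "n = nat b"
  have n: "n > 0" "q = of_int a / of_nat n" using ab by (auto simp: n_def)
  have e1: "exponent_value (a, n) < val x"
    unfolding exponent_value_def prod.case powr_less_iff[OF p1 pos(1)] using q(1) n(2) by linarith
  have e2: "exponent_value (- a, n) < val (inverse x)"
    unfolding exponent_value_def prod.case powr_less_iff[OF p1 pos(2)] using q(2) n(2) by simp
  have "x ^ n * P powi (- a) \<noteq> 0" using x P0 by simp
  then have "x ^ n * P powi (- a) \<in> B \<or> inverse (x ^ n * P powi (- a)) \<in> B" by (rule valuation_ring)
  then show False
  proof
    assume "x ^ n * P powi (- a) \<in> B"
    then have "(a, n) \<in> exponents x" using n by (simp add: exponents_def)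
    then show False using val_le e1 by fastforce
  next
    assume "inverse (x ^ n * P powi (- a)) \<in> B"
    then have "(- a, n) \<in> exponents (inverse x)" using n
      by (simp add: exponents_def power_inverse power_int_minus)
    then show False using val_le e2 by fastforce
  qed
qed

lemma val_0: "val 0 = 0"
proof -
  have *: "val 0 \<le> e" if e: "e > 0" for e
  proof -
    obtain n :: nat where n: "inverse (real p ^ n) < e"
      using real_arch_pow_inv[OF e, of "inverse (real p)"] prime_gt_1_nat[OF prime]
      by (auto simp: power_inverse field_simps)
    have "(int n, 1) \<in> exponents 0" by (simp add: exponents_def)
    from val_le[OF this] have "val 0 \<le> inverse (real p ^ n)"
      using prime_gt_0_nat[OF prime] by (simp add: exponent_value_def powr_minus powr_realpow)
    then show ?thesis using n by simp
  qed
  have "val 0 \<le> 0"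
  proof (rule field_le_epsilon)
    fix e :: real assume "0 < e"
    from *[OF this] show "val 0 \<le> 0 + e" by simp
  qed
  then show ?thesis using val_nonneg[of 0] by simp
qed

text \<open>The missing inequality is submultiplicativity applied to
  \<open>y = inverse x * (x * y)\<close>, together with \<open>val_inverse_le\<close>.\<close>

lemma val_mult:
  assumes "algebraic x" "algebraic y"
  shows "val (x * y) = val x * val y"
proof (cases "x = 0")
  case True
  then show ?thesis by (simp add: val_0)
next
  case False
  have xi: "algebraic (inverse x)" using assms by auto
  have xy: "algebraic (x * y)" using alg.mult_closed assms by auto
  have "val x * val y = val x * val (inverse x * (x * y))" using False by (simp add: field_simps)
  also have "\<dots> \<le> val x * (val (inverse x) * val (x * y))"
    by (intro mult_left_mono val_mult_le xi xy val_nonneg assms)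
  also have "\<dots> = (val x * val (inverse x)) * val (x * y)" by simp
  also have "\<dots> \<le> 1 * val (x * y)"
    by (intro mult_right_mono val_inverse_le False assms val_nonneg xy)
  finally show ?thesis using val_mult_le[OF assms] by simp
qed

lemma val_inverse:
  assumes "algebraic x" "x \<noteq> 0"
  shows "val x * val (inverse x) = 1"
  using val_mult[of x "inverse x"] assms val_1 by auto

lemma val_eq_0_iff: "algebraic x \<Longrightarrow> val x = 0 \<longleftrightarrow> x = 0"
  using val_inverse[of x] val_0 by (metis mult_zero_left zero_neq_one)

text \<open>One of \<open>x / y\<close> and \<open>y / x\<close> lies in \<open>B\<close>, and
  adding 1 stays in \<open>B\<close>, where values are at most 1.\<close>

lemma val_add:
  assumes "algebraic x" "algebraic y"
  shows "val (x + y) \<le> max (val x) (val y)"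
proof -
  have *: "val (x + y) \<le> val y" if "algebraic x" "algebraic y" "y \<noteq> 0" "x / y \<in> B" for x y
  proof -
    have xy: "algebraic (1 + x / y)" using that alg.add_closed[OF _ alg.divide_closed, of 1 x y] by auto
    have "val (x + y) = val (y * (1 + x / y))" using that by (simp add: field_simps)
    also have "\<dots> = val y * val (1 + x / y)" by (rule val_mult[OF that(2) xy])
    also have "\<dots> \<le> val y * 1" using that by (intro mult_left_mono val_le_1 val_nonneg) auto
    finally show ?thesis by simp
  qed
  show ?thesis
  proof (cases "x = 0 \<or> y = 0")
    case True
    then show ?thesis by (auto simp: val_0 le_max_iff_disj)
  next
    case False
    then have "x / y \<in> B \<or> y / x \<in> B" using valuation_ring[of "x / y"] by auto
    then show ?thesis
      using *[of x y] *[of y x] False assms by (auto simp: le_max_iff_disj add.commute)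
  qed
qed

lemma val_prime: "val P = 1 / real p"
proof -
  have a: "algebraic P" by simp
  have "(1, 1) \<in> exponents P" using P0 by (simp add: exponents_def power_int_minus)
  from val_le[OF this] have 1: "val P \<le> 1 / real p"
    by (simp add: exponent_value_def powr_minus divide_inverse)
  have "(- 1, 1) \<in> exponents (inverse P)" using P0 by (simp add: exponents_def)
  from val_le[OF this] have 2: "val (inverse P) \<le> real p"
    by (simp add: exponent_value_def)
  have "1 \<le> val P * real p"
    using mult_left_mono[OF 2 val_nonneg[OF a]] val_inverse[OF a P0] by simp
  then show ?thesis using 1 prime_gt_0_nat[OF prime] by (simp add: field_simps)
qed

lemma val_coprime:
  assumes "coprime (m::int) (int p)"
  shows "val (of_int m) = 1"
proof -
  have "m \<noteq> 0" using assms prime_gt_1_nat[OF prime] by auto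
  then have "val (of_int m) * val (inverse (of_int m)) = 1" by (intro val_inverse) auto
  moreover have "val (of_int m) \<le> 1" "val (inverse (of_int m)) \<le> 1"
    using val_le_1[OF of_int_closed[of m]] val_le_1[OF inverse_coprime[OF assms]] by auto
  ultimately show ?thesis
    using mult_left_mono[of "val (inverse (of_int m))" 1 "val (of_int m)"] val_nonneg[of "of_int m"] by simp
qed

lemma val_int:
  assumes "m \<noteq> 0"
  shows "val (of_int m) = real p powi (- int (multiplicity (int p) m))"
proof -
  define k where "k = multiplicity (int p) m"
  obtain c where c: "m = int p ^ k * c" and cop: "coprime c (int p)"
    using split_prime_power[OF assms] by (auto simp: k_def)
  have pw: "val (P ^ n) = val P ^ n" for n
    by (induction n) (auto simp: val_1 val_mult alg.power_closed[unfolded mem_Collect_eq])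
  have "val (of_int m) = val (P ^ k * of_int c)" by (simp add: c)
  also have "\<dots> = val P ^ k * val (of_int c)"
    using val_mult[of "P ^ k" "of_int c"] pw alg.power_closed[of P k] by simp
  also have "\<dots> = real p powi (- int k)"
    unfolding val_coprime[OF cop] val_prime by (simp add: power_int_minus power_divide field_simps)
  finally show ?thesis by (simp add: k_def)
qed

lemma val_of_rat: "val (of_rat q) = padic_abs p q"
proof (cases "q = 0")
  case True
  then show ?thesis by (simp add: padic_abs_def val_0)
next
  case False
  obtain a b where ab: "quotient_of q = (a, b)" by (cases "quotient_of q")
  have b: "b > 0" using quotient_of_denom_pos[OF ab] .
  have q: "q = of_int a / of_int b" using quotient_of_div[OF ab] .
  have a: "a \<noteq> 0" using False q by auto
  have "val (of_rat q) * val (of_int b) = val (of_rat q * of_int b)"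
    by (intro val_mult[symmetric]) (auto intro: rat_imp_algebraic)
  also have "of_rat q * of_int b = (of_int a :: complex)"
    using b by (simp add: q of_rat_divide)
  finally have "val (of_rat q) = val (of_int a) / val (of_int b)"
    using val_eq_0_iff[of "of_int b"] b by (simp add: field_simps)
  also have "\<dots> = padic_abs p q"
    using a b prime_gt_0_nat[OF prime] False
    by (simp add: val_int padic_abs_def ab power_int_minus power_int_diff field_simps)
  finally show ?thesis .
qed

end

text \<open>Zorn's lemma is started from the integers, which do not contain \<open>1 / p\<close>;
  the union of a nonempty chain of subrings avoiding \<open>1 / p\<close> is again one.\<close>

lemma padic_extension:
  assumes prime: "normalization_semidom_class.prime p"
  obtains u where "absolute_value_on {x. algebraic x} u"
    "\<And>q. u (of_rat q) = padic_abs p q"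
    "\<And>x y. algebraic x \<Longrightarrow> algebraic y \<Longrightarrow> u (x + y) \<le> max (u x) (u y)"
proof -
  define AA where "AA = {B. complex_subring B \<and> 1 / of_nat p \<notin> B}"
  have "complex_subring \<int>" by unfold_locales auto
  moreover have "1 / of_nat p \<notin> (\<int> :: complex set)"
  proof
    assume "1 / of_nat p \<in> (\<int> :: complex set)"
    then obtain n where "1 / of_nat p = (of_int n :: complex)" by (auto elim: Ints_cases)
    then have "(of_int 1 :: complex) = of_int (n * int p)"
      using prime_gt_0_nat[OF prime] by (simp add: field_simps)
    then have "1 = n * int p" by (simp only: of_int_eq_iff)
    then have "int p dvd 1" by (metis dvd_triv_right)
    then show False using prime_gt_1_nat[OF prime] by simp
  qed
  ultimately have ne: "\<int> \<in> AA" by (simp add: AA_def)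
  have "\<exists>M\<in>AA. (\<forall>Y\<in>AA. (M \<subseteq> Y \<longrightarrow> Y = M))"
  proof (rule subset_Zorn_nonempty)
    show "AA \<noteq> {}" using ne by blast
    fix C assume C: "C \<noteq> {}" "subset.chain AA C"
    have sub: "complex_subring B" "1 / of_nat p \<notin> B" if "B \<in> C" for B
      using C that by (auto simp: subset.chain_def AA_def)
    have two: "\<exists>B\<in>C. x \<in> B \<and> y \<in> B" if "x \<in> \<Union>C" "y \<in> \<Union>C" for x y
      using C that unfolding subset_chain_def by (metis UnionE in_mono)
    have "complex_subring (\<Union>C)"
    proof
      show "1 \<in> \<Union>C" using C(1) sub(1) complex_subring.one_closed by blast
      fix x y assume "x \<in> \<Union>C" "y \<in> \<Union>C"
      then obtain B where B: "B \<in> C" "x \<in> B" "y \<in> B" using two by blast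
      show "x - y \<in> \<Union>C" using B complex_subring.diff_closed[OF sub(1)[OF B(1)]] by blast
      show "x * y \<in> \<Union>C" using B complex_subring.mult_closed[OF sub(1)[OF B(1)]] by blast
    qed
    then show "\<Union>C \<in> AA" using sub(2) by (auto simp: AA_def)
  qed
  then obtain B where B: "B \<in> AA" "\<And>Y. Y \<in> AA \<Longrightarrow> B \<subseteq> Y \<Longrightarrow> Y = B" by blast
  interpret complex_subring B using B(1) by (simp add: AA_def)
  interpret maximal_avoiding B p
  proof
    show "normalization_semidom_class.prime p" by (rule prime)
    show "1 / of_nat p \<notin> B" using B(1) by (simp add: AA_def)
    fix C assume "complex_subring C" "B \<subseteq> C" "1 / of_nat p \<notin> C"
    then show "C = B" by (intro B(2)) (simp_all add: AA_def)
  qed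
  show thesis
  proof (rule that[of val])
    have "val (x + y) \<le> val x + val y" if "algebraic x" "algebraic y" for x y
      using val_add[OF that] val_nonneg[OF that(1)] val_nonneg[OF that(2)] by linarith
    then show "absolute_value_on {x. algebraic x} val" unfolding absolute_value_on_def
      using val_nonneg val_eq_0_iff val_mult by blast
  qed (use val_of_rat val_add in auto)
qed


section \<open>Completions and local degrees\<close>

lemma (in cring) subfieldI_inverses:
  assumes "K \<subseteq> carrier R" "\<one> \<in> K" "\<And>h. h \<in> K \<Longrightarrow> \<ominus> h \<in> K"
    and "\<And>h k. h \<in> K \<Longrightarrow> k \<in> K \<Longrightarrow> h \<otimes> k \<in> K" "\<And>h k. h \<in> K \<Longrightarrow> k \<in> K \<Longrightarrow> h \<oplus> k \<in> K"
    and "\<one> \<noteq> \<zero>" "\<And>h. h \<in> K \<Longrightarrow> h \<noteq> \<zero> \<Longrightarrow> \<exists>k\<in>K. h \<otimes> k = \<one>"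
  shows "subfield K R"
proof (rule subfieldI)
  show "subcring K R" by (intro subcringI' subringI assms)
  show "Units (R\<lparr>carrier := K\<rparr>) = K - {\<zero>}"
  proof (intro equalityI subsetI)
    fix y assume "y \<in> Units (R\<lparr>carrier := K\<rparr>)"
    then obtain x where x: "y \<in> K" "x \<in> K" "x \<otimes> y = \<one>" by (auto simp: Units_def)
    then have "y \<noteq> \<zero>" using assms(1,6) by auto
    then show "y \<in> K - {\<zero>}" using x by simp
  next
    fix y assume y: "y \<in> K - {\<zero>}"
    then obtain k where k: "k \<in> K" "y \<otimes> k = \<one>" using assms(7) by blast
    then have "k \<otimes> y = \<one>" using y assms(1) m_comm[of k y] by auto
    then show "y \<in> Units (R\<lparr>carrier := K\<rparr>)" using y k by (auto simp: Units_def)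
  qed
qed

lemma (in ring) combine_map_eq_finsum:
  assumes "distinct is" "\<And>i. i \<in> set is \<Longrightarrow> c i \<in> carrier R" "\<And>i. i \<in> set is \<Longrightarrow> u i \<in> carrier R"
  shows "combine (map c is) (map u is) = (\<Oplus>i\<in>set is. c i \<otimes> u i)"
  using assms
proof (induction "is")
  case (Cons a xs)
  then show ?case by (subst list.set) (subst finsum_insert, auto)
qed simp

text \<open>Bridge from a basis \<open>u\<close>, with independence and spanning written as finite
  sums, to the list-based notion of dimension behind \<open>vs_dim\<close>.\<close>

lemma (in ring) vs_dim_eqI:
  fixes m :: nat
  assumes F: "subfield F R" and u: "\<And>i. i < m \<Longrightarrow> u i \<in> carrier R"
    and indep: "\<And>c i. (\<And>i. i < m \<Longrightarrow> c i \<in> F) \<Longrightarrow> (\<Oplus>i\<in>{..<m}. c i \<otimes> u i) = \<zero> \<Longrightarrow> i < m \<Longrightarrow> c i = \<zero>"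
    and E: "E = {\<Oplus>i\<in>{..<m}. c i \<otimes> u i | c. \<forall>i<m. c i \<in> F}"
  shows "vs_dim R F E = m"
proof -
  have FR: "F \<subseteq> carrier R" using subfieldE(3)[OF F] .
  define Us where "Us = map u [0..<m]"
  have Us: "set Us \<subseteq> carrier R" "length Us = m" using u by (auto simp: Us_def)
  have comb: "combine (map c [0..<m]) Us = (\<Oplus>i\<in>{..<m}. c i \<otimes> u i)" if "\<And>i. i < m \<Longrightarrow> c i \<in> F" for c
    unfolding Us_def using that FR u by (subst combine_map_eq_finsum) (auto simp: atLeast0LessThan)
  have comb': "combine Ks Us = (\<Oplus>i\<in>{..<m}. Ks ! i \<otimes> u i)" if "length Ks = m" "set Ks \<subseteq> F" for Ks
  proof -
    have "Ks = map (nth Ks) [0..<m]" using that(1) by (metis map_nth)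
    moreover have "Ks ! i \<in> F" if "i < m" for i using that \<open>length Ks = m\<close> \<open>set Ks \<subseteq> F\<close> by auto
    ultimately show ?thesis using comb[of "nth Ks"] by metis
  qed
  have "independent F Us"
  proof (rule trivial_combine_imp_independent[OF F Us(1)])
    fix Ks assume Ks: "set Ks \<subseteq> F" "combine Ks Us = \<zero>"
    then have "set Ks \<subseteq> carrier R" using FR by auto
    \<comment> \<open>A vanishing combination may come with a coefficient list of any length; it is
      cut or padded with zeros to length \<open>m\<close>.\<close>
    from combine_normalize[OF this Us(1) Ks(2)] obtain Ks' where Ks':
      "set (take (length Us) Ks) \<subseteq> set Ks'" "set Ks' \<subseteq> set (take (length Us) Ks) \<union> {\<zero>}"
      "length Ks' = length Us" "combine Ks' Us = \<zero>" by blast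
    have sub: "set Ks' \<subseteq> F"
      using Ks'(2) Ks(1) subringE(2)[OF subfieldE(1)[OF F]] by (auto dest: in_set_takeD)
    have "Ks' ! i = \<zero>" if "i < m" for i
    proof (rule indep[OF _ _ that])
      show "Ks' ! i \<in> F" if "i < m" for i using that sub Ks'(3) Us(2) by auto
      show "(\<Oplus>i\<in>{..<m}. Ks' ! i \<otimes> u i) = \<zero>" using comb'[of Ks'] sub Ks'(3,4) Us(2) by simp
    qed
    then have "set Ks' \<subseteq> {\<zero>}" using Ks'(3) Us(2) by (auto simp: in_set_conv_nth)
    then show "set (take (length Us) Ks) \<subseteq> {\<zero>}" using Ks'(1) by blast
  qed
  then have "dimension m F (Span F Us)" using dimension_independent Us(2) by metis
  moreover have "Span F Us = E"
    unfolding Span_eq_combine_set_length_version[OF F Us(1)] E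
  proof (intro equalityI subsetI; clarify)
    fix Ks assume "length Ks = length Us" "set Ks \<subseteq> F"
    then show "\<exists>c. combine Ks Us = (\<Oplus>i\<in>{..<m}. c i \<otimes> u i) \<and> (\<forall>i<m. c i \<in> F)"
      using comb'[of Ks] Us(2) by (intro exI[of _ "nth Ks"]) auto
  next
    fix c assume "\<forall>i<m. c i \<in> F"
    then show "\<exists>Ks. (\<Oplus>i\<in>{..<m}. c i \<otimes> u i) = combine Ks Us \<and> length Ks = length Us \<and> set Ks \<subseteq> F"
      using comb[of c] Us(2) by (intro exI[of _ "map c [0..<m]"]) auto
  qed
  ultimately show ?thesis
    unfolding vs_dim_def using dimension_is_inj[OF F] by (intro the_equality) auto
qed

section \<open>Cauchy sequences and the completion as a quotient ring\<close>

locale abs_field = complex_subfield K for K :: "complex set" +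
  fixes v :: "complex \<Rightarrow> real"
  assumes abs_value: "absolute_value_on K v"
begin

lemma v_nonneg: "x \<in> K \<Longrightarrow> 0 \<le> v x"
  and v_eq_0_iff: "x \<in> K \<Longrightarrow> v x = 0 \<longleftrightarrow> x = 0"
  and v_mult: "x \<in> K \<Longrightarrow> y \<in> K \<Longrightarrow> v (x * y) = v x * v y"
  and v_add: "x \<in> K \<Longrightarrow> y \<in> K \<Longrightarrow> v (x + y) \<le> v x + v y"
  using abs_value by (auto simp: absolute_value_on_def)

lemma v_0 [simp]: "v 0 = 0"
  using v_eq_0_iff[of 0] by simp

lemma v_1 [simp]: "v 1 = 1"
proof -
  have "v 1 * v 1 = v 1" using v_mult[of 1 1] by simp
  then show ?thesis using v_eq_0_iff[of 1] by simp
qed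

lemma v_minus: "x \<in> K \<Longrightarrow> v (- x) = v x"
proof -
  assume x: "x \<in> K"
  have m1: "- 1 \<in> K" using uminus_closed one_closed by blast
  have "v (- 1) * v (- 1) = 1" using v_mult[OF m1 m1] by simp
  then have "v (- 1) = 1" using v_nonneg[OF m1] by (metis mult_1_right power2_eq_1_iff power2_eq_square neg_0_le_iff_le not_one_le_zero)
  then show ?thesis using v_mult[OF m1 x] by simp
qed

lemma v_diff: "x \<in> K \<Longrightarrow> y \<in> K \<Longrightarrow> v (x - y) \<le> v x + v y"
  using v_add[of x "- y"] v_minus[of y] uminus_closed[of y] by simp

lemma v_diff_commute: "x \<in> K \<Longrightarrow> y \<in> K \<Longrightarrow> v (x - y) = v (y - x)"
  using v_minus[of "x - y"] diff_closed[of x y] by simp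

lemma v_diff_ge: "x \<in> K \<Longrightarrow> y \<in> K \<Longrightarrow> v x - v y \<le> v (x - y)"
  using v_add[of "x - y" y] diff_closed[of x y] by simp

lemma v_inverse: "x \<in> K \<Longrightarrow> v (inverse x) = inverse (v x)"
proof (cases "x = 0")
  case False
  assume x: "x \<in> K"
  have "v x * v (inverse x) = 1" using v_mult[OF x inverse_closed[OF x]] False by simp
  then show ?thesis by (metis inverse_unique)
qed simp

lemma v_power: "x \<in> K \<Longrightarrow> v (x ^ n) = v x ^ n"
  by (induction n) (auto simp: v_mult power_closed)

lemma v_sum: "finite I \<Longrightarrow> (\<And>i. i \<in> I \<Longrightarrow> f i \<in> K) \<Longrightarrow> v (sum f I) \<le> (\<Sum>i\<in>I. v (f i))"
proof (induction I rule: finite_induct)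
  case (insert a I)
  have "v (f a + sum f I) \<le> v (f a) + v (sum f I)"
    using insert.prems by (intro v_add sum_closed) auto
  then show ?case using insert by fastforce
qed simp

lemma abs_field_subset:
  assumes "complex_subfield F" "F \<subseteq> K"
  shows "abs_field F v"
proof -
  interpret F: complex_subfield F by fact
  show ?thesis
    by unfold_locales (use abs_value assms(2) in \<open>auto simp: absolute_value_on_def subset_iff\<close>)
qed

lemma abs_field_Rats: "abs_field \<rat> v"
  by (rule abs_field_subset[OF rat.complex_subfield_axioms Rats_subset])

lemma cauchyI:
  assumes "\<And>n. s n \<in> K" "\<And>e. e > 0 \<Longrightarrow> \<exists>N. \<forall>m\<ge>N. \<forall>n\<ge>N. v (s m - s n) < e"
  shows "s \<in> cauchy_seqs K v"
  using assms by (auto simp: cauchy_seqs_def)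

lemma cauchy_mem: "s \<in> cauchy_seqs K v \<Longrightarrow> s n \<in> K"
  by (auto simp: cauchy_seqs_def)

lemma cauchyD: "s \<in> cauchy_seqs K v \<Longrightarrow> e > 0 \<Longrightarrow> \<exists>N. \<forall>m\<ge>N. \<forall>n\<ge>N. v (s m - s n) < e"
  by (auto simp: cauchy_seqs_def)

lemma null_mem: "s \<in> null_seqs K v \<Longrightarrow> s n \<in> K"
  by (auto simp: null_seqs_def)

lemma nullI: "(\<And>n. s n \<in> K) \<Longrightarrow> (\<lambda>n. v (s n)) \<longlonglongrightarrow> 0 \<Longrightarrow> s \<in> null_seqs K v"
  by (auto simp: null_seqs_def)

lemma nullD: "s \<in> null_seqs K v \<Longrightarrow> (\<lambda>n. v (s n)) \<longlonglongrightarrow> 0"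
  by (auto simp: null_seqs_def)

lemma null_compare:
  assumes "\<And>n. s n \<in> K" "\<And>n. v (s n) \<le> f n" "f \<longlonglongrightarrow> 0"
  shows "s \<in> null_seqs K v"
proof (rule nullI[OF assms(1)])
  show "(\<lambda>n. v (s n)) \<longlonglongrightarrow> 0"
    by (rule tendsto_sandwich[OF _ _ tendsto_const assms(3)])
      (use assms v_nonneg in \<open>auto intro!: always_eventually\<close>)
qed

lemma null_eventuallyD:
  assumes "s \<in> null_seqs K v" "e > 0"
  shows "\<exists>N. \<forall>n\<ge>N. v (s n) < e"
  using order_tendstoD(2)[OF nullD[OF assms(1)] assms(2)] by (auto simp: eventually_sequentially)

lemma nullI_eventually:
  assumes "\<And>n. s n \<in> K" "\<And>e. e > 0 \<Longrightarrow> \<exists>N. \<forall>n\<ge>N. v (s n) < e"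
  shows "s \<in> null_seqs K v"
proof (rule nullI[OF assms(1)], rule order_tendstoI)
  fix a :: real assume "a < 0"
  then show "eventually (\<lambda>n. a < v (s n)) sequentially"
    using assms(1) v_nonneg by (intro always_eventually allI) (meson less_le_trans)
next
  fix a :: real assume "0 < a"
  then show "eventually (\<lambda>n. v (s n) < a) sequentially"
    using assms(2) by (auto simp: eventually_sequentially)
qed

lemma null_imp_cauchy: "s \<in> null_seqs K v \<Longrightarrow> s \<in> cauchy_seqs K v"
proof (rule cauchyI)
  assume s: "s \<in> null_seqs K v"
  show "s n \<in> K" for n using null_mem[OF s] .
  fix e :: real assume "e > 0"
  then obtain N where N: "\<forall>n\<ge>N. v (s n) < e / 2" using null_eventuallyD[OF s, of "e / 2"] by auto
  show "\<exists>N. \<forall>m\<ge>N. \<forall>n\<ge>N. v (s m - s n) < e"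
  proof (intro exI allI impI)
    fix m n assume "m \<ge> N" "n \<ge> N"
    then have "v (s m) < e / 2" "v (s n) < e / 2" using N by auto
    then show "v (s m - s n) < e" using v_diff[of "s m" "s n"] null_mem[OF s] by fastforce
  qed
qed

lemma cauchy_const: "x \<in> K \<Longrightarrow> (\<lambda>_. x) \<in> cauchy_seqs K v"
  by (auto simp: cauchy_seqs_def)

lemma cauchy_minus: "s \<in> cauchy_seqs K v \<Longrightarrow> (\<lambda>n. - s n) \<in> cauchy_seqs K v"
proof (rule cauchyI)
  assume s: "s \<in> cauchy_seqs K v"
  show "- s n \<in> K" for n using cauchy_mem[OF s] by blast
  fix e :: real assume "e > 0"
  then obtain N where "\<forall>m\<ge>N. \<forall>n\<ge>N. v (s m - s n) < e" using cauchyD[OF s] by blast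
  then show "\<exists>N. \<forall>m\<ge>N. \<forall>n\<ge>N. v (- s m - - s n) < e"
    by (intro exI[of _ N]) (auto simp: minus_diff_commute)
qed

lemma cauchy_add:
  assumes s: "s \<in> cauchy_seqs K v" and t: "t \<in> cauchy_seqs K v"
  shows "(\<lambda>n. s n + t n) \<in> cauchy_seqs K v"
proof (rule cauchyI)
  show "s n + t n \<in> K" for n using cauchy_mem s t by blast
  fix e :: real assume "e > 0"
  then obtain M N where M: "\<forall>m\<ge>M. \<forall>n\<ge>M. v (s m - s n) < e / 2" and N: "\<forall>m\<ge>N. \<forall>n\<ge>N. v (t m - t n) < e / 2"
    using cauchyD[OF s, of "e / 2"] cauchyD[OF t, of "e / 2"] by auto
  show "\<exists>N. \<forall>m\<ge>N. \<forall>n\<ge>N. v (s m + t m - (s n + t n)) < e"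
  proof (intro exI allI impI)
    fix m n assume mn: "m \<ge> max M N" "n \<ge> max M N"
    have "v (s m + t m - (s n + t n)) = v ((s m - s n) + (t m - t n))" by (simp add: algebra_simps)
    also have "\<dots> \<le> v (s m - s n) + v (t m - t n)"
      using cauchy_mem s t by (intro v_add diff_closed) auto
    also have "\<dots> < e / 2 + e / 2" using M N mn by (intro add_strict_mono) auto
    finally show "v (s m + t m - (s n + t n)) < e" by simp
  qed
qed

lemma cauchy_bounded:
  assumes s: "s \<in> cauchy_seqs K v"
  obtains B where "B > 0" "\<And>n. v (s n) \<le> B"
proof -
  obtain N where N: "\<forall>m\<ge>N. \<forall>n\<ge>N. v (s m - s n) < 1" using cauchyD[OF s, of 1] by auto
  define B where "B = Max ((\<lambda>n. v (s n)) ` {..N}) + 1"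
  have le: "v (s n) \<le> Max ((\<lambda>n. v (s n)) ` {..N})" if "n \<le> N" for n
    using that by (intro Max_ge) auto
  have "v (s n) \<le> B" for n
  proof (cases "n \<le> N")
    case False
    then have "v (s n - s N) < 1" using N by auto
    moreover have "v (s n) - v (s N) \<le> v (s n - s N)" using cauchy_mem[OF s] by (intro v_diff_ge) auto
    ultimately show ?thesis using le[OF order_refl] unfolding B_def by linarith
  next
    case True
    then show ?thesis using le[OF True] unfolding B_def by linarith
  qed
  moreover have "B > 0" using le[OF order_refl] v_nonneg[OF cauchy_mem[OF s, of N]]
    unfolding B_def by linarith
  ultimately show thesis using that by blast
qed

lemma cauchy_mult:
  assumes s: "s \<in> cauchy_seqs K v" and t: "t \<in> cauchy_seqs K v"
  shows "(\<lambda>n. s n * t n) \<in> cauchy_seqs K v"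
proof (rule cauchyI)
  note mem = cauchy_mem[OF s] cauchy_mem[OF t]
  show "s n * t n \<in> K" for n using mem by blast
  obtain A where A: "A > 0" "\<And>n. v (s n) \<le> A" using cauchy_bounded[OF s] by blast
  obtain B where B: "B > 0" "\<And>n. v (t n) \<le> B" using cauchy_bounded[OF t] by blast
  fix e :: real assume e: "e > 0"
  then obtain M N where M: "\<forall>m\<ge>M. \<forall>n\<ge>M. v (s m - s n) < e / (2 * B)"
    and N: "\<forall>m\<ge>N. \<forall>n\<ge>N. v (t m - t n) < e / (2 * A)"
    using cauchyD[OF s, of "e / (2 * B)"] cauchyD[OF t, of "e / (2 * A)"] A B by auto
  show "\<exists>N. \<forall>m\<ge>N. \<forall>n\<ge>N. v (s m * t m - s n * t n) < e"
  proof (intro exI allI impI)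
    fix m n assume mn: "m \<ge> max M N" "n \<ge> max M N"
    have "v (s m * t m - s n * t n) = v (s m * (t m - t n) + (s m - s n) * t n)" by (simp add: algebra_simps)
    also have "\<dots> \<le> v (s m * (t m - t n)) + v ((s m - s n) * t n)"
      using mem by (intro v_add diff_closed mult_closed) auto
    also have "\<dots> = v (s m) * v (t m - t n) + v (s m - s n) * v (t n)"
      using mem by (simp add: v_mult diff_closed)
    also have "\<dots> \<le> A * v (t m - t n) + v (s m - s n) * B"
      using A B mem by (intro add_mono mult_right_mono mult_left_mono v_nonneg diff_closed) auto
    also have "\<dots> < A * (e / (2 * A)) + e / (2 * B) * B"
      using A B M N mn by (intro add_strict_mono mult_strict_left_mono mult_strict_right_mono) auto
    also have "\<dots> = e" using A B by (simp add: field_simps)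
    finally show "v (s m * t m - s n * t n) < e" .
  qed
qed

lemma null_mult:
  assumes s: "s \<in> null_seqs K v" and t: "t \<in> cauchy_seqs K v"
  shows "(\<lambda>n. s n * t n) \<in> null_seqs K v"
proof -
  obtain B where B: "B > 0" "\<And>n. v (t n) \<le> B" using cauchy_bounded[OF t] by blast
  show ?thesis
  proof (rule null_compare)
    show "s n * t n \<in> K" for n using null_mem[OF s] cauchy_mem[OF t] by blast
    show "v (s n * t n) \<le> v (s n) * B" for n
      using B null_mem[OF s] cauchy_mem[OF t] by (simp add: v_mult mult_left_mono v_nonneg)
    show "(\<lambda>n. v (s n) * B) \<longlonglongrightarrow> 0" using tendsto_mult_left_zero[OF nullD[OF s]] .
  qed
qed

lemma null_add:
  assumes s: "s \<in> null_seqs K v" and t: "t \<in> null_seqs K v"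
  shows "(\<lambda>n. s n + t n) \<in> null_seqs K v"
proof (rule null_compare)
  show "s n + t n \<in> K" for n using null_mem s t by blast
  show "v (s n + t n) \<le> v (s n) + v (t n)" for n using null_mem s t by (intro v_add) auto
  show "(\<lambda>n. v (s n) + v (t n)) \<longlonglongrightarrow> 0" using tendsto_add[OF nullD[OF s] nullD[OF t]] by simp
qed

lemma null_minus: "s \<in> null_seqs K v \<Longrightarrow> (\<lambda>n. - s n) \<in> null_seqs K v"
  using null_mult[of s "\<lambda>_. - 1"] cauchy_const[of "- 1"] uminus_closed[OF one_closed] by simp

text \<open>Some late term has value at least \<open>e\<close>, and from \<open>N\<close> on all
  terms are within \<open>e / 2\<close> of it.\<close>

lemma not_null_lower_bound:
  assumes s: "s \<in> cauchy_seqs K v" "s \<notin> null_seqs K v"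
  obtains N e where "e > 0" "\<And>n. n \<ge> N \<Longrightarrow> v (s n) \<ge> e"
proof -
  obtain e where e: "e > 0" "\<And>N. \<exists>n\<ge>N. v (s n) \<ge> e"
    using nullI_eventually[of s] cauchy_mem[OF s(1)] s(2) by (meson not_less)
  obtain N where N: "\<forall>m\<ge>N. \<forall>n\<ge>N. v (s m - s n) < e / 2" using cauchyD[OF s(1), of "e / 2"] e(1) by auto
  obtain k where k: "k \<ge> N" "v (s k) \<ge> e" using e(2) by blast
  have "v (s n) \<ge> e / 2" if "n \<ge> N" for n
  proof -
    have "v (s k) - v (s n) \<le> v (s k - s n)" using cauchy_mem[OF s(1)] by (intro v_diff_ge) auto
    also have "\<dots> < e / 2" using N k that by auto
    finally show ?thesis using k(2) by linarith
  qed
  then show thesis using that[of "e / 2" N] e(1) by simp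
qed

text \<open>Finitely many terms may vanish, and their inverse is 0 by convention; hence the product
  with the inverse sequence equals 1 only up to a null sequence.\<close>

lemma cauchy_inverse:
  assumes s: "s \<in> cauchy_seqs K v" "s \<notin> null_seqs K v"
  shows "(\<lambda>n. inverse (s n)) \<in> cauchy_seqs K v"
    and "(\<lambda>n. s n * inverse (s n) - 1) \<in> null_seqs K v"
proof -
  note mem = cauchy_mem[OF s(1)]
  obtain N d where d: "d > 0" "\<And>n. n \<ge> N \<Longrightarrow> v (s n) \<ge> d"
    using not_null_lower_bound[OF s] by metis
  have nz: "s n \<noteq> 0" if "n \<ge> N" for n using d(2)[OF that] d(1) by auto
  show "(\<lambda>n. inverse (s n)) \<in> cauchy_seqs K v"
  proof (rule cauchyI)
    show "inverse (s n) \<in> K" for n using mem by blast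
    fix e :: real assume "e > 0"
    then obtain M where M: "\<forall>m\<ge>M. \<forall>n\<ge>M. v (s m - s n) < e * (d * d)"
      using cauchyD[OF s(1), of "e * (d * d)"] d(1) by auto
    show "\<exists>N. \<forall>m\<ge>N. \<forall>n\<ge>N. v (inverse (s m) - inverse (s n)) < e"
    proof (intro exI allI impI)
      fix m n assume mn: "m \<ge> max M N" "n \<ge> max M N"
      have "inverse (s m) - inverse (s n) = (s n - s m) * (inverse (s m) * inverse (s n))"
        using nz mn by (simp add: field_simps)
      then have "v (inverse (s m) - inverse (s n)) = v (s n - s m) * (inverse (v (s m)) * inverse (v (s n)))"
        using mem by (simp add: v_mult v_inverse diff_closed inverse_closed mult_closed)
      also have "\<dots> \<le> v (s n - s m) * (inverse d * inverse d)"
        using d mn mem by (intro mult_left_mono mult_mono le_imp_inverse_le v_nonneg diff_closed) (auto intro: v_nonneg)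
      also have "\<dots> < e * (d * d) * (inverse d * inverse d)"
        using M mn d(1) by (intro mult_strict_right_mono) auto
      also have "\<dots> = e" using d(1) by (simp add: field_simps)
      finally show "v (inverse (s m) - inverse (s n)) < e" .
    qed
  qed
  show "(\<lambda>n. s n * inverse (s n) - 1) \<in> null_seqs K v"
  proof (rule nullI_eventually)
    show "s n * inverse (s n) - 1 \<in> K" for n using mem by blast
    fix e :: real assume "e > 0"
    then show "\<exists>N. \<forall>n\<ge>N. v (s n * inverse (s n) - 1) < e"
      using nz by (intro exI[of _ N]) auto
  qed
qed

lemma cring_cauchy_ring: "cring (cauchy_ring K v)"
proof (rule cringI)
  show "abelian_group (cauchy_ring K v)"
  proof (rule abelian_groupI)
    fix s assume "s \<in> carrier (cauchy_ring K v)"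
    then show "\<exists>t\<in>carrier (cauchy_ring K v). t \<oplus>\<^bsub>cauchy_ring K v\<^esub> s = \<zero>\<^bsub>cauchy_ring K v\<^esub>"
      by (intro bexI[of _ "\<lambda>n. - s n"]) (auto simp: cauchy_ring_def cauchy_minus)
  qed (auto simp: cauchy_ring_def cauchy_add cauchy_const algebra_simps)
  show "comm_monoid (cauchy_ring K v)"
    by (rule comm_monoidI) (auto simp: cauchy_ring_def cauchy_mult cauchy_const algebra_simps)
qed (auto simp: cauchy_ring_def algebra_simps)

sublocale R: cring "cauchy_ring K v"
  by (rule cring_cauchy_ring)

lemma a_inv_cauchy_ring: "s \<in> cauchy_seqs K v \<Longrightarrow> \<ominus>\<^bsub>cauchy_ring K v\<^esub> s = (\<lambda>n. - s n)"
  by (rule R.minus_equality) (auto simp: cauchy_ring_def cauchy_minus)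

lemma ideal_null_seqs: "ideal (null_seqs K v) (cauchy_ring K v)"
proof (rule idealI)
  show "ring (cauchy_ring K v)" ..
  show "subgroup (null_seqs K v) (add_monoid (cauchy_ring K v))"
  proof (rule R.add.subgroupI)
    show "null_seqs K v \<subseteq> carrier (cauchy_ring K v)"
      using null_imp_cauchy by (auto simp: cauchy_ring_def)
    have "(\<lambda>_. 0) \<in> null_seqs K v" by (rule nullI) auto
    then show "null_seqs K v \<noteq> {}" by blast
    show "\<ominus>\<^bsub>cauchy_ring K v\<^esub> s \<in> null_seqs K v" if "s \<in> null_seqs K v" for s
      using a_inv_cauchy_ring[OF null_imp_cauchy[OF that]] null_minus[OF that] by simp
    show "s \<oplus>\<^bsub>cauchy_ring K v\<^esub> t \<in> null_seqs K v" if "s \<in> null_seqs K v" "t \<in> null_seqs K v" for s t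
      using null_add[OF that] by (simp add: cauchy_ring_def)
  qed
  fix s t assume st: "s \<in> null_seqs K v" "t \<in> carrier (cauchy_ring K v)"
  then show "s \<otimes>\<^bsub>cauchy_ring K v\<^esub> t \<in> null_seqs K v" "t \<otimes>\<^bsub>cauchy_ring K v\<^esub> s \<in> null_seqs K v"
    using null_mult[of s t] by (auto simp: cauchy_ring_def mult.commute)
qed

sublocale I: ideal "null_seqs K v" "cauchy_ring K v"
  by (rule ideal_null_seqs)

sublocale C: cring "completion K v"
  unfolding completion_def by (rule I.quotient_is_cring[OF cring_cauchy_ring])

definition cls :: "(nat \<Rightarrow> complex) \<Rightarrow> (nat \<Rightarrow> complex) set" where
  "cls s = null_seqs K v +>\<^bsub>cauchy_ring K v\<^esub> s"

lemma cls_hom: "cls \<in> ring_hom (cauchy_ring K v) (completion K v)"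
  using I.rcos_ring_hom by (simp add: completion_def cls_def[abs_def])

lemma cls_closed: "s \<in> cauchy_seqs K v \<Longrightarrow> cls s \<in> carrier (completion K v)"
  using ring_hom_memE(1)[OF cls_hom] by (simp add: cauchy_ring_def)

lemma cls_add: "s \<in> cauchy_seqs K v \<Longrightarrow> t \<in> cauchy_seqs K v \<Longrightarrow>
    cls s \<oplus>\<^bsub>completion K v\<^esub> cls t = cls (\<lambda>n. s n + t n)"
  using ring_hom_memE(3)[OF cls_hom, of s t] by (simp add: cauchy_ring_def)

lemma cls_mult: "s \<in> cauchy_seqs K v \<Longrightarrow> t \<in> cauchy_seqs K v \<Longrightarrow>
    cls s \<otimes>\<^bsub>completion K v\<^esub> cls t = cls (\<lambda>n. s n * t n)"
  using ring_hom_memE(2)[OF cls_hom, of s t] by (simp add: cauchy_ring_def)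

lemma cls_one: "cls (\<lambda>_. 1) = \<one>\<^bsub>completion K v\<^esub>"
  using ring_hom_memE(4)[OF cls_hom] by (simp add: cauchy_ring_def)

lemma cls_eq_zero_iff:
  assumes "s \<in> cauchy_seqs K v"
  shows "cls s = \<zero>\<^bsub>completion K v\<^esub> \<longleftrightarrow> s \<in> null_seqs K v"
proof -
  have z: "\<zero>\<^bsub>completion K v\<^esub> = null_seqs K v" by (simp add: completion_def FactRing_def)
  have s: "s \<in> carrier (cauchy_ring K v)" using assms by (simp add: cauchy_ring_def)
  show ?thesis unfolding z cls_def
    using R.a_coset_join1[OF _ s I.is_additive_subgroup[THEN additive_subgroup.a_subgroup]]
      R.a_coset_join2[OF s I.is_additive_subgroup[THEN additive_subgroup.a_subgroup]] by blast
qed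

lemma cls_eqI:
  assumes "s \<in> cauchy_seqs K v" "t \<in> cauchy_seqs K v" "(\<lambda>n. s n - t n) \<in> null_seqs K v"
  shows "cls s = cls t"
proof -
  have d: "(\<lambda>n. s n - t n) \<in> cauchy_seqs K v" by (rule null_imp_cauchy[OF assms(3)])
  have "cls s = cls t \<oplus>\<^bsub>completion K v\<^esub> cls (\<lambda>n. s n - t n)"
    unfolding cls_add[OF assms(2) d] by simp
  also have "cls (\<lambda>n. s n - t n) = \<zero>\<^bsub>completion K v\<^esub>"
    using cls_eq_zero_iff[OF d] assms(3) by blast
  finally show ?thesis using cls_closed[OF assms(2)] by simp
qed

lemma cls_minus:
  assumes "s \<in> cauchy_seqs K v"
  shows "\<ominus>\<^bsub>completion K v\<^esub> cls s = cls (\<lambda>n. - s n)"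
proof (rule C.minus_equality)
  have "(\<lambda>_. 0) \<in> null_seqs K v" by (rule nullI) auto
  then show "cls (\<lambda>n. - s n) \<oplus>\<^bsub>completion K v\<^esub> cls s = \<zero>\<^bsub>completion K v\<^esub>"
    using assms cls_eq_zero_iff[OF null_imp_cauchy] by (simp add: cls_add cauchy_minus)
qed (use assms cls_closed cauchy_minus in auto)

lemma carrier_completion: "carrier (completion K v) = cls ` cauchy_seqs K v"
  by (auto simp: completion_def FactRing_def A_RCOSETS_def' cls_def cauchy_ring_def)

lemma cls_sum:
  assumes "finite J" "\<And>i. i \<in> J \<Longrightarrow> s i \<in> cauchy_seqs K v"
  shows "(\<Oplus>\<^bsub>completion K v\<^esub>i\<in>J. cls (s i)) = cls (\<lambda>n. \<Sum>i\<in>J. s i n)"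
    and "(\<lambda>n. \<Sum>i\<in>J. s i n) \<in> cauchy_seqs K v"
proof -
  have "(\<Oplus>\<^bsub>completion K v\<^esub>i\<in>J. cls (s i)) = cls (\<lambda>n. \<Sum>i\<in>J. s i n) \<and>
    (\<lambda>n. \<Sum>i\<in>J. s i n) \<in> cauchy_seqs K v"
    using assms
  proof (induction J rule: finite_induct)
    case empty
    have "(\<lambda>_. 0) \<in> null_seqs K v" by (rule nullI) auto
    then show ?case using cls_eq_zero_iff[OF null_imp_cauchy] cauchy_const[of 0] by simp
  next
    case (insert a J)
    then show ?case by (simp add: cls_closed cls_add cauchy_add)
  qed
  then show "(\<Oplus>\<^bsub>completion K v\<^esub>i\<in>J. cls (s i)) = cls (\<lambda>n. \<Sum>i\<in>J. s i n)"
    and "(\<lambda>n. \<Sum>i\<in>J. s i n) \<in> cauchy_seqs K v" by auto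
qed

lemma cauchy_Rats: "cauchy_seqs \<rat> v \<subseteq> cauchy_seqs K v"
  using Rats_subset by (auto simp: cauchy_seqs_def)

lemma rat_completion_eq: "rat_completion K v = cls ` cauchy_seqs \<rat> v"
  by (simp add: rat_completion_def cls_def[abs_def])

text \<open>Inverses are formed termwise in the rational sequence. Being null depends on the values
  alone, so for rational terms it means the same over the rationals and over
  \<open>K\<close>.\<close>

lemma subfield_rat_completion: "subfield (rat_completion K v) (completion K v)"
proof -
  interpret Q: abs_field \<rat> v by (rule abs_field_Rats)
  note sub = cauchy_Rats[THEN subsetD]
  show ?thesis unfolding rat_completion_eq
  proof (rule C.subfieldI_inverses)
    show "cls ` cauchy_seqs \<rat> v \<subseteq> carrier (completion K v)" using sub cls_closed by auto
    show "\<one>\<^bsub>completion K v\<^esub> \<in> cls ` cauchy_seqs \<rat> v"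
      unfolding cls_one[symmetric] using Q.cauchy_const[of 1] by auto
    show "\<one>\<^bsub>completion K v\<^esub> \<noteq> \<zero>\<^bsub>completion K v\<^esub>"
    proof
      assume "\<one>\<^bsub>completion K v\<^esub> = \<zero>\<^bsub>completion K v\<^esub>"
      then have "(\<lambda>_. 1) \<in> null_seqs K v"
        unfolding cls_one[symmetric] using cls_eq_zero_iff[OF cauchy_const[of 1]] by simp
      from nullD[OF this] show False by (simp add: LIMSEQ_const_iff)
    qed
    fix h assume "h \<in> cls ` cauchy_seqs \<rat> v"
    then obtain s where s: "s \<in> cauchy_seqs \<rat> v" "h = cls s" by auto
    show "\<ominus>\<^bsub>completion K v\<^esub> h \<in> cls ` cauchy_seqs \<rat> v"
      using s cls_minus[OF sub] Q.cauchy_minus by auto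
    {
      fix k assume "k \<in> cls ` cauchy_seqs \<rat> v"
      then obtain t where t: "t \<in> cauchy_seqs \<rat> v" "k = cls t" by auto
      show "h \<otimes>\<^bsub>completion K v\<^esub> k \<in> cls ` cauchy_seqs \<rat> v"
        using s t cls_mult[OF sub sub] Q.cauchy_mult by auto
      show "h \<oplus>\<^bsub>completion K v\<^esub> k \<in> cls ` cauchy_seqs \<rat> v"
        using s t cls_add[OF sub sub] Q.cauchy_add by auto
    }
    assume "h \<noteq> \<zero>\<^bsub>completion K v\<^esub>"
    then have nn: "s \<notin> null_seqs K v" using s cls_eq_zero_iff[OF sub[OF s(1)]] by blast
    then have "s \<notin> null_seqs \<rat> v" using Q.cauchy_mem[OF s(1)] Rats_subset by (auto simp: null_seqs_def)
    then have i: "(\<lambda>n. inverse (s n)) \<in> cauchy_seqs \<rat> v" using Q.cauchy_inverse(1)[OF s(1)] by blast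
    have "cls (\<lambda>n. s n * inverse (s n)) = cls (\<lambda>_. 1)"
      by (rule cls_eqI[OF cauchy_mult[OF sub[OF s(1)] sub[OF i]] cauchy_const cauchy_inverse(2)[OF sub[OF s(1)] nn]]) simp
    then show "\<exists>k\<in>cls ` cauchy_seqs \<rat> v. h \<otimes>\<^bsub>completion K v\<^esub> k = \<one>\<^bsub>completion K v\<^esub>"
      using i s cls_mult[OF sub[OF s(1)] sub[OF i]] cls_one by (intro bexI[of _ "cls (\<lambda>n. inverse (s n))"]) auto
  qed
qed

end

text \<open>The \<open>Q\<^sub>v\<close>-linear independence of \<open>x 0, \<dots>, x (m - 1)\<close> in the completion, expressed
  without leaving the number field.\<close>

definition v_independent :: "(complex \<Rightarrow> real) \<Rightarrow> nat \<Rightarrow> (nat \<Rightarrow> complex) \<Rightarrow> bool" where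
  "v_independent v m x \<longleftrightarrow> (\<exists>C>0. \<forall>c. (\<forall>i<m. c i \<in> \<rat>) \<longrightarrow> (\<forall>i<m. v (c i) \<le> C * v (\<Sum>i<m. c i * x i)))"

text \<open>Stands for spanning over the completed rationals. Density alone gives only
  approximations; the bound in \<open>v_independent\<close> makes their coefficients
  converge.\<close>

definition v_dense :: "complex set \<Rightarrow> (complex \<Rightarrow> real) \<Rightarrow> nat \<Rightarrow> (nat \<Rightarrow> complex) \<Rightarrow> bool" where
  "v_dense K v m x \<longleftrightarrow> (\<forall>y\<in>K. \<forall>e>0. \<exists>c. (\<forall>i<m. c i \<in> \<rat>) \<and> v (y - (\<Sum>i<m. c i * x i)) < e)"

context abs_field begin

text \<open>The classes of the constants \<open>x i\<close> form a basis. The bound in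
  \<open>v_independent\<close> forces null coefficients in a null combination, and it makes the
  coefficients of approximating combinations Cauchy sequences, so that density turns into
  spanning.\<close>

lemma local_degree_eqI:
  assumes x: "\<And>i. i < m \<Longrightarrow> x i \<in> K" and ind: "v_independent v m x" and dense: "v_dense K v m x"
  shows "local_degree K v = m"
  unfolding local_degree_def
proof (rule C.vs_dim_eqI[OF subfield_rat_completion, where u = "\<lambda>i. cls (\<lambda>_. x i)"])
  interpret Q: abs_field \<rat> v by (rule abs_field_Rats)
  note sub = cauchy_Rats[THEN subsetD]
  obtain C where C: "C > 0" "\<And>c i. (\<And>i. i < m \<Longrightarrow> c i \<in> \<rat>) \<Longrightarrow> i < m \<Longrightarrow> v (c i) \<le> C * v (\<Sum>i<m. c i * x i)"
    using ind by (auto simp: v_independent_def)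
  show cx: "cls (\<lambda>_. x i) \<in> carrier (completion K v)" if "i < m" for i
    using cls_closed cauchy_const x that by blast
  have lin: "(\<Oplus>\<^bsub>completion K v\<^esub>i\<in>{..<m}. cls (s i) \<otimes>\<^bsub>completion K v\<^esub> cls (\<lambda>_. x i)) = cls (\<lambda>n. \<Sum>i<m. s i n * x i)"
    and lin_mem: "(\<lambda>n. \<Sum>i<m. s i n * x i) \<in> cauchy_seqs K v"
    if s: "\<And>i. i < m \<Longrightarrow> s i \<in> cauchy_seqs \<rat> v" for s
  proof -
    have sx: "(\<lambda>n. s i n * x i) \<in> cauchy_seqs K v" if "i < m" for i
      using cauchy_mult[OF sub cauchy_const] s x that by blast
    have "(\<Oplus>\<^bsub>completion K v\<^esub>i\<in>{..<m}. cls (s i) \<otimes>\<^bsub>completion K v\<^esub> cls (\<lambda>_. x i)) =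
        (\<Oplus>\<^bsub>completion K v\<^esub>i\<in>{..<m}. cls (\<lambda>n. s i n * x i))"
      by (intro C.finsum_cong' refl) (use cls_mult[OF sub cauchy_const] s x cls_closed sx in auto)
    also have "\<dots> = cls (\<lambda>n. \<Sum>i<m. s i n * x i)"
      using sx by (intro cls_sum) auto
    finally show "(\<Oplus>\<^bsub>completion K v\<^esub>i\<in>{..<m}. cls (s i) \<otimes>\<^bsub>completion K v\<^esub> cls (\<lambda>_. x i)) = cls (\<lambda>n. \<Sum>i<m. s i n * x i)" .
    show "(\<lambda>n. \<Sum>i<m. s i n * x i) \<in> cauchy_seqs K v" using sx by (intro cls_sum) auto
  qed
  {
    fix c i assume c: "\<And>i. i < m \<Longrightarrow> c i \<in> rat_completion K v"
      and zero: "(\<Oplus>\<^bsub>completion K v\<^esub>i\<in>{..<m}. c i \<otimes>\<^bsub>completion K v\<^esub> cls (\<lambda>_. x i)) = \<zero>\<^bsub>completion K v\<^esub>"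
      and i: "i < m"
    have "\<forall>i. \<exists>s. i < m \<longrightarrow> s \<in> cauchy_seqs \<rat> v \<and> c i = cls s"
      using c unfolding rat_completion_eq by blast
    then obtain s where s: "\<And>i. i < m \<Longrightarrow> s i \<in> cauchy_seqs \<rat> v" "\<And>i. i < m \<Longrightarrow> c i = cls (s i)" by metis
    have "(\<Oplus>\<^bsub>completion K v\<^esub>i\<in>{..<m}. c i \<otimes>\<^bsub>completion K v\<^esub> cls (\<lambda>_. x i)) =
      (\<Oplus>\<^bsub>completion K v\<^esub>i\<in>{..<m}. cls (s i) \<otimes>\<^bsub>completion K v\<^esub> cls (\<lambda>_. x i))"
      by (intro C.finsum_cong' refl) (use s cls_closed[OF sub] cx in auto)
    then have "cls (\<lambda>n. \<Sum>i<m. s i n * x i) = \<zero>\<^bsub>completion K v\<^esub>"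
      using zero lin[OF s(1)] by simp
    then have null: "(\<lambda>n. \<Sum>i<m. s i n * x i) \<in> null_seqs K v"
      using cls_eq_zero_iff[OF lin_mem[OF s(1)]] by simp
    have "s i \<in> null_seqs K v"
    proof (rule null_compare)
      show "s i n \<in> K" for n using cauchy_mem[OF sub[OF s(1)[OF i]]] .
      show "v (s i n) \<le> C * v (\<Sum>i<m. s i n * x i)" for n
        using C(2)[of "\<lambda>i. s i n" i] Q.cauchy_mem[OF s(1)] i by blast
      show "(\<lambda>n. C * v (\<Sum>i<m. s i n * x i)) \<longlonglongrightarrow> 0"
        using tendsto_mult_right_zero[OF nullD[OF null]] .
    qed
    then show "c i = \<zero>\<^bsub>completion K v\<^esub>" using cls_eq_zero_iff[OF sub[OF s(1)[OF i]]] s(2)[OF i] by simp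
  }
  show "carrier (completion K v) = {\<Oplus>\<^bsub>completion K v\<^esub>i\<in>{..<m}. c i \<otimes>\<^bsub>completion K v\<^esub> cls (\<lambda>_. x i) | c.
     \<forall>i<m. c i \<in> rat_completion K v}"
  proof (intro equalityI subsetI)
    fix y assume "y \<in> carrier (completion K v)"
    then obtain s where s: "s \<in> cauchy_seqs K v" "y = cls s" unfolding carrier_completion by blast
    note smem = cauchy_mem[OF s(1)]
    have "\<forall>n. \<exists>c. (\<forall>i<m. c i \<in> \<rat>) \<and> v (s n - (\<Sum>i<m. c i * x i)) < inverse (real (Suc n))"
      using dense smem unfolding v_dense_def by (simp del: of_nat_Suc)
    then obtain c where c: "\<And>n i. i < m \<Longrightarrow> c n i \<in> \<rat>"
      "\<And>n. v (s n - (\<Sum>i<m. c n i * x i)) < inverse (real (Suc n))" by metis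
    define w where "w n = (\<Sum>i<m. c n i * x i)" for n
    have wK: "w n \<in> K" for n unfolding w_def using c(1) Rats_subset x by (intro sum_closed mult_closed) auto
    have null: "(\<lambda>n. s n - w n) \<in> null_seqs K v"
    proof (rule null_compare)
      show "s n - w n \<in> K" for n using smem wK by blast
      show "v (s n - w n) \<le> inverse (real (Suc n))" for n using c(2)[of n] by (simp add: w_def less_imp_le)
    qed (rule LIMSEQ_inverse_real_of_nat)
    have wc: "w \<in> cauchy_seqs K v"
      using cauchy_add[OF s(1) cauchy_minus[OF null_imp_cauchy[OF null]]] by simp
    have ct: "(\<lambda>n. c n i) \<in> cauchy_seqs \<rat> v" if i: "i < m" for i
    proof (rule Q.cauchyI)
      show "c n i \<in> \<rat>" for n using c(1) i by blast
      fix e :: real assume "e > 0"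
      then obtain N where N: "\<forall>j\<ge>N. \<forall>n\<ge>N. v (w j - w n) < e / C" using cauchyD[OF wc, of "e / C"] C(1) by auto
      show "\<exists>N. \<forall>j\<ge>N. \<forall>n\<ge>N. v (c j i - c n i) < e"
      proof (intro exI allI impI)
        fix j n assume jn: "j \<ge> N" "n \<ge> N"
        have "v (c j i - c n i) \<le> C * v (\<Sum>i<m. (c j i - c n i) * x i)"
          by (rule C(2)) (use c(1) i in auto)
        also have "(\<Sum>i<m. (c j i - c n i) * x i) = w j - w n"
          by (simp add: w_def sum_subtractf algebra_simps)
        also have "C * v (w j - w n) < C * (e / C)" using N jn C(1) by (intro mult_strict_left_mono) auto
        finally show "v (c j i - c n i) < e" using C(1) by simp
      qed
    qed
    have "y = cls (\<lambda>n. \<Sum>i<m. c n i * x i)"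
      using cls_eqI[OF s(1) wc null] s(2) by (simp add: w_def[abs_def])
    also have "\<dots> = (\<Oplus>\<^bsub>completion K v\<^esub>i\<in>{..<m}. cls (\<lambda>n. c n i) \<otimes>\<^bsub>completion K v\<^esub> cls (\<lambda>_. x i))"
      using lin[OF ct] by simp
    finally show "y \<in> {\<Oplus>\<^bsub>completion K v\<^esub>i\<in>{..<m}. c i \<otimes>\<^bsub>completion K v\<^esub> cls (\<lambda>_. x i) | c.
     \<forall>i<m. c i \<in> rat_completion K v}"
      using ct by (intro CollectI exI[of _ "\<lambda>i. cls (\<lambda>n. c n i)"]) (auto simp: rat_completion_eq)
  next
    fix y assume "y \<in> {\<Oplus>\<^bsub>completion K v\<^esub>i\<in>{..<m}. c i \<otimes>\<^bsub>completion K v\<^esub> cls (\<lambda>_. x i) | c.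
     \<forall>i<m. c i \<in> rat_completion K v}"
    then obtain c where c: "y = (\<Oplus>\<^bsub>completion K v\<^esub>i\<in>{..<m}. c i \<otimes>\<^bsub>completion K v\<^esub> cls (\<lambda>_. x i))"
      "\<forall>i<m. c i \<in> rat_completion K v" by blast
    have "c i \<in> carrier (completion K v)" if "i < m" for i
      using c(2) that cls_closed[OF sub] by (auto simp: rat_completion_eq)
    then show "y \<in> carrier (completion K v)" unfolding c(1) using cx by (intro C.finsum_closed) auto
  qed
qed

end


section \<open>Weak approximation and the sum of the local degrees\<close>

context abs_field begin

text \<open>Consecutive powers of \<open>q\<close> differ in value by the factor \<open>v q\<close>,
  so an interval whose ends have a larger ratio cannot be missed. The exponent is the first integer
  above \<open>log (v q) A\<close>.\<close>

lemma v_rat_power_between: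
  assumes q: "q \<in> \<rat>" "v q > 1" and A: "A > 0" "B > v q * A"
  obtains r where "r \<in> \<rat>" "A < v r" "v r < B"
proof -
  have K: "q \<in> K" using q Rats_subset by blast
  define j where "j = \<lfloor>log (v q) A\<rfloor> + 1"
  define r where "r = q powi j"
  have rQ: "r \<in> \<rat>" using q by (simp add: r_def power_int_def)
  have pw: "v (x powi j) = v x powi j" if "x \<in> K" for x j
    using that by (cases "j \<ge> 0") (auto simp: power_int_def v_power v_inverse inverse_closed)
  have vr: "v r = v q powr j" using q(2) by (simp add: r_def pw[OF K] powr_real_of_int')
  have "log (v q) A < j" "j \<le> log (v q) A + 1" unfolding j_def by linarith+
  then have "A < v q powr j" "v q powr j \<le> v q powr (log (v q) A + 1)"
    using q(2) A(1) by (auto simp: less_powr_iff)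
  moreover have "v q powr (log (v q) A + 1) = v q * A" using q(2) A(1) by (simp add: powr_add)
  ultimately show thesis using that[OF rQ] A(2) vr by simp
qed

text \<open>The mere inequality \<open>v x < w x\<close> is amplified: for large \<open>k\<close>
  the ratio of \<open>w x ^ k\<close> to \<open>v x ^ k\<close> exceeds \<open>v q\<close>, so the
  value of a rational \<open>r\<close> fits in between. Both absolute values agree on
  \<open>r\<close>, and division by \<open>r\<close> moves the gap across 1.\<close>

lemma exists_separating_power:
  assumes w: "abs_field K w" and agree: "\<And>q. q \<in> \<rat> \<Longrightarrow> v q = w q"
    and q: "q \<in> \<rat>" "v q > 1" and x: "x \<in> K" "v x < w x"
  obtains y where "y \<in> K" "v y < 1" "w y > 1"
proof -
  interpret w: abs_field K w by fact
  have x0: "x \<noteq> 0" using x(2) by auto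
  have vx: "v x > 0" using v_nonneg[OF x(1)] v_eq_0_iff[OF x(1)] x0 by linarith
  have "w x / v x > 1" using x(2) vx by simp
  then obtain k where k: "v q < (w x / v x) ^ k" using real_arch_pow by blast
  then have "w x ^ k > v q * v x ^ k" using vx by (simp add: power_divide field_simps)
  then obtain r where r: "r \<in> \<rat>" "v x ^ k < v r" "v r < w x ^ k"
    using v_rat_power_between[OF q, of "v x ^ k" "w x ^ k"] vx by auto
  have rK: "r \<in> K" using r(1) Rats_subset by blast
  have r0: "v r > 0" using r(2) vx by (meson less_trans zero_less_power)
  show thesis
  proof (rule that[of "x ^ k * inverse r"])
    show "x ^ k * inverse r \<in> K" using x(1) rK by blast
    have "v (x ^ k * inverse r) = v x ^ k / v r" "w (x ^ k * inverse r) = w x ^ k / v r"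
      using x(1) rK agree[OF r(1)]
      by (simp_all add: v_mult w.v_mult v_power w.v_power v_inverse w.v_inverse power_closed inverse_closed divide_inverse)
    then show "v (x ^ k * inverse r) < 1" "w (x ^ k * inverse r) > 1" using r r0 by auto
  qed
qed

lemma exists_separating:
  assumes w: "abs_field K w" and agree: "\<And>q. q \<in> \<rat> \<Longrightarrow> v q = w q"
    and q: "q \<in> \<rat>" "v q > 1" and x: "x \<in> K" "v x \<noteq> w x"
  obtains a where "a \<in> K" "v a > 1" "w a < 1"
proof -
  interpret w: abs_field K w by fact
  show thesis
  proof (cases "v x < w x")
    case True
    obtain y where y: "y \<in> K" "v y < 1" "w y > 1"
      using exists_separating_power[OF w agree q x(1) True] by blast
    have "y \<noteq> 0" using y(3) by auto
    then have "0 < v y" using v_nonneg[OF y(1)] v_eq_0_iff[OF y(1)] by linarith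
    then show thesis using y that[of "inverse y"]
      by (auto simp: v_inverse w.v_inverse one_less_inverse_iff inverse_less_1_iff)
  next
    case False
    then have lt: "w x < v x" using x(2) by simp
    show thesis using w.exists_separating_power[OF abs_field_axioms _ q(1) _ x(1) lt] agree q that by metis
  qed
qed

text \<open>As \<open>k\<close> grows, this approaches 1 where \<open>a\<close> has value above 1
  and 0 where it has value below 1. Should \<open>1 + a ^ k\<close> vanish, the result is 0 by
  convention.\<close>

definition approx_unit :: "complex \<Rightarrow> nat \<Rightarrow> complex" where
  "approx_unit a k = a ^ k * inverse (1 + a ^ k)"

lemma approx_unit_closed: "a \<in> K \<Longrightarrow> approx_unit a k \<in> K"
  unfolding approx_unit_def by blast

lemma approx_unit_tendsto_0:
  assumes a: "a \<in> K" "v a < 1"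
  shows "(\<lambda>k. v (approx_unit a k)) \<longlonglongrightarrow> 0"
proof (rule tendsto_sandwich[OF _ _ tendsto_const])
  have lim: "(\<lambda>k. v a ^ k) \<longlonglongrightarrow> 0" using a v_nonneg[OF a(1)] by (intro LIMSEQ_power_zero) auto
  show "(\<lambda>k. v a ^ k / (1 - v a ^ k)) \<longlonglongrightarrow> 0"
    using tendsto_divide[OF lim tendsto_diff[OF tendsto_const lim, of 1]] by simp
  show "eventually (\<lambda>k. 0 \<le> v (approx_unit a k)) sequentially"
    using v_nonneg approx_unit_closed[OF a(1)] by simp
  have "v (approx_unit a k) \<le> v a ^ k / (1 - v a ^ k)" if "k \<ge> 1" for k
  proof -
    have pos: "1 - v a ^ k > 0" using a v_nonneg[OF a(1)] that power_strict_mono[of "v a" 1 k] by simp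
    have mem: "a ^ k \<in> K" "1 + a ^ k \<in> K" using a(1) by auto
    have "1 - v a ^ k \<le> v (1 + a ^ k)"
      using v_diff_ge[OF one_closed uminus_closed[OF mem(1)]] a(1) by (simp add: v_minus mem v_power)
    then have "v a ^ k / v (1 + a ^ k) \<le> v a ^ k / (1 - v a ^ k)"
      using pos a(1) v_nonneg by (intro divide_left_mono) auto
    then show ?thesis
      using a(1) mem by (simp add: approx_unit_def v_mult v_inverse inverse_closed v_power divide_inverse)
  qed
  then show "eventually (\<lambda>k. v (approx_unit a k) \<le> v a ^ k / (1 - v a ^ k)) sequentially"
    by (auto simp: eventually_sequentially)
qed

text \<open>Replacing \<open>a\<close> by \<open>inverse a\<close> exchanges
  \<open>approx_unit a k\<close> and \<open>1 - approx_unit a k\<close>, which reduces the claim to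
  the case of limit 0.\<close>

lemma approx_unit_tendsto_1:
  assumes a: "a \<in> K" "v a > 1"
  shows "(\<lambda>k. v (1 - approx_unit a k)) \<longlonglongrightarrow> 0"
proof -
  have a0: "a \<noteq> 0" using a(2) by auto
  have ia: "inverse a \<in> K" "v (inverse a) < 1" using a by (auto simp: v_inverse inverse_less_1_iff)
  have *: "approx_unit (inverse a) k = 1 - approx_unit a k" if "k \<ge> 1" for k
  proof -
    have "a ^ k \<in> K" using a(1) by blast
    have "v (a ^ k) > 1" using a that by (simp add: v_power)
    moreover have "v (- 1) = 1" using v_minus[OF one_closed] by simp
    ultimately have "a ^ k \<noteq> - 1" by auto
    then have "a ^ k + 1 \<noteq> 0" unfolding eq_neg_iff_add_eq_0 .
    then have "1 + a ^ k \<noteq> 0" by (simp only: add.commute not_False_eq_True)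
    then show ?thesis using a0 by (simp add: approx_unit_def field_simps)
  qed
  have "eventually (\<lambda>k. v (approx_unit (inverse a) k) = v (1 - approx_unit a k)) sequentially"
    unfolding eventually_sequentially by (intro exI[of _ 1] allI impI) (simp only: *)
  then show ?thesis using approx_unit_tendsto_0[OF ia] by (rule Lim_transform_eventually[rotated])
qed

lemma approx_unit_tendsto_value:
  assumes a: "a \<in> K" "v a > 1"
  shows "(\<lambda>k. v (approx_unit a k)) \<longlonglongrightarrow> 1"
proof -
  have m: "approx_unit a k \<in> K" "1 - approx_unit a k \<in> K" for k
    using approx_unit_closed[OF a(1)] diff_closed by auto
  have "\<bar>v (approx_unit a k) - 1\<bar> \<le> v (1 - approx_unit a k)" for k
    using v_diff_ge[OF one_closed m(1), of k] v_diff_ge[OF m(1) one_closed, of k]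
      v_diff_commute[OF m(1) one_closed, of k] by simp
  then have "(\<lambda>k. \<bar>v (approx_unit a k) - 1\<bar>) \<longlonglongrightarrow> 0"
    by (intro tendsto_sandwich[OF _ _ tendsto_const approx_unit_tendsto_1[OF a]]) auto
  then have "(\<lambda>k. v (approx_unit a k) - 1) \<longlonglongrightarrow> 0"
    by (rule tendsto_rabs_zero_cancel)
  then show ?thesis by (simp add: LIM_zero_iff)
qed

text \<open>Induction on \<open>W\<close>: \<open>a\<close> is large at \<open>v\<close> and small
  on the old set, \<open>b\<close> is large at \<open>v\<close> and small at the new
  \<open>w\<close>. They are combined so that \<open>a\<close> takes care of the old set and
  \<open>b\<close> of \<open>w\<close>.\<close>

lemma artin_whaples:
  assumes "finite W" "\<And>w. w \<in> W \<Longrightarrow> abs_field K w" "\<And>w q. w \<in> W \<Longrightarrow> q \<in> \<rat> \<Longrightarrow> v q = w q"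
    and q: "q \<in> \<rat>" "v q > 1" and "\<And>w. w \<in> W \<Longrightarrow> \<exists>x\<in>K. v x \<noteq> w x"
  shows "\<exists>a\<in>K. v a > 1 \<and> (\<forall>w\<in>W. w a < 1)"
  using assms(1,2,3,6)
proof (induction W rule: finite_induct)
  case empty
  then show ?case using q Rats_subset by auto
next
  case (insert w W)
  then obtain a where a: "a \<in> K" "v a > 1" "\<forall>w\<in>W. w a < 1" by auto
  obtain b where b: "b \<in> K" "v b > 1" "w b < 1"
    using exists_separating[of w q] insert.prems q by (metis insertI1)
  interpret w: abs_field K w using insert.prems by simp
  have ak: "a ^ k \<in> K" for k using a(1) by blast
  show ?case
  proof (cases "w a \<le> 1")
    case True
    \<comment> \<open>Powers of \<open>a\<close> do not increase values at \<open>w\<close>, so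
      \<open>a ^ k * b\<close> works once \<open>k\<close> is large.\<close>
    have "eventually (\<lambda>k. \<forall>u\<in>W. u (a ^ k * b) < 1) sequentially"
    proof (rule eventually_ball_finite[OF insert.hyps(1)], rule ballI)
      fix u assume u: "u \<in> W"
      interpret u: abs_field K u using insert.prems u by simp
      have "(\<lambda>k. u a ^ k * u b) \<longlonglongrightarrow> 0"
        using a(1,3) u u.v_nonneg by (intro tendsto_mult_left_zero LIMSEQ_power_zero) auto
      then show "eventually (\<lambda>k. u (a ^ k * b) < 1) sequentially"
        using order_tendstoD(2)[of "\<lambda>k. u a ^ k * u b" 0 sequentially 1] a(1) b(1) ak
        by (simp add: u.v_mult u.v_power)
    qed
    then obtain k where k: "\<forall>u\<in>W. u (a ^ k * b) < 1" by (auto simp: eventually_sequentially)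
    have "v (a ^ k * b) \<ge> 1 * v b"
      using a b by (simp add: v_mult ak v_power mult_right_mono one_le_power)
    moreover have "w (a ^ k * b) \<le> 1 * w b"
      using a b mult_right_mono[OF power_le_one[OF w.v_nonneg[OF a(1)] True] w.v_nonneg[OF b(1)], of k]
      by (simp add: w.v_mult ak w.v_power)
    ultimately show ?thesis using k b ak by (intro bexI[of _ "a ^ k * b"]) auto
  next
    case False
    \<comment> \<open>Powers of \<open>a\<close> would now blow up at \<open>w\<close>; the value of
      \<open>approx_unit a k\<close> tends to 1 at both \<open>v\<close> and \<open>w\<close> and to
      0 on the old set.\<close>
    define c where "c k = approx_unit a k * b" for k
    have cK: "approx_unit a k \<in> K" "c k \<in> K" for k
      using approx_unit_closed[OF a(1)] b(1) by (auto simp: c_def)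
    have "(\<lambda>k. v (c k)) \<longlonglongrightarrow> 1 * v b"
      using tendsto_mult_right[OF approx_unit_tendsto_value[OF a(1,2)]] b(1) cK by (simp add: c_def v_mult)
    then have 1: "eventually (\<lambda>k. v (c k) > 1) sequentially" using order_tendstoD(1) b(2) by fastforce
    have "(\<lambda>k. w (c k)) \<longlonglongrightarrow> 1 * w b"
      using tendsto_mult_right[OF w.approx_unit_tendsto_value[OF a(1)]] False b(1) cK by (simp add: c_def w.v_mult)
    then have 2: "eventually (\<lambda>k. w (c k) < 1) sequentially" using order_tendstoD(2) b(3) by fastforce
    have 3: "eventually (\<lambda>k. \<forall>u\<in>W. u (c k) < 1) sequentially"
    proof (rule eventually_ball_finite[OF insert.hyps(1)], rule ballI)
      fix u assume u: "u \<in> W"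
      interpret u: abs_field K u using insert.prems u by simp
      have "(\<lambda>k. u (c k)) \<longlonglongrightarrow> 0 * u b"
        using tendsto_mult_right[OF u.approx_unit_tendsto_0[OF a(1)]] u a(3) b(1) cK by (simp add: c_def u.v_mult)
      then show "eventually (\<lambda>k. u (c k) < 1) sequentially"
        using order_tendstoD(2)[of _ _ sequentially 1] by fastforce
    qed
    have "eventually (\<lambda>k. v (c k) > 1 \<and> w (c k) < 1 \<and> (\<forall>u\<in>W. u (c k) < 1)) sequentially"
      using 1 2 3 by eventually_elim auto
    then obtain k where "v (c k) > 1 \<and> w (c k) < 1 \<and> (\<forall>u\<in>W. u (c k) < 1)"
      by (auto simp: eventually_sequentially)
    then show ?thesis using cK(2)[of k] by (intro bexI[of _ "c k"]) auto
  qed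
qed

text \<open>With a separating \<open>a\<close>, the elements \<open>approx_unit a k\<close> tend to
  1 at \<open>v\<close> and to 0 at all of \<open>W\<close>.\<close>

lemma weak_approximation:
  assumes W: "finite W" "\<And>w. w \<in> W \<Longrightarrow> abs_field K w" "\<And>w q. w \<in> W \<Longrightarrow> q \<in> \<rat> \<Longrightarrow> v q = w q"
    and q: "q \<in> \<rat>" "v q > 1" and dist: "\<And>w. w \<in> W \<Longrightarrow> \<exists>x\<in>K. v x \<noteq> w x" and e: "e > 0"
  shows "\<exists>a\<in>K. v (1 - a) < e \<and> (\<forall>w\<in>W. w a < e)"
proof -
  obtain a where a: "a \<in> K" "v a > 1" "\<forall>w\<in>W. w a < 1"
    using artin_whaples[where W = W, OF W(1) _ _ q] W(2,3) dist by blast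
  have "eventually (\<lambda>k. \<forall>w\<in>W. w (approx_unit a k) < e) sequentially"
  proof (rule eventually_ball_finite[OF W(1)], rule ballI)
    fix u assume u: "u \<in> W"
    interpret u: abs_field K u using W u by simp
    show "eventually (\<lambda>k. u (approx_unit a k) < e) sequentially"
      using order_tendstoD(2)[OF u.approx_unit_tendsto_0[OF a(1)] e] u a(3) by simp
  qed
  moreover have "eventually (\<lambda>k. v (1 - approx_unit a k) < e) sequentially"
    using order_tendstoD(2)[OF approx_unit_tendsto_1[OF a(1,2)] e] .
  ultimately have "eventually (\<lambda>k. v (1 - approx_unit a k) < e \<and> (\<forall>w\<in>W. w (approx_unit a k) < e)) sequentially"
    by eventually_elim simp
  then obtain k where "v (1 - approx_unit a k) < e \<and> (\<forall>w\<in>W. w (approx_unit a k) < e)"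
    by (auto simp: eventually_sequentially)
  then show ?thesis using approx_unit_closed[OF a(1)] by blast
qed

text \<open>An element \<open>y\<close> that keeps distance \<open>e\<close> from all rational
  combinations can be added. Dividing a combination \<open>s\<close> by its last coefficient gives
  \<open>v (c m) <= v s / e\<close>, and subtracting that term bounds the other coefficients by the
  old constant \<open>C\<close>.\<close>

lemma v_independent_extend:
  assumes x: "\<And>i. i < m \<Longrightarrow> x i \<in> K" and ind: "v_independent v m x" and nd: "\<not> v_dense K v m x"
  obtains y where "y \<in> K" "v_independent v (Suc m) (x(m := y))"
proof -
  obtain y e where y: "y \<in> K" "e > 0"
    "\<And>c. (\<And>i. i < m \<Longrightarrow> c i \<in> \<rat>) \<Longrightarrow> v (y - (\<Sum>i<m. c i * x i)) \<ge> e"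
    using nd unfolding v_dense_def by (meson not_less)
  obtain C where C: "C > 0" "\<And>c i. (\<And>i. i < m \<Longrightarrow> c i \<in> \<rat>) \<Longrightarrow> i < m \<Longrightarrow> v (c i) \<le> C * v (\<Sum>i<m. c i * x i)"
    using ind by (auto simp: v_independent_def)
  \<comment> \<open>The first summand handles the coefficient of \<open>y\<close>, the second the
    remaining ones.\<close>
  define D where "D = inverse e + C * (1 + v y * inverse e)"
  have D: "D \<ge> inverse e" "D \<ge> C * (1 + v y * inverse e)" "D > 0"
    using C(1) y(2) v_nonneg[OF y(1)] by (auto simp: D_def add_pos_nonneg)
  have "v_independent v (Suc m) (x(m := y))" unfolding v_independent_def
  proof (intro exI[of _ D] conjI D(3) allI impI)
    fix c :: "nat \<Rightarrow> complex" and i assume c: "\<forall>i<Suc m. c i \<in> \<rat>" and i: "i < Suc m"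
    have cK: "c j \<in> K" if "j < Suc m" for j using c that Rats_subset by blast
    define t where "t = (\<Sum>i<m. c i * x i)"
    have tK: "t \<in> K" unfolding t_def using cK x by (intro sum_closed mult_closed) auto
    define s where "s = t + c m * y"
    have cm: "c m \<in> K" "c m * y \<in> K" using cK y(1) by auto
    have sK: "s \<in> K" using tK cm by (auto simp: s_def)
    have s: "(\<Sum>i<Suc m. c i * (x(m := y)) i) = s" by (simp add: s_def t_def)
    have vs: "v s \<ge> 0" by (rule v_nonneg[OF sK])
    have 1: "v (c m) \<le> v s * inverse e"
    proof (cases "c m = 0")
      case False
      have "y - (\<Sum>i<m. (- c i / c m) * x i) = s * inverse (c m)"
      proof -
        have *: "(\<Sum>i<m. (- c i / c m) * x i) = - t / c m"
          unfolding t_def sum_negf[symmetric] sum_divide_distrib by (rule sum.cong) auto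
        have "b - - a / d = (a + d * b) * inverse d" if "d \<noteq> 0" for a b d :: complex
          using that by (simp add: divide_inverse distrib_right mult.assoc[symmetric])
        then show ?thesis unfolding * s_def using False by blast
      qed
      moreover have "v (y - (\<Sum>i<m. (- c i / c m) * x i)) \<ge> e" using c by (intro y(3)) auto
      ultimately have "e \<le> v s * inverse (v (c m))" using sK cm by (simp add: v_mult v_inverse inverse_closed)
      moreover have "v (c m) > 0" using False v_nonneg[OF cm(1)] v_eq_0_iff[OF cm(1)] by linarith
      ultimately show ?thesis using y(2) by (simp add: field_simps)
    qed (use vs y(2) in auto)
    have "v (c i) \<le> D * v s"
    proof (cases "i = m")
      case True
      then show ?thesis using 1 mult_right_mono[OF D(1) vs] by (simp add: mult.commute)
    next
      case False
      then have "v (c i) \<le> C * v t" unfolding t_def using C(2)[of c i] c i by auto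
      also have "t = s - c m * y" by (simp add: s_def)
      also have "C * v (s - c m * y) \<le> C * (v s + v (c m) * v y)"
        using v_diff[OF sK cm(2)] C(1) cm y(1) by (intro mult_left_mono) (auto simp: v_mult)
      also have "\<dots> \<le> C * (v s + v s * inverse e * v y)"
        using 1 C(1) v_nonneg[OF y(1)] by (intro mult_left_mono add_left_mono mult_right_mono) auto
      also have "\<dots> = C * (1 + v y * inverse e) * v s" by (simp add: algebra_simps)
      also have "\<dots> \<le> D * v s" by (rule mult_right_mono[OF D(2) vs])
      finally show ?thesis .
    qed
    then show "v (c i) \<le> D * v (\<Sum>i<Suc m. c i * (x(m := y)) i)" unfolding s .
  qed
  then show thesis using that y(1) by blast
qed

end

section \<open>Upper bound for the sum of the local degrees\<close>

interpretation Qvs: vector_space "\<lambda>(r::rat) (x::complex). of_rat r * x"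
  by unfold_locales (auto simp: algebra_simps of_rat_add of_rat_mult)

lemma (in complex_subfield) adjoin_reduced:
  assumes alg: "algebraic_over F t" and x: "x \<in> adjoin F t"
  obtains P where "P \<in> polys_over F" "degree P < degree (min_poly F t)" "x = poly P t"
proof -
  obtain R where R: "R \<in> polys_over F" "x = poly R t" using x by (auto simp: adjoin_def)
  obtain Q P where P: "P \<in> polys_over F" "R = Q * min_poly F t + P" "P = 0 \<or> degree P < degree (min_poly F t)"
    using polys_over_divide[OF min_poly_over[OF alg] min_poly_monic[OF alg] R(1)] by blast
  have "degree P < degree (min_poly F t)" using P(3) degree_min_poly_pos[OF alg] by auto
  moreover have "x = poly P t" using R(2) P(2) poly_min_poly[OF alg] by simp
  ultimately show thesis using that P(1) by blast
qed

text \<open>The powers of \<open>t\<close> below the degree span the field over the rationals. An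
  indexed family is allowed because independence already rules out repeated members.\<close>

lemma card_independent_le_degree:
  assumes alg: "algebraic t" and S: "finite S" "\<And>s. s \<in> S \<Longrightarrow> y s \<in> adjoin \<rat> t"
    and ind: "\<And>c s. (\<And>s. s \<in> S \<Longrightarrow> c s \<in> \<rat>) \<Longrightarrow> (\<Sum>s\<in>S. c s * y s) = 0 \<Longrightarrow> s \<in> S \<Longrightarrow> c s = 0"
  shows "card S \<le> degree (min_poly \<rat> t)"
proof -
  let ?T = "(\<lambda>i. t ^ i) ` {..<degree (min_poly \<rat> t)}"
  have alg': "algebraic_over \<rat> t" using alg by (simp add: algebraic_over_Rats)
  have span: "adjoin \<rat> t \<subseteq> Qvs.span ?T"
  proof
    fix x assume "x \<in> adjoin \<rat> t"
    then obtain P where P: "P \<in> polys_over \<rat>" "degree P < degree (min_poly \<rat> t)" "x = poly P t"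
      using rat.adjoin_reduced[OF alg'] by blast
    have "coeff P i * t ^ i \<in> Qvs.span ?T" if "i \<le> degree P" for i
    proof -
      obtain r where "coeff P i = of_rat r" using polys_overD[OF P(1)] by (auto elim: Rats_cases)
      then show ?thesis using Qvs.span_scale[OF Qvs.span_base, of "t ^ i" ?T r] that P(2) by auto
    qed
    then show "x \<in> Qvs.span ?T" unfolding P(3) poly_altdef by (intro Qvs.span_sum) auto
  qed
  have inj: "inj_on y S"
  proof (rule inj_onI, rule ccontr)
    fix a b assume ab: "a \<in> S" "b \<in> S" "y a = y b" "a \<noteq> b"
    define c where "c s = (if s = a then 1 else if s = b then - 1 else 0 :: complex)" for s
    have "(\<Sum>s\<in>S. c s * y s) = (\<Sum>s\<in>{a, b}. c s * y s)"
      using ab S by (intro sum.mono_neutral_right) (auto simp: c_def)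
    also have "\<dots> = 0" using ab by (simp add: c_def)
    finally have "c a = 0" using ab by (intro ind[of c a]) (auto simp: c_def)
    then show False by (simp add: c_def)
  qed
  have "Qvs.independent (y ` S)"
  proof
    assume "Qvs.dependent (y ` S)"
    then obtain u where u: "\<exists>z\<in>y ` S. u z \<noteq> 0" "(\<Sum>z\<in>y ` S. of_rat (u z) * z) = 0"
      using S(1) by (auto simp: Qvs.dependent_finite)
    have "(\<Sum>s\<in>S. of_rat (u (y s)) * y s) = 0" using u(2) inj by (simp add: sum.reindex)
    have "of_rat (u (y s)) = (0::complex)" if "s \<in> S" for s
      by (rule ind[of "\<lambda>s. of_rat (u (y s))", OF _ \<open>(\<Sum>s\<in>S. of_rat (u (y s)) * y s) = 0\<close> that]) simp
    then show False using u(1) by auto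
  qed
  then have "card (y ` S) \<le> card ?T"
    using Qvs.independent_span_bound[of ?T "y ` S"] S(2) span by auto
  also have "\<dots> \<le> degree (min_poly \<rat> t)" using card_image_le[of "{..<degree (min_poly \<rat> t)}" "\<lambda>i. t ^ i"] by simp
  finally show ?thesis using inj by (simp add: card_image)
qed


text \<open>The local families are glued into one family that is independent over the rationals:
  each \<open>x v i\<close> is multiplied by an element \<open>e v\<close> close to 1 at
  \<open>v\<close> and close to 0 at the other places. In a nontrivial rational relation the largest
  coefficient belongs to some \<open>v\<close>; at this place the relation is a small perturbation
  of a combination of the \<open>x v i\<close>, against the bound in
  \<open>v_independent\<close>.\<close>

lemma sum_independent_le_degree:
  fixes k :: "(complex \<Rightarrow> real) \<Rightarrow> nat"
  assumes alg: "algebraic t" and V: "finite V" "\<And>v. v \<in> V \<Longrightarrow> abs_field (adjoin \<rat> t) v"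
    and agree: "\<And>v w q. v \<in> V \<Longrightarrow> w \<in> V \<Longrightarrow> q \<in> \<rat> \<Longrightarrow> v q = w q"
    and q: "q \<in> \<rat>" "\<And>v. v \<in> V \<Longrightarrow> v q > 1"
    and dist: "\<And>v w. v \<in> V \<Longrightarrow> w \<in> V \<Longrightarrow> v \<noteq> w \<Longrightarrow> \<exists>x\<in>adjoin \<rat> t. v x \<noteq> w x"
    and x: "\<And>v i. v \<in> V \<Longrightarrow> i < k v \<Longrightarrow> x v i \<in> adjoin \<rat> t"
    and ind: "\<And>v. v \<in> V \<Longrightarrow> v_independent v (k v) (x v)"
  shows "(\<Sum>v\<in>V. k v) \<le> degree (min_poly \<rat> t)"
proof -
  let ?K = "adjoin \<rat> t"
  define S where "S = Sigma V (\<lambda>v. {..<k v})"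
  have finS: "finite S" using V(1) by (auto simp: S_def)
  have "\<forall>v. \<exists>C. v \<in> V \<longrightarrow> C > 0 \<and> (\<forall>c. (\<forall>i<k v. c i \<in> \<rat>) \<longrightarrow> (\<forall>i<k v. v (c i) \<le> C * v (\<Sum>i<k v. c i * x v i)))"
    using ind unfolding v_independent_def by metis
  then obtain C where C: "\<And>v. v \<in> V \<Longrightarrow> C v > 0"
    "\<And>v c i. v \<in> V \<Longrightarrow> (\<And>i. i < k v \<Longrightarrow> c i \<in> \<rat>) \<Longrightarrow> i < k v \<Longrightarrow> v (c i) \<le> C v * v (\<Sum>i<k v. c i * x v i)"
    by metis
  define xs where "xs s = x (fst s) (snd s)" for s
  have xsK: "xs s \<in> ?K" if "s \<in> S" for s using x that by (auto simp: xs_def S_def)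
  have nn: "v y \<ge> 0" if "v \<in> V" "y \<in> ?K" for v y
    using abs_field.v_nonneg[OF V(2)[OF that(1)] that(2)] .
  define Y where "Y = 1 + (\<Sum>v\<in>V. \<Sum>s\<in>S. v (xs s))"
  have Y1: "Y \<ge> 1" unfolding Y_def using nn xsK by (simp add: sum_nonneg)
  have Y: "v (xs s) \<le> Y" if v: "v \<in> V" and s: "s \<in> S" for v s
  proof -
    have "v (xs s) \<le> (\<Sum>s\<in>S. v (xs s))" using nn v s xsK finS by (intro member_le_sum) auto
    also have "\<dots> \<le> (\<Sum>v\<in>V. \<Sum>s\<in>S. v (xs s))" using nn v xsK V(1) by (intro member_le_sum) (auto intro: sum_nonneg)
    finally show ?thesis by (simp add: Y_def)
  qed
  define D where "D = 1 + (\<Sum>v\<in>V. C v)"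
  have D: "C v < D" if "v \<in> V" for v
    using member_le_sum[of v V C] that C(1) V(1) by (force simp: D_def less_imp_le)
  have D1: "D \<ge> 1" unfolding D_def using C(1) by (simp add: sum_nonneg less_imp_le)
  define N where "N = real (card S) + 1"
  have N: "N \<ge> 1" by (simp add: N_def)
  \<comment> \<open>Chosen so small that the perturbation, at most \<open>N * (M * d * Y)\<close>,
    stays below the largest coefficient \<open>M\<close> even after multiplication by any constant
    \<open>C v\<close>.\<close>
  define d where "d = 1 / (D * Y * N)"
  have d: "d > 0" unfolding d_def using D1 Y1 N by simp
  have "\<forall>v. \<exists>a. v \<in> V \<longrightarrow> a \<in> ?K \<and> v (1 - a) < d \<and> (\<forall>w\<in>V - {v}. w a < d)"
  proof (intro allI)
    fix v
    show "\<exists>a. v \<in> V \<longrightarrow> a \<in> ?K \<and> v (1 - a) < d \<and> (\<forall>w\<in>V - {v}. w a < d)"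
    proof (cases "v \<in> V")
      case True
      interpret v: abs_field ?K v by (rule V(2)[OF True])
      have "\<exists>a\<in>?K. v (1 - a) < d \<and> (\<forall>w\<in>V - {v}. w a < d)"
        using V True agree q d dist by (intro v.weak_approximation) auto
      then show ?thesis by blast
    qed auto
  qed
  then obtain e where e: "\<And>v. v \<in> V \<Longrightarrow> e v \<in> ?K" "\<And>v. v \<in> V \<Longrightarrow> v (1 - e v) < d"
    "\<And>v w. v \<in> V \<Longrightarrow> w \<in> V \<Longrightarrow> w \<noteq> v \<Longrightarrow> w (e v) < d" by (metis DiffI singletonD)
  have "card S \<le> degree (min_poly \<rat> t)"
  proof (rule card_independent_le_degree[OF alg finS, where y = "\<lambda>s. e (fst s) * xs s"])
    fix s assume s: "s \<in> S"
    then have "fst s \<in> V" by (auto simp: S_def)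
    then interpret v: abs_field ?K "fst s" by (rule V(2))
    show "e (fst s) * xs s \<in> ?K" using e(1) s xsK by (intro v.mult_closed) (auto simp: S_def)
  next
    fix c s assume c: "\<And>s. s \<in> S \<Longrightarrow> c s \<in> \<rat>" and sum0: "(\<Sum>s\<in>S. c s * (e (fst s) * xs s)) = 0" and s: "s \<in> S"
    show "c s = 0"
    proof (rule ccontr)
      assume cs: "c s \<noteq> 0"
      have sV: "fst s \<in> V" using s by (auto simp: S_def)
      \<comment> \<open>All places in \<open>V\<close> agree on the rationals, so the size of the
        coefficients can be measured at any one of them.\<close>
      define nrm where "nrm = fst s"
      define M where "M = Max ((\<lambda>s. nrm (c s)) ` S)"
      have "M \<in> (\<lambda>s. nrm (c s)) ` S" unfolding M_def using finS s by (intro Max_in) auto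
      then obtain s1 where s1: "s1 \<in> S" "M = nrm (c s1)" by auto
      define v where "v = fst s1"
      define i where "i = snd s1"
      have v: "v \<in> V" "i < k v" "s1 = (v, i)" using s1(1) by (auto simp: S_def v_def i_def)
      interpret v: abs_field ?K v by (rule V(2)[OF v(1)])
      have cM: "v (c s) \<le> M" if "s \<in> S" for s
      proof -
        have "v (c s) = nrm (c s)" using agree[OF v(1) sV] c that by (simp add: nrm_def)
        also have "\<dots> \<le> M" unfolding M_def using finS that by (intro Max_ge) auto
        finally show ?thesis .
      qed
      have cK: "c s \<in> ?K" if "s \<in> S" for s using c[OF that] v.Rats_subset by blast
      have "0 < v (c s)" using v.v_nonneg[OF cK[OF s]] v.v_eq_0_iff[OF cK[OF s]] cs by linarith
      then have Mpos: "M > 0" using cM[OF s] by linarith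
      have vM: "v (c (v, i)) = M" using agree[OF v(1) sV] c[OF s1(1)] s1(2) v(3) by (simp add: nrm_def)
      define z where "z = (\<Sum>i<k v. c (v, i) * x v i)"
      \<comment> \<open>The difference between the ideal weight, 1 at \<open>v\<close> and 0
        elsewhere, and the actual weight \<open>e (fst s)\<close>. Subtracting the given relation
        leaves exactly these differences in \<open>z\<close>.\<close>
      define b where "b s = (if fst s = v then 1 - e (fst s) else - e (fst s))" for s :: "(complex \<Rightarrow> real) \<times> nat"
      have bK: "b s \<in> ?K" and bd: "v (b s) \<le> d" if "s \<in> S" for s
      proof -
        have f: "fst s \<in> V" using that by (auto simp: S_def)
        show "b s \<in> ?K" using e(1)[OF f] by (auto simp: b_def)
        show "v (b s) \<le> d"
          using e(1)[OF f] e(2)[OF f] e(3)[OF f v(1)] by (auto simp: b_def v.v_minus less_imp_le)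
      qed
      have "z = (\<Sum>s\<in>S. if fst s = v then c s * xs s else 0)"
      proof -
        have "(\<Sum>s\<in>S. if fst s = v then c s * xs s else 0) =
            (\<Sum>w\<in>V. \<Sum>i<k w. if w = v then c (w, i) * x w i else 0)"
          unfolding S_def
          by (subst sum.Sigma) (use V(1) in \<open>auto simp: xs_def intro!: sum.cong\<close>)
        also have "\<dots> = (\<Sum>w\<in>V. if w = v then z else 0)"
          by (rule sum.cong) (auto simp: z_def)
        also have "\<dots> = z" using v(1) V(1) by simp
        finally show ?thesis by simp
      qed
      also have "\<dots> = (\<Sum>s\<in>S. if fst s = v then c s * xs s else 0) - (\<Sum>s\<in>S. c s * (e (fst s) * xs s))"
        unfolding sum0 by simp
      also have "\<dots> = (\<Sum>s\<in>S. c s * b s * xs s)"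
        unfolding sum_subtractf[symmetric] by (rule sum.cong) (auto simp: b_def algebra_simps)
      finally have "v z \<le> (\<Sum>s\<in>S. v (c s * b s * xs s))"
        using finS cK bK xsK by (simp only:, intro v.v_sum v.mult_closed) auto
      also have "\<dots> \<le> (\<Sum>s\<in>S. M * d * Y)"
      proof (rule sum_mono)
        fix s assume s: "s \<in> S"
        have "v (c s * b s * xs s) = v (c s) * v (b s) * v (xs s)"
          using cK[OF s] bK[OF s] xsK[OF s] by (simp add: v.v_mult v.mult_closed)
        also have "\<dots> \<le> M * d * Y"
          using cM[OF s] bd[OF s] Y[OF v(1) s] Mpos d Y1 v.v_nonneg[OF cK[OF s]] v.v_nonneg[OF bK[OF s]]
            v.v_nonneg[OF xsK[OF s]] by (intro mult_mono) auto
        finally show "v (c s * b s * xs s) \<le> M * d * Y" .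
      qed
      also have "\<dots> = real (card S) * (M * d * Y)" by simp
      also have "\<dots> \<le> N * (M * d * Y)" using Mpos d Y1 by (intro mult_right_mono) (auto simp: N_def)
      finally have vz: "v z \<le> N * (M * d * Y)" .
      have "M \<le> C v * v z"
        using C(2)[of v "\<lambda>i. c (v, i)" i] v c vM by (simp add: z_def S_def)
      also have "\<dots> \<le> C v * (N * (M * d * Y))" using vz C(1)[OF v(1)] by (intro mult_left_mono) auto
      also have "\<dots> < D * (N * (M * d * Y))"
        using D[OF v(1)] N Mpos d Y1 by (intro mult_strict_right_mono) auto
      also have "\<dots> = M" using D1 N Y1 by (simp add: d_def)
      finally show False by simp
    qed
  qed
  then show ?thesis using V(1) by (simp add: S_def)
qed

text \<open>Lagrange interpolation: a polynomial \<open>P\<close> of degree below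
  \<open>card S\<close> is recovered from its values on \<open>S\<close>, so its coefficients are
  bounded by those values. All of them have the same absolute value \<open>v (poly P t)\<close>, as
  every element of \<open>S\<close> induces \<open>v\<close>.\<close>

lemma v_independent_powers:
  assumes u: "abs_field {x. algebraic x} u" and fin: "finite S" and S: "S \<subseteq> {x. algebraic x}"
    and v: "\<And>P \<beta>. P \<in> polys_over \<rat> \<Longrightarrow> \<beta> \<in> S \<Longrightarrow> v (poly P t) = u (poly P \<beta>)"
    and vq: "\<And>q. q \<in> \<rat> \<Longrightarrow> v q = u q"
  shows "v_independent v (card S) (\<lambda>i. t ^ i)"
proof -
  interpret u: abs_field "{x. algebraic x}" u by (rule u)
  let ?A = "{x :: complex. algebraic x}"
  \<comment> \<open>The Lagrange basis polynomials of \<open>S\<close>; their coefficients are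
    algebraic, so that \<open>u\<close> applies to them.\<close>
  define l where "l \<beta> = (\<Prod>\<gamma>\<in>S - {\<beta>}. smult (inverse (\<beta> - \<gamma>)) [:- \<gamma>, 1:])" for \<beta>
  have lA: "l \<beta> \<in> polys_over ?A" if "\<beta> \<in> S" for \<beta>
    unfolding l_def using S that
    by (intro alg.polys_over_prod alg.polys_over_smult alg.inverse_closed alg.diff_closed) (auto simp: alg.polys_over_pCons)
  have lv: "poly (l \<beta>) \<gamma> = (if \<gamma> = \<beta> then 1 else 0)" if "\<beta> \<in> S" "\<gamma> \<in> S" for \<beta> \<gamma>
  proof -
    have *: "poly (smult (inverse (\<beta> - \<delta>)) [:- \<delta>, 1:]) \<gamma> = inverse (\<beta> - \<delta>) * (\<gamma> - \<delta>)" for \<delta>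
      by (simp add: algebra_simps)
    show ?thesis
    proof (cases "\<gamma> = \<beta>")
      case True
      have "(\<Prod>k\<in>S - {\<beta>}. inverse (\<beta> - k) * (\<beta> - k)) = 1"
        by (intro prod.neutral ballI left_inverse) auto
      then show ?thesis unfolding l_def poly_prod * using True by simp
    next
      case False
      then show ?thesis unfolding l_def poly_prod * using that fin by auto
    qed
  qed
  define C where "C = 1 + (\<Sum>\<beta>\<in>S. \<Sum>i<card S. u (coeff (l \<beta>) i))"
  have cl: "coeff (l \<beta>) i \<in> ?A" if "\<beta> \<in> S" for \<beta> i using polys_overD[OF lA[OF that]] .
  have C0: "C > 0" unfolding C_def using cl u.v_nonneg by (intro add_pos_nonneg sum_nonneg) auto
  show ?thesis unfolding v_independent_def
  proof (intro exI[of _ C] conjI C0 allI impI)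
    fix c :: "nat \<Rightarrow> complex" and i
    assume c: "\<forall>i<card S. c i \<in> \<rat>" and i: "i < card S"
    define P where "P = (\<Sum>i<card S. monom (c i) i)"
    have cP: "coeff P j = (if j < card S then c j else 0)" for j
      unfolding P_def by (simp add: coeff_sum)
    have PQ: "P \<in> polys_over \<rat>" using c by (auto simp: polys_over_def cP)
    have pP: "poly P s = (\<Sum>i<card S. c i * s ^ i)" for s unfolding P_def by (simp add: poly_sum poly_monom)
    have "degree P \<le> card S - 1" by (rule degree_le) (auto simp: cP)
    then have degP: "degree P < card S" using i by linarith
    have "P = (\<Sum>\<beta>\<in>S. smult (poly P \<beta>) (l \<beta>))"
    proof (rule poly_eqI_degree[of S])
      fix s assume s: "s \<in> S"
      have "poly (\<Sum>\<beta>\<in>S. smult (poly P \<beta>) (l \<beta>)) s = (\<Sum>\<beta>\<in>S. if \<beta> = s then poly P s else 0)"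
        unfolding poly_sum by (rule sum.cong) (use s lv in auto)
      then show "poly P s = poly (\<Sum>\<beta>\<in>S. smult (poly P \<beta>) (l \<beta>)) s" using fin s by simp
    next
      have "degree (smult (poly P \<beta>) (l \<beta>)) \<le> card S - 1" if "\<beta> \<in> S" for \<beta>
      proof -
        have "degree (l \<beta>) \<le> (\<Sum>\<gamma>\<in>S - {\<beta>}. 1)" unfolding l_def
          using fin by (intro order_trans[OF degree_prod_sum_le] sum_mono) (auto simp: degree_smult_le)
        then show ?thesis using that fin degree_smult_le[of "poly P \<beta>" "l \<beta>"] by simp
      qed
      then have "degree (\<Sum>\<beta>\<in>S. smult (poly P \<beta>) (l \<beta>)) \<le> card S - 1"
        by (intro degree_sum_le fin)
      then show "card S > degree (\<Sum>\<beta>\<in>S. smult (poly P \<beta>) (l \<beta>))"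
        using i by linarith
    qed (rule degP)
    then have "c i = (\<Sum>\<beta>\<in>S. poly P \<beta> * coeff (l \<beta>) i)"
      using cP[of i] i by (metis (no_types, lifting) coeff_smult coeff_sum sum.cong)
    moreover have PA: "poly P \<beta> \<in> ?A" if "\<beta> \<in> S" for \<beta>
      using PQ polys_over_mono[OF alg.Rats_subset] S that by (intro alg.poly_closed) auto
    ultimately have "u (c i) \<le> (\<Sum>\<beta>\<in>S. u (poly P \<beta> * coeff (l \<beta>) i))"
      using fin cl by (simp only:, intro u.v_sum alg.mult_closed) auto
    also have "\<dots> = (\<Sum>\<beta>\<in>S. v (poly P t) * u (coeff (l \<beta>) i))"
      using PA cl v[OF PQ] by (intro sum.cong refl) (simp add: u.v_mult)
    also have "\<dots> = v (poly P t) * (\<Sum>\<beta>\<in>S. u (coeff (l \<beta>) i))" by (simp add: sum_distrib_left)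
    also have "\<dots> \<le> v (poly P t) * C"
    proof (rule mult_left_mono)
      have "(\<Sum>\<beta>\<in>S. u (coeff (l \<beta>) i)) \<le> (\<Sum>\<beta>\<in>S. \<Sum>i<card S. u (coeff (l \<beta>) i))"
        using i cl u.v_nonneg by (intro sum_mono member_le_sum) auto
      then show "(\<Sum>\<beta>\<in>S. u (coeff (l \<beta>) i)) \<le> C" by (simp add: C_def)
      obtain \<beta> where "\<beta> \<in> S" using i by fastforce
      then show "v (poly P t) \<ge> 0" using v[OF PQ] u.v_nonneg[OF PA] by simp
    qed
    finally show "v (c i) \<le> C * v (\<Sum>i<card S. c i * t ^ i)"
      using vq c i by (simp add: pP mult.commute)
  qed
qed

text \<open>The places of \<open>K\<close> above one place of the rationals, namely the one to which
  \<open>u\<close> restricts.\<close>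

definition rational_places :: "complex set \<Rightarrow> (complex \<Rightarrow> real) \<Rightarrow> (complex \<Rightarrow> real) set" where
  "rational_places K u = {v \<in> extensional K. absolute_value_on K v \<and> (\<forall>q\<in>\<rat>. v q = u q)}"

text \<open>The places of \<open>\<rat>(t)\<close> above a place of \<open>\<rat>\<close> come from the embeddings \<open>t \<mapsto> \<beta>\<close>, and
  the local degree counts the embeddings inducing the place: these numbers are lower bounds for the
  local degrees and already add up to the degree, which weak approximation shows to be an upper
  bound for the sum of all local degrees.\<close>

lemma rational_places_conjugates:
  assumes alg: "algebraic t" and u: "abs_field {x. algebraic x} u" and q: "q \<in> \<rat>" "u q > 1"
  obtains f where "f ` conjugates \<rat> t = rational_places (adjoin \<rat> t) u"
    "\<And>\<beta>. \<beta> \<in> conjugates \<rat> t \<Longrightarrow> f \<beta> t = u \<beta>"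
    "\<And>v. v \<in> rational_places (adjoin \<rat> t) u \<Longrightarrow>
       local_degree (adjoin \<rat> t) v = card {\<beta> \<in> conjugates \<rat> t. f \<beta> = v}"
proof -
  let ?K = "adjoin \<rat> t" and ?R = "conjugates \<rat> t" and ?P = "rational_places (adjoin \<rat> t) u"
  interpret u: abs_field "{x. algebraic x}" u by (rule u)
  have alg': "algebraic_over \<rat> t" using alg by (simp add: algebraic_over_Rats)
  interpret K: complex_subfield ?K by (rule rat.subfield_adjoin[OF alg'])
  have finR: "finite ?R" by (rule rat.finite_conjugates[OF alg'])
  have RA: "?R \<subseteq> {x. algebraic x}" using rat.conjugate_algebraic[OF alg'] by (auto simp: algebraic_over_Rats)
  \<comment> \<open>\<open>f \<beta>\<close> will be the absolute value pulled back from
    \<open>u\<close> along the embedding that sends \<open>t\<close> to \<open>\<beta>\<close>. A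
    polynomial expression is chosen for each element, and conjugacy of \<open>\<beta>\<close> makes
    the value independent of the choice.\<close>
  define rep where "rep x = (SOME P. P \<in> polys_over \<rat> \<and> poly P t = x)" for x
  have rep: "rep x \<in> polys_over \<rat>" "poly (rep x) t = x" if "x \<in> ?K" for x
  proof -
    have "\<exists>P. P \<in> polys_over \<rat> \<and> poly P t = x" using that by (auto simp: adjoin_def)
    then have "rep x \<in> polys_over \<rat> \<and> poly (rep x) t = x" unfolding rep_def by (rule someI_ex)
    then show "rep x \<in> polys_over \<rat>" "poly (rep x) t = x" by auto
  qed
  define f where "f \<beta> = restrict (\<lambda>x. u (poly (rep x) \<beta>)) ?K" for \<beta>
  have f_poly: "f \<beta> (poly P t) = u (poly P \<beta>)" if "\<beta> \<in> ?R" "P \<in> polys_over \<rat>" for \<beta> P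
  proof -
    have m: "poly P t \<in> ?K" using that(2) by (rule rat.adjoinI)
    have "poly (rep (poly P t) - P) \<beta> = 0"
      by (rule rat.conjugate_root[OF _ _ that(1)]) (use rep[OF m] that(2) in auto)
    then show ?thesis using m by (simp add: f_def)
  qed
  have PA: "poly P \<beta> \<in> {x. algebraic x}" if "\<beta> \<in> ?R" "P \<in> polys_over \<rat>" for \<beta> P
    using that polys_over_mono[OF alg.Rats_subset] RA by (intro alg.poly_closed) auto
  have f_rat: "f \<beta> q = u q" if "\<beta> \<in> ?R" "q \<in> \<rat>" for \<beta> q
    using f_poly[OF that(1), of "[:q:]"] that(2) by simp
  have f_abs: "absolute_value_on ?K (f \<beta>)" if b: "\<beta> \<in> ?R" for \<beta>
    unfolding absolute_value_on_def
  proof (intro conjI ballI)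
    fix x assume "x \<in> ?K"
    then obtain P where P: "P \<in> polys_over \<rat>" "x = poly P t" by (auto simp: adjoin_def)
    show "0 \<le> f \<beta> x" unfolding P(2) f_poly[OF b P(1)] by (rule u.v_nonneg[OF PA[OF b P(1)]])
    have "poly P \<beta> = 0 \<longleftrightarrow> poly P t = 0"
      using rat.conjugate_root[OF P(1) _ b] rat.conjugate_root[OF P(1), of \<beta> t]
        rat.conjugates_eq[OF alg' b] rat.self_conjugate[OF alg'] by blast
    then show "(f \<beta> x = 0) = (x = 0)"
      unfolding P(2) f_poly[OF b P(1)] u.v_eq_0_iff[OF PA[OF b P(1)]] by simp
    fix y assume "y \<in> ?K"
    then obtain Q where Q: "Q \<in> polys_over \<rat>" "y = poly Q t" by (auto simp: adjoin_def)
    show "f \<beta> (x * y) = f \<beta> x * f \<beta> y"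
      using f_poly[OF b rat.polys_over_mult[OF P(1) Q(1)]] f_poly[OF b P(1)] f_poly[OF b Q(1)]
        u.v_mult[OF PA[OF b P(1)] PA[OF b Q(1)]] by (simp add: P(2) Q(2))
    show "f \<beta> (x + y) \<le> f \<beta> x + f \<beta> y"
      using f_poly[OF b rat.polys_over_add[OF P(1) Q(1)]] f_poly[OF b P(1)] f_poly[OF b Q(1)]
        u.v_add[OF PA[OF b P(1)] PA[OF b Q(1)]] by (simp add: P(2) Q(2))
  qed
  have af: "abs_field ?K v" if "v \<in> ?P" for v
    using that by unfold_locales (auto simp: rational_places_def)
  have fP: "f ` ?R \<subseteq> ?P" using f_abs f_rat by (auto simp: rational_places_def f_def)
  define m where "m v = card {\<beta> \<in> ?R. f \<beta> = v}" for v
  have dist: "\<exists>x\<in>?K. v x \<noteq> w x" if "v \<in> ?P" "w \<in> ?P" "v \<noteq> w" for v w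
    using that extensionalityI[of v ?K w] by (auto simp: rational_places_def)
  have ind: "v_independent v (m v) (\<lambda>i. t ^ i)" for v
  proof (cases "{\<beta> \<in> ?R. f \<beta> = v} = {}")
    case True
    have "m v = 0" unfolding m_def True by simp
    then show ?thesis unfolding v_independent_def by (intro exI[of _ 1]) auto
  next
    case False
    then obtain \<beta> where "\<beta> \<in> ?R" "f \<beta> = v" by blast
    then have "v q = u q" if "q \<in> \<rat>" for q using f_rat that by blast
    then show ?thesis unfolding m_def
      by (intro v_independent_powers[OF u]) (use finR RA f_poly in auto)
  qed
  have tK: "t ^ i \<in> ?K" for i using rat.self_adjoin K.power_closed by blast
  \<comment> \<open>The fibres of \<open>f\<close> partition the conjugates, so their sizes add up
    to the degree.\<close>
  have deg: "(\<Sum>v\<in>f ` ?R. m v) = degree (min_poly \<rat> t)"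
    using sum.image_gen[OF finR, of "\<lambda>_. 1 :: nat" f] rat.card_conjugates[OF alg'] by (simp add: m_def)
  have bound: "(\<Sum>v\<in>V. k v) \<le> degree (min_poly \<rat> t)"
    if "finite V" "V \<subseteq> ?P" "\<And>v i. v \<in> V \<Longrightarrow> i < k v \<Longrightarrow> x v i \<in> ?K" "\<And>v. v \<in> V \<Longrightarrow> v_independent v (k v) (x v)"
    for V and k :: "(complex \<Rightarrow> real) \<Rightarrow> nat" and x
  proof (rule sum_independent_le_degree[OF alg that(1) _ _ q(1) _ _ that(3,4)])
    have eq: "v r = u r" if "v \<in> V" "r \<in> \<rat>" for v r
      using that \<open>V \<subseteq> ?P\<close> by (auto simp: rational_places_def)
    show "abs_field ?K v" if "v \<in> V" for v using af that \<open>V \<subseteq> ?P\<close> by blast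
    show "v r = w r" if "v \<in> V" "w \<in> V" "r \<in> \<rat>" for v w r using eq that by metis
    show "v q > 1" if "v \<in> V" for v using eq[OF that q(1)] q(2) by simp
    show "\<exists>x\<in>?K. v x \<noteq> w x" if "v \<in> V" "w \<in> V" "v \<noteq> w" for v w
      using dist that \<open>V \<subseteq> ?P\<close> by blast
  qed
  show thesis
  proof (rule that[of f])
    show "f ` ?R = ?P"
    proof (rule ccontr)
      assume "f ` ?R \<noteq> ?P"
      then obtain w where w: "w \<in> ?P" "w \<notin> f ` ?R" using fP by blast
      \<comment> \<open>A place outside the image would add the independent family consisting of 1
        alone and push the sum beyond the degree.\<close>
      define k where "k v = (if v = w then 1 else m v)" for v
      define x where "x v i = (if v = w then 1 else t ^ i)" for v and i :: nat
      have wi: "v_independent w 1 (x w)" unfolding v_independent_def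
        by (intro exI[of _ 1]) (auto simp: x_def)
      have "(\<Sum>v\<in>insert w (f ` ?R). k v) \<le> degree (min_poly \<rat> t)"
      proof (rule bound[of "insert w (f ` ?R)" k x])
        show "insert w (f ` ?R) \<subseteq> ?P" using w(1) fP by auto
        fix v assume v: "v \<in> insert w (f ` ?R)"
        show "x v i \<in> ?K" for i using tK by (simp add: x_def)
        show "v_independent v (k v) (x v)"
          using wi v w(2) ind[of v] by (cases "v = w") (auto simp: k_def x_def[abs_def])
      qed (use finR in auto)
      moreover have "(\<Sum>v\<in>f ` ?R. k v) = (\<Sum>v\<in>f ` ?R. m v)"
        using w(2) by (intro sum.cong) (auto simp: k_def)
      ultimately show False using w(2) finR deg by (simp add: k_def)
    qed
    show "f \<beta> t = u \<beta>" if "\<beta> \<in> ?R" for \<beta> using f_poly[OF that, of "[:0, 1:]"] by simp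
    fix v assume v: "v \<in> ?P"
    then have vf: "v \<in> f ` ?R" using \<open>f ` ?R = ?P\<close> by simp
    interpret v: abs_field ?K v by (rule af[OF v])
    show "local_degree ?K v = card {\<beta> \<in> ?R. f \<beta> = v}"
    proof (fold m_def, rule v.local_degree_eqI[where x = "\<lambda>i. t ^ i"])
      show "v_dense ?K v (m v) (\<lambda>i. t ^ i)"
      proof (rule ccontr)
        assume "\<not> ?thesis"
        \<comment> \<open>Without density the family at \<open>v\<close> could be enlarged by one,
          again exceeding the degree.\<close>
        then obtain y where y: "y \<in> ?K" "v_independent v (Suc (m v)) ((\<lambda>i. t ^ i)(m v := y))"
          using v.v_independent_extend[of "m v" "\<lambda>i. t ^ i"] tK ind by blast
        define k where "k w = (if w = v then Suc (m v) else m w)" for w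
        define x where "x w = (if w = v then (\<lambda>i. t ^ i)(m v := y) else (\<lambda>i. t ^ i))" for w
        have "(\<Sum>w\<in>f ` ?R. k w) \<le> degree (min_poly \<rat> t)"
        proof (rule bound[of "f ` ?R" k x])
          fix w show "x w i \<in> ?K" for i using tK y(1) by (auto simp: x_def)
          show "v_independent w (k w) (x w)" using y(2) ind[of w] by (auto simp: k_def x_def)
        qed (use finR fP in auto)
        moreover have "(\<Sum>w\<in>f ` ?R. k w) = (\<Sum>w\<in>f ` ?R. m w) + (\<Sum>w\<in>f ` ?R. if w = v then 1 else 0)"
          unfolding sum.distrib[symmetric] by (rule sum.cong) (auto simp: k_def)
        ultimately show False using vf finR deg by simp
      qed
    qed (use tK ind in auto)
  qed
qed

text \<open>Conjugates are grouped by the place that they induce: \<open>u\<close> takes the value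
  \<open>v t\<close> on the whole fibre over \<open>v\<close>, whose size is the local
  degree.\<close>

lemma prod_rational_places:
  assumes alg: "algebraic t" and u: "abs_field {x. algebraic x} u" and q: "q \<in> \<rat>" "u q > 1"
  shows "finite (rational_places (adjoin \<rat> t) u)"
    and "(\<Prod>v\<in>rational_places (adjoin \<rat> t) u. max 1 (v t) ^ local_degree (adjoin \<rat> t) v) =
      (\<Prod>\<beta>\<in>conjugates \<rat> t. max 1 (u \<beta>))"
proof -
  have fin: "finite (conjugates \<rat> t)"
    using rat.finite_conjugates alg by (simp add: algebraic_over_Rats)
  obtain f where f: "f ` conjugates \<rat> t = rational_places (adjoin \<rat> t) u"
    "\<And>\<beta>. \<beta> \<in> conjugates \<rat> t \<Longrightarrow> f \<beta> t = u \<beta>"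
    "\<And>v. v \<in> rational_places (adjoin \<rat> t) u \<Longrightarrow>
       local_degree (adjoin \<rat> t) v = card {\<beta> \<in> conjugates \<rat> t. f \<beta> = v}"
    using rational_places_conjugates[OF assms] by blast
  show "finite (rational_places (adjoin \<rat> t) u)" using f(1) fin by (metis finite_imageI)
  have "(\<Prod>\<beta>\<in>conjugates \<rat> t. max 1 (u \<beta>)) =
      (\<Prod>v\<in>f ` conjugates \<rat> t. \<Prod>\<beta> | \<beta> \<in> conjugates \<rat> t \<and> f \<beta> = v. max 1 (u \<beta>))"
    by (rule prod.image_gen[OF fin])
  also have "\<dots> = (\<Prod>v\<in>f ` conjugates \<rat> t. max 1 (v t) ^ local_degree (adjoin \<rat> t) v)"
  proof (rule prod.cong[OF refl])
    fix v assume "v \<in> f ` conjugates \<rat> t"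
    then have v: "v \<in> rational_places (adjoin \<rat> t) u" using f(1) by simp
    have "(\<Prod>\<beta> | \<beta> \<in> conjugates \<rat> t \<and> f \<beta> = v. max 1 (u \<beta>)) = (\<Prod>\<beta> | \<beta> \<in> conjugates \<rat> t \<and> f \<beta> = v. max 1 (v t))"
      using f(2) by (intro prod.cong) auto
    then show "(\<Prod>\<beta> | \<beta> \<in> conjugates \<rat> t \<and> f \<beta> = v. max 1 (u \<beta>)) = max 1 (v t) ^ local_degree (adjoin \<rat> t) v"
      using f(3)[OF v] by simp
  qed
  finally show "(\<Prod>v\<in>rational_places (adjoin \<rat> t) u. max 1 (v t) ^ local_degree (adjoin \<rat> t) v) =
      (\<Prod>\<beta>\<in>conjugates \<rat> t. max 1 (u \<beta>))" using f(1) by simp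
qed


section \<open>Heights\<close>

interpretation CR: cring complex_ring
  by (rule cring_from_type_algebra)

lemma field_complex_ring: "Ring.field complex_ring"
  by (rule field_from_type_algebra)

lemma complex_ring_simps [simp]:
  "carrier complex_ring = UNIV" "x \<otimes>\<^bsub>complex_ring\<^esub> y = x * y" "x \<oplus>\<^bsub>complex_ring\<^esub> y = x + y"
  "\<one>\<^bsub>complex_ring\<^esub> = 1" "\<zero>\<^bsub>complex_ring\<^esub> = 0"
  by (simp_all add: ring_of_type_algebra_def)

lemma complex_ring_a_inv [simp]: "\<ominus>\<^bsub>complex_ring\<^esub> x = - x"
  by (rule CR.minus_equality) auto

lemma complex_ring_finsum: "finite I \<Longrightarrow> finsum complex_ring f I = sum f I"
  by (induction I rule: finite_induct) auto

lemma (in complex_subfield) subfield_complex_ring: "subfield F complex_ring"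
proof (rule CR.subfieldI_inverses)
  fix h assume "h \<in> F" "h \<noteq> \<zero>\<^bsub>complex_ring\<^esub>"
  then show "\<exists>k\<in>F. h \<otimes>\<^bsub>complex_ring\<^esub> k = \<one>\<^bsub>complex_ring\<^esub>"
    by (intro bexI[of _ "inverse h"]) auto
qed auto

text \<open>Polynomial expressions lie in every field containing \<open>t\<close> and the rationals;
  conversely they form a field themselves, which contains the generated one by minimality.\<close>

lemma adjoin_rat_eq:
  assumes "algebraic t"
  shows "adjoin_rat t = adjoin \<rat> t"
proof
  have alg: "algebraic_over \<rat> t" using assms by (simp add: algebraic_over_Rats)
  interpret K: complex_subfield "adjoin \<rat> t" by (rule rat.subfield_adjoin[OF alg])
  show "adjoin_rat t \<subseteq> adjoin \<rat> t" unfolding adjoin_rat_def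
    by (rule field.generate_field_min_subfield1[OF field_complex_ring])
      (use K.subfield_complex_ring rat.self_adjoin rat.subset_adjoin in auto)
  show "adjoin \<rat> t \<subseteq> adjoin_rat t"
  proof
    fix x assume "x \<in> adjoin \<rat> t"
    then obtain P where P: "P \<in> polys_over \<rat>" "x = poly P t" by (auto simp: adjoin_def)
    have "poly P t \<in> adjoin_rat t" using P(1)
    proof (induction P)
      case 0
      show ?case using field.zero_in_generate[OF field_complex_ring, of "insert t \<rat>"] by (simp add: adjoin_rat_def)
    next
      case (pCons a P)
      then have "a \<in> adjoin_rat t" "t \<in> adjoin_rat t" "poly P t \<in> adjoin_rat t"
        unfolding adjoin_rat_def by (auto intro: generate_field.incl)
      then show ?case unfolding adjoin_rat_def
        using generate_field.eng_add[of a complex_ring _ "t * poly P t"] generate_field.eng_mult[of t complex_ring _ "poly P t"]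
        by simp
    qed
    then show "x \<in> adjoin_rat t" using P(2) by simp
  qed
qed

lemma field_degree_adjoin:
  assumes "algebraic t"
  shows "field_degree (adjoin \<rat> t) = card (conjugates \<rat> t)"
proof -
  have alg: "algebraic_over \<rat> t" using assms by (simp add: algebraic_over_Rats)
  let ?d = "degree (min_poly \<rat> t)"
  have "field_degree (adjoin \<rat> t) = ?d" unfolding field_degree_def
  proof (rule CR.vs_dim_eqI[OF rat.subfield_complex_ring, where u = "\<lambda>i. t ^ i"])
    have co: "coeff (\<Sum>i<m. monom (c i) i) j = (if j < m then c j else 0)" for c :: "nat \<Rightarrow> complex" and m j
      by (simp add: coeff_sum)
    have po: "poly (\<Sum>i<m. monom (c i) i) t = (\<Sum>i<m. c i * t ^ i)" for c :: "nat \<Rightarrow> complex" and m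
      by (simp add: poly_sum poly_monom)
    {
      fix c :: "nat \<Rightarrow> complex" and i
      assume c: "\<And>i. i < ?d \<Longrightarrow> c i \<in> \<rat>" and i: "i < ?d"
        and z: "(\<Oplus>\<^bsub>complex_ring\<^esub>i\<in>{..<?d}. c i \<otimes>\<^bsub>complex_ring\<^esub> t ^ i) = \<zero>\<^bsub>complex_ring\<^esub>"
      let ?P = "\<Sum>i<?d. monom (c i) i"
      have P: "?P \<in> polys_over \<rat>" using c by (auto simp: polys_over_def co)
      have "poly ?P t = 0" using z by (simp add: po complex_ring_finsum)
      moreover have "degree ?P < ?d"
      proof -
        have "degree ?P \<le> ?d - 1" by (rule degree_le) (auto simp: co)
        then show ?thesis using i by linarith
      qed
      ultimately have "?P = 0" using rat.degree_min_poly_le[OF P] by fastforce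
      then show "c i = \<zero>\<^bsub>complex_ring\<^esub>" using co[of c ?d i] i by simp
    }
    show "adjoin \<rat> t = {\<Oplus>\<^bsub>complex_ring\<^esub>i\<in>{..<?d}. c i \<otimes>\<^bsub>complex_ring\<^esub> t ^ i | c. \<forall>i<?d. c i \<in> \<rat>}"
    proof (intro equalityI subsetI)
      fix x assume "x \<in> adjoin \<rat> t"
      then obtain P where P: "P \<in> polys_over \<rat>" "degree P < ?d" "x = poly P t"
        using rat.adjoin_reduced[OF alg] by blast
      have "poly P t = (\<Sum>i<?d. coeff P i * t ^ i)"
        unfolding poly_altdef using P(2) by (intro sum.mono_neutral_left) (auto simp: coeff_eq_0)
      then show "x \<in> {\<Oplus>\<^bsub>complex_ring\<^esub>i\<in>{..<?d}. c i \<otimes>\<^bsub>complex_ring\<^esub> t ^ i | c. \<forall>i<?d. c i \<in> \<rat>}"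
        using P by (intro CollectI exI[of _ "coeff P"]) (auto simp: complex_ring_finsum polys_overD)
    next
      fix x assume "x \<in> {\<Oplus>\<^bsub>complex_ring\<^esub>i\<in>{..<?d}. c i \<otimes>\<^bsub>complex_ring\<^esub> t ^ i | c. \<forall>i<?d. c i \<in> \<rat>}"
      then obtain c where c: "\<forall>i<?d. c i \<in> \<rat>" "x = (\<Sum>i<?d. c i * t ^ i)"
        by (auto simp: complex_ring_finsum)
      have "(\<Sum>i<?d. monom (c i) i) \<in> polys_over \<rat>" using c(1) by (auto simp: polys_over_def co)
      then show "x \<in> adjoin \<rat> t" using rat.adjoinI[of _ t] c(2) po by metis
    qed
  qed auto
  then show ?thesis using rat.card_conjugates[OF alg] by simp
qed

text \<open>The index \<open>0\<close> stands for the infinite place.\<close>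

definition rat_places :: "nat set" where
  "rat_places = insert 0 {p. normalization_semidom_class.prime p}"

definition rat_abs :: "nat \<Rightarrow> rat \<Rightarrow> real" where
  "rat_abs p q = (if p = 0 then \<bar>of_rat q\<bar> else padic_abs p q)"

text \<open>One extension is fixed for each place of the rationals, so the same choice serves every
  number field. At a prime the ultrametric inequality is recorded; at 0 the choice is
  \<open>cmod\<close>, which later bounds complex coefficients.\<close>

definition ext_abs :: "nat \<Rightarrow> complex \<Rightarrow> real" where
  "ext_abs p = (SOME u. abs_field {x. algebraic x} u \<and> (\<forall>q. u (of_rat q) = rat_abs p q) \<and>
     (p = 0 \<longrightarrow> u = cmod) \<and>
     (p \<noteq> 0 \<longrightarrow> (\<forall>x y. algebraic x \<longrightarrow> algebraic y \<longrightarrow> u (x + y) \<le> max (u x) (u y))))"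

lemma
  assumes "p \<in> rat_places"
  shows abs_field_ext_abs: "abs_field {x. algebraic x} (ext_abs p)"
    and ext_abs_of_rat: "ext_abs p (of_rat q) = rat_abs p q"
    and ext_abs_0: "p = 0 \<Longrightarrow> ext_abs p = cmod"
    and ext_abs_add: "p \<noteq> 0 \<Longrightarrow> algebraic x \<Longrightarrow> algebraic y \<Longrightarrow> ext_abs p (x + y) \<le> max (ext_abs p x) (ext_abs p y)"
proof -
  have "\<exists>u. abs_field {x. algebraic x} u \<and> (\<forall>q. u (of_rat q) = rat_abs p q) \<and>
     (p = 0 \<longrightarrow> u = cmod) \<and>
     (p \<noteq> 0 \<longrightarrow> (\<forall>x y. algebraic x \<longrightarrow> algebraic y \<longrightarrow> u (x + y) \<le> max (u x) (u y)))"
  proof (cases "p = 0")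
    case True
    have "abs_field {x. algebraic x} cmod"
      by unfold_locales (auto simp: absolute_value_on_def norm_mult norm_triangle_ineq)
    moreover have "cmod (of_rat q) = rat_abs 0 q" for q
    proof -
      obtain a b where "quotient_of q = (a, b)" by (cases "quotient_of q")
      then have "q = of_int a / of_int b" by (rule quotient_of_div)
      then show ?thesis by (simp add: rat_abs_def of_rat_divide norm_divide)
    qed
    ultimately show ?thesis using True by auto
  next
    case False
    then have "normalization_semidom_class.prime p" using assms by (simp add: rat_places_def)
    from padic_extension[OF this] obtain u where "absolute_value_on {x. algebraic x} u"
      "\<And>q. u (of_rat q) = padic_abs p q" "\<And>x y. algebraic x \<Longrightarrow> algebraic y \<Longrightarrow> u (x + y) \<le> max (u x) (u y)"
      by blast
    then show ?thesis using False
      by (intro exI[of _ u]) (auto simp: rat_abs_def abs_field_def abs_field_axioms_def alg.complex_subfield_axioms)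
  qed
  then have *: "abs_field {x. algebraic x} (ext_abs p) \<and> (\<forall>q. ext_abs p (of_rat q) = rat_abs p q) \<and>
     (p = 0 \<longrightarrow> ext_abs p = cmod) \<and>
     (p \<noteq> 0 \<longrightarrow> (\<forall>x y. algebraic x \<longrightarrow> algebraic y \<longrightarrow> ext_abs p (x + y) \<le> max (ext_abs p x) (ext_abs p y)))"
    unfolding ext_abs_def by (rule someI_ex)
  show "abs_field {x. algebraic x} (ext_abs p)" using * by blast
  show "ext_abs p (of_rat q) = rat_abs p q" using * by blast
  show "p = 0 \<Longrightarrow> ext_abs p = cmod" using * by blast
  show "p \<noteq> 0 \<Longrightarrow> algebraic x \<Longrightarrow> algebraic y \<Longrightarrow> ext_abs p (x + y) \<le> max (ext_abs p x) (ext_abs p y)"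
    using * by blast
qed

lemma rat_abs_of_nat_prime:
  assumes "normalization_semidom_class.prime p" "r \<in> rat_places"
  shows "rat_abs r (of_nat p) = (if r = 0 then real p else if r = p then 1 / real p else 1)"
proof -
  have p0: "p > 0" using prime_gt_0_nat[OF assms(1)] .
  have quo: "quotient_of (of_nat p) = (int p, 1)"
    using quotient_of_int[of "int p"] by simp
  show ?thesis
  proof (cases "r = 0")
    case True
    then show ?thesis by (simp add: rat_abs_def)
  next
    case False
    then have r: "normalization_semidom_class.prime r" using assms(2) by (simp add: rat_places_def)
    have "multiplicity (int r) (int p) = (if r = p then 1 else 0)"
      using prime_multiplicity_other[of "int r" "int p"] multiplicity_prime[of "int p"] assms(1) r by auto
    then show ?thesis using False p0
      by (simp add: rat_abs_def padic_abs_def quo power_int_minus divide_inverse)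
  qed
qed

text \<open>A prime \<open>p\<close> has value \<open>1 / p\<close> at its own place, but value
  \<open>p\<close> or 1 at every other one.\<close>

lemma rat_abs_inj:
  assumes "p \<in> rat_places" "r \<in> rat_places" "rat_abs p = rat_abs r"
  shows "p = r"
proof -
  have *: "p = r" if "p \<in> rat_places" "r \<in> rat_places" "rat_abs p = rat_abs r" "p \<noteq> 0" for p r
  proof -
    have pr: "normalization_semidom_class.prime p" using that by (simp add: rat_places_def)
    then have p1: "real p > 1" using prime_gt_1_nat[OF pr] by simp
    have "real p * real p > 1" by (rule less_1_mult[OF p1 p1])
    with p1 show ?thesis
      using rat_abs_of_nat_prime[OF pr that(1)] rat_abs_of_nat_prime[OF pr that(2)] that(3,4)
      by (auto split: if_splits simp: field_simps)
  qed
  show ?thesis using *[of p r] *[of r p] assms by metis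
qed

lemma ext_abs_nontrivial:
  assumes "p \<in> rat_places"
  obtains q where "q \<in> \<rat>" "ext_abs p q > 1"
proof (cases "p = 0")
  case True
  then show thesis using that[of 2] ext_abs_0[OF assms] by simp
next
  case False
  interpret u: abs_field "{x. algebraic x}" "ext_abs p" by (rule abs_field_ext_abs[OF assms])
  have p: "normalization_semidom_class.prime p" using False assms by (simp add: rat_places_def)
  have "ext_abs p (of_nat p) = 1 / real p"
    using ext_abs_of_rat[OF assms, of "of_nat p"] rat_abs_of_nat_prime[OF p assms] False by simp
  then have "ext_abs p (inverse (of_nat p)) = real p" using u.v_inverse[of "of_nat p"] by simp
  then show thesis using that[of "inverse (of_nat p)"] prime_gt_1_nat[OF p] by auto
qed

lemma places_adjoin:
  "places (adjoin \<rat> t) = (\<Union>p\<in>rat_places. rational_places (adjoin \<rat> t) (ext_abs p))"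
proof -
  have eq: "(\<forall>q\<in>\<rat>. v q = ext_abs p q) \<longleftrightarrow> (\<forall>q. v (of_rat q) = rat_abs p q)" if "p \<in> rat_places" for p v
    using ext_abs_of_rat[OF that] by (auto elim!: Rats_cases)
  show ?thesis
    unfolding places_def rational_places_def using eq by (auto simp: rat_places_def rat_abs_def prime_gt_0_nat)
qed

lemma rational_places_disjoint:
  assumes "p \<in> rat_places" "r \<in> rat_places" "p \<noteq> r"
  shows "rational_places K (ext_abs p) \<inter> rational_places K (ext_abs r) = {}"
proof (rule ccontr)
  assume "\<not> ?thesis"
  then obtain v where "\<forall>q\<in>\<rat>. v q = ext_abs p q" "\<forall>q\<in>\<rat>. v q = ext_abs r q"
    by (auto simp: rational_places_def)
  then have "rat_abs p = rat_abs r"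
    using ext_abs_of_rat[OF assms(1)] ext_abs_of_rat[OF assms(2)] by (metis Rats_of_rat ext)
  then show False using rat_abs_inj assms by blast
qed

text \<open>The joint contribution of all places above \<open>p\<close> to the height, with the
  local degrees absorbed in the count of conjugates.\<close>

definition local_height :: "nat \<Rightarrow> complex \<Rightarrow> real" where
  "local_height p t = (\<Prod>\<beta>\<in>conjugates \<rat> t. max 1 (ext_abs p \<beta>)) powr (1 / real (card (conjugates \<rat> t)))"

lemma prod_eq_1D:
  fixes f :: "'i \<Rightarrow> real"
  assumes "finite I" "\<And>i. i \<in> I \<Longrightarrow> 1 \<le> f i" "prod f I = 1" "i \<in> I"
  shows "f i = 1"
proof -
  have "prod f I = f i * prod f (I - {i})" using assms by (simp add: prod.remove)
  moreover have "1 \<le> prod f (I - {i})" using assms(2) by (intro prod_ge_1) auto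
  moreover have "f i \<ge> 0" using assms(2,4) by (meson order_trans zero_le_one)
  ultimately have "f i \<le> 1" using mult_left_mono[of 1 "prod f (I - {i})" "f i"] assms(3) by simp
  then show ?thesis using assms(2,4) by (metis antisym)
qed

lemma local_height_ge_1: "local_height p t \<ge> 1"
  unfolding local_height_def by (intro ge_one_powr_ge_zero prod_ge_1) auto

lemma local_height_eq_1_iff:
  assumes "algebraic t"
  shows "local_height p t = 1 \<longleftrightarrow> (\<forall>\<beta>\<in>conjugates \<rat> t. ext_abs p \<beta> \<le> 1)"
proof -
  have alg: "algebraic_over \<rat> t" using assms by (simp add: algebraic_over_Rats)
  have fin: "finite (conjugates \<rat> t)" "card (conjugates \<rat> t) > 0"
    using rat.finite_conjugates[OF alg] rat.self_conjugate[OF alg] by (auto simp: card_gt_0_iff)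
  let ?P = "\<Prod>\<beta>\<in>conjugates \<rat> t. max 1 (ext_abs p \<beta>)"
  have P1: "?P \<ge> 1" by (rule prod_ge_1) auto
  have "local_height p t = 1 \<longleftrightarrow> ?P = 1"
  proof
    assume "local_height p t = 1"
    then show "?P = 1"
      using gr_one_powr[of ?P "1 / real (card (conjugates \<rat> t))"] P1 fin(2)
      by (cases "?P = 1") (auto simp: local_height_def)
  qed (simp add: local_height_def)
  also have "\<dots> \<longleftrightarrow> (\<forall>\<beta>\<in>conjugates \<rat> t. max 1 (ext_abs p \<beta>) = 1)"
    using prod_eq_1D[OF fin(1), of "\<lambda>\<beta>. max 1 (ext_abs p \<beta>)"] by auto
  finally show ?thesis by (auto simp: max_def)
qed

text \<open>Apart from 0, only primes dividing a denominator of the minimal polynomial can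
  contribute: for the others this monic polynomial has \<open>p\<close>-integral coefficients, and
  the ultrametric inequality forces all its roots to have value at most 1.\<close>

lemma finite_local_height:
  assumes "algebraic t"
  shows "finite {p \<in> rat_places. local_height p t \<noteq> 1}"
proof -
  have alg: "algebraic_over \<rat> t" using assms by (simp add: algebraic_over_Rats)
  define m where "m = min_poly \<rat> t"
  define n where "n = degree m"
  have mQ: "m \<in> polys_over \<rat>" "coeff m n = 1"
    using rat.min_poly_over[OF alg] rat.min_poly_monic[OF alg] by (auto simp: m_def n_def)
  have "\<forall>i. \<exists>q. coeff m i = of_rat q" using mQ(1) by (auto simp: polys_over_def elim!: Rats_cases)
  then obtain c where c: "\<And>i. coeff m i = of_rat (c i)" by metis
  define D where "D = (\<Prod>i\<le>n. snd (quotient_of (c i)))"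
  have D0: "D \<noteq> 0" unfolding D_def
    using quotient_of_denom_pos' by (auto simp: prod_zero_iff less_le dest: quotient_of_denom_pos)
  have "{p \<in> rat_places. local_height p t \<noteq> 1} \<subseteq> insert 0 (nat ` prime_factors D)"
  proof
    fix p assume p: "p \<in> {p \<in> rat_places. local_height p t \<noteq> 1}"
    show "p \<in> insert 0 (nat ` prime_factors D)"
    proof (rule ccontr)
      assume np: "p \<notin> insert 0 (nat ` prime_factors D)"
      then have p0: "p \<noteq> 0" and prp: "normalization_semidom_class.prime p" using p by (auto simp: rat_places_def)
      have pr: "p \<in> rat_places" using p by simp
      interpret u: abs_field "{x. algebraic x}" "ext_abs p" by (rule abs_field_ext_abs[OF pr])
      have "\<not> int p dvd D"
      proof
        assume "int p dvd D"
        then have "int p \<in> prime_factors D" using D0 prp by (auto simp: in_prime_factors_iff)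
        then show False using np by (metis image_eqI insertI2 nat_int)
      qed
      then have cop: "\<not> int p dvd snd (quotient_of (c i))" if "i \<le> n" for i
        unfolding D_def using that by (meson atMost_iff dvd_trans dvd_prodI finite_atMost)
      have coef: "ext_abs p (coeff m i) \<le> 1" if "i \<le> n" for i
      proof -
        obtain a b where ab: "quotient_of (c i) = (a, b)" by (cases "quotient_of (c i)")
        have "multiplicity (int p) b = 0" using cop[OF that] ab by (simp add: not_dvd_imp_multiplicity_0)
        then have "padic_abs p (c i) \<le> 1" using ab prime_gt_0_nat[OF prp]
          by (auto simp: padic_abs_def power_int_minus field_simps)
        then show ?thesis using ext_abs_of_rat[OF pr, of "c i"] p0 by (simp add: c rat_abs_def)
      qed
      have "ext_abs p \<beta> \<le> 1" if b: "\<beta> \<in> conjugates \<rat> t" for \<beta>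
      proof (rule ccontr)
        assume neg: "\<not> ext_abs p \<beta> \<le> 1"
        have bA: "\<beta> \<in> {x. algebraic x}" using rat.conjugate_algebraic[OF alg b] by (simp add: algebraic_over_Rats)
        have cA: "coeff m i \<in> {x. algebraic x}" for i using c rat_imp_algebraic[OF Rats_of_rat] by simp
        have n0: "n > 0" using rat.degree_min_poly_pos[OF alg] by (simp add: n_def m_def)
        have "0 = poly m \<beta>" using b by (simp add: conjugates_def m_def)
        also have "\<dots> = \<beta> ^ n + (\<Sum>i<n. coeff m i * \<beta> ^ i)"
          unfolding poly_altdef using mQ(2) by (simp add: n_def lessThan_Suc_atMost[symmetric])
        finally have eq: "\<beta> ^ n = - (\<Sum>i<n. coeff m i * \<beta> ^ i)" by (metis add_eq_0_iff2)
        \<comment> \<open>A root of value above 1 would have its top power bounded by the lower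
          terms, each of value at most that of \<open>\<beta> ^ (n - 1)\<close>.\<close>
        have "ext_abs p (\<Sum>i<k. coeff m i * \<beta> ^ i) \<le> ext_abs p \<beta> ^ (n - 1)" if "k \<le> n" for k
          using that
        proof (induction k)
          case 0
          then show ?case using neg by simp
        next
          case (Suc k)
          have "ext_abs p (coeff m k * \<beta> ^ k) = ext_abs p (coeff m k) * ext_abs p \<beta> ^ k"
            by (simp only: u.v_mult[OF cA alg.power_closed[OF bA]] u.v_power[OF bA])
          also have "\<dots> \<le> 1 * ext_abs p \<beta> ^ (n - 1)"
            using coef[of k] Suc.prems neg by (intro mult_mono power_increasing) auto
          finally have 1: "ext_abs p (coeff m k * \<beta> ^ k) \<le> ext_abs p \<beta> ^ (n - 1)" by simp
          have "algebraic (\<Sum>i<k. coeff m i * \<beta> ^ i)" "algebraic (coeff m k * \<beta> ^ k)"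
            using alg.sum_closed[of "{..<k}" "\<lambda>i. coeff m i * \<beta> ^ i"] alg.mult_closed[OF cA alg.power_closed[OF bA]] by auto
          then show ?case using ext_abs_add[OF pr p0] 1 Suc by fastforce
        qed
        from this[of n] have "ext_abs p (\<beta> ^ n) \<le> ext_abs p \<beta> ^ (n - 1)"
          unfolding eq using u.v_minus alg.sum_closed[of "{..<n}" "\<lambda>i. coeff m i * \<beta> ^ i"]
            alg.mult_closed[OF cA alg.power_closed[OF bA]] by auto
        then have "ext_abs p \<beta> ^ n \<le> ext_abs p \<beta> ^ (n - 1)" using u.v_power[OF bA] by simp
        then show False using neg n0 power_strict_increasing[of "n - 1" n "ext_abs p \<beta>"] by simp
      qed
      then have "local_height p t = 1" using local_height_eq_1_iff[OF assms] by blast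
      then show False using p by simp
    qed
  qed
  then show ?thesis by (rule finite_subset) auto
qed

lemma max_powr_divide:
  assumes "a \<ge> 0" "d > 0"
  shows "max 1 (a powr (real n / d)) = (max 1 a ^ n) powr (1 / d)"
proof (cases "a \<le> 1")
  case True
  then have "a powr (real n / d) \<le> 1" using assms by (intro powr_le1) auto
  then show ?thesis using True by simp
next
  case False
  then have "a powr (real n / d) = (a ^ n) powr (1 / d)" by (simp add: powr_powr flip: powr_realpow)
  moreover have "a powr (real n / d) \<ge> 1" using False assms by (intro ge_one_powr_ge_zero) auto
  ultimately show ?thesis using False by simp
qed

text \<open>The set \<open>T\<close> may be larger than the set of contributing places, so that
  heights of several numbers can be compared over one common \<open>T\<close>.\<close>

lemma weil_height_eq_prod:
  assumes t: "algebraic t" and T: "finite T" "T \<subseteq> rat_places" "\<And>p. p \<in> rat_places \<Longrightarrow> local_height p t \<noteq> 1 \<Longrightarrow> p \<in> T"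
  shows "weil_height t = (\<Prod>p\<in>T. local_height p t)"
proof -
  have alg: "algebraic_over \<rat> t" using t by (simp add: algebraic_over_Rats)
  let ?K = "adjoin \<rat> t"
  let ?R = "\<lambda>p. rational_places ?K (ext_abs p)"
  define d where "d = real (card (conjugates \<rat> t))"
  have d: "d > 0" using rat.finite_conjugates[OF alg] rat.self_conjugate[OF alg] by (auto simp: d_def card_gt_0_iff)
  have fp: "finite (?R p)" "(\<Prod>v\<in>?R p. max 1 (v t) ^ local_degree ?K v) = (\<Prod>\<beta>\<in>conjugates \<rat> t. max 1 (ext_abs p \<beta>))"
    if p: "p \<in> rat_places" for p
  proof -
    obtain q where "q \<in> \<rat>" "ext_abs p q > 1" using ext_abs_nontrivial[OF p] by blast
    from prod_rational_places[OF t abs_field_ext_abs[OF p] this]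
    show "finite (?R p)" "(\<Prod>v\<in>?R p. max 1 (v t) ^ local_degree ?K v) = (\<Prod>\<beta>\<in>conjugates \<rat> t. max 1 (ext_abs p \<beta>))"
      by auto
  qed
  have tK: "t \<in> ?K" by (rule rat.self_adjoin)
  have nonneg: "v t \<ge> 0" if "v \<in> ?R p" for v p
    using that tK by (auto simp: rational_places_def absolute_value_on_def)
  have fac: "max 1 (normalized_abs ?K v t) = (max 1 (v t) ^ local_degree ?K v) powr (1 / d)" if "v \<in> ?R p" for v p
    unfolding normalized_abs_def field_degree_adjoin[OF t] d_def[symmetric]
    using max_powr_divide[OF nonneg[OF that] d] by simp
  have loc: "(\<Prod>v\<in>?R p. max 1 (normalized_abs ?K v t)) = local_height p t" if p: "p \<in> rat_places" for p
  proof -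
    have "(\<Prod>v\<in>?R p. max 1 (normalized_abs ?K v t)) = (\<Prod>v\<in>?R p. (max 1 (v t) ^ local_degree ?K v) powr (1 / d))"
      using fac by (intro prod.cong) auto
    also have "\<dots> = (\<Prod>v\<in>?R p. max 1 (v t) ^ local_degree ?K v) powr (1 / d)"
      by (rule prod_powr_distrib[symmetric])
    finally show ?thesis using fp(2)[OF p] by (simp add: local_height_def d_def)
  qed
  define g where "g v = (if v \<in> places ?K then max 1 (normalized_abs ?K v t) else 1)" for v
  have "weil_height t = Prod_any g"
    unfolding weil_height_def height_in_def adjoin_rat_eq[OF t] g_def ..
  also have "\<dots> = prod g (\<Union>p\<in>T. ?R p)"
  proof (rule Prod_any.expand_superset)
    show "finite (\<Union>p\<in>T. ?R p)" using T fp by auto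
    \<comment> \<open>All factors above a given \<open>p\<close> are at least 1, so a factor
      different from 1 makes their product, the local height, different from 1.\<close>
    show "{v. g v \<noteq> 1} \<subseteq> (\<Union>p\<in>T. ?R p)"
    proof
      fix v assume v: "v \<in> {v. g v \<noteq> 1}"
      then have "v \<in> places ?K" by (auto simp: g_def split: if_splits)
      then obtain p where p: "p \<in> rat_places" "v \<in> ?R p" unfolding places_adjoin by blast
      have gv: "max 1 (normalized_abs ?K v t) \<noteq> 1" using v \<open>v \<in> places ?K\<close> by (simp add: g_def)
      have "local_height p t \<noteq> 1"
      proof
        assume "local_height p t = 1"
        then show False using prod_eq_1D[OF fp(1)[OF p(1)], of "\<lambda>v. max 1 (normalized_abs ?K v t)"] loc[OF p(1)] p(2) gv by auto
      qed
      then show "v \<in> (\<Union>p\<in>T. ?R p)" using T(3)[OF p(1)] p(2) by blast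
    qed
  qed
  also have "\<dots> = (\<Prod>p\<in>T. prod g (?R p))"
    using T fp(1) rational_places_disjoint by (intro prod.UNION_disjoint) blast+
  also have "\<dots> = (\<Prod>p\<in>T. local_height p t)"
  proof (rule prod.cong[OF refl])
    fix p assume p: "p \<in> T"
    have "prod g (?R p) = (\<Prod>v\<in>?R p. max 1 (normalized_abs ?K v t))"
      using p T(2) by (intro prod.cong refl) (auto simp: g_def places_adjoin)
    then show "prod g (?R p) = local_height p t" using loc p T(2) by auto
  qed
  finally show ?thesis .
qed


section \<open>Conjugation invariance and subadditivity of the height\<close>

lemma local_height_conjugate:
  assumes "algebraic t" "s \<in> conjugates \<rat> t"
  shows "local_height p s = local_height p t"
  unfolding local_height_def
  using rat.conjugates_eq[of t s] assms by (simp add: algebraic_over_Rats)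

text \<open>Independence of the field: the conjugates of a generator \<open>t\<close> of a larger
  field may be used for \<open>poly P t\<close>. Each conjugate of \<open>poly P t\<close> occurs
  \<open>e\<close> times, which cancels against the factor \<open>e\<close> in the degree.\<close>

lemma local_height_poly:
  assumes t: "algebraic t" and P: "P \<in> polys_over \<rat>"
  shows "local_height p (poly P t) =
    (\<Prod>s\<in>conjugates \<rat> t. max 1 (ext_abs p (poly P s))) powr (1 / real (card (conjugates \<rat> t)))"
proof -
  have alg: "algebraic_over \<rat> t" using t by (simp add: algebraic_over_Rats)
  let ?x = "poly P t"
  have algx: "algebraic_over \<rat> ?x" by (rule rat.algebraic_over_poly[OF alg P])
  have c: "card (conjugates \<rat> ?x) > 0"
    using rat.finite_conjugates[OF algx] rat.self_conjugate[OF algx] by (auto simp: card_gt_0_iff)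
  obtain e where e: "e > 0" "card (conjugates \<rat> t) = e * card (conjugates \<rat> ?x)"
    "\<And>f :: complex \<Rightarrow> real. (\<Prod>s\<in>conjugates \<rat> t. f (poly P s)) = (\<Prod>y\<in>conjugates \<rat> ?x. f y) ^ e"
    by (rule rat.conjugates_prod[OF alg P, where 'a = real]) blast
  let ?Q = "\<Prod>y\<in>conjugates \<rat> ?x. max 1 (ext_abs p y)"
  have "?Q > 0" by (intro prod_pos) auto
  then have "(?Q ^ e) powr (1 / real (e * card (conjugates \<rat> ?x))) = ?Q powr (1 / real (card (conjugates \<rat> ?x)))"
    using e(1) by (simp add: powr_powr flip: powr_realpow)
  then show ?thesis unfolding e(2) e(3)[of "\<lambda>y. max 1 (ext_abs p y)"] by (simp only: local_height_def)
qed

text \<open>All elements of \<open>C\<close> are written as polynomials in one \<open>t\<close>, so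
  that both sides become products over the conjugates of \<open>t\<close>; there
  \<open>max 1\<close> of a product is at most the product of the \<open>max 1\<close>. Being
  conjugates of \<open>x\<close>, the members of \<open>C\<close> share its local height.\<close>

lemma local_height_prod_le:
  assumes x: "algebraic x" and C: "C \<subseteq> conjugates \<rat> x" and p: "p \<in> rat_places"
  shows "local_height p (\<Prod>C) \<le> local_height p x ^ card C"
proof -
  interpret u: abs_field "{x. algebraic x}" "ext_abs p" by (rule abs_field_ext_abs[OF p])
  have algx: "algebraic_over \<rat> x" using x by (simp add: algebraic_over_Rats)
  have fin: "finite C" using C rat.finite_conjugates[OF algx] finite_subset by blast
  obtain t where t: "algebraic_over \<rat> t" "C \<subseteq> adjoin \<rat> t"
    using rat.primitive_element[OF fin] rat.conjugate_algebraic[OF algx] C by blast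
  have talg: "algebraic t" using t(1) by (simp add: algebraic_over_Rats)
  have "\<forall>y. \<exists>P. y \<in> C \<longrightarrow> P \<in> polys_over \<rat> \<and> poly P t = y" using t(2) by (auto simp: adjoin_def)
  then obtain P where P: "\<And>y. y \<in> C \<Longrightarrow> P y \<in> polys_over \<rat>" "\<And>y. y \<in> C \<Longrightarrow> poly (P y) t = y" by metis
  define Q where "Q = (\<Prod>y\<in>C. P y)"
  have Q: "Q \<in> polys_over \<rat>" unfolding Q_def using P(1) by (rule rat.polys_over_prod)
  have Qt: "poly Q t = \<Prod>C" unfolding Q_def poly_prod using P(2) by (intro prod.cong) auto
  let ?R = "conjugates \<rat> t"
  have RA: "poly (P y) s \<in> {x. algebraic x}" if "y \<in> C" "s \<in> ?R" for y s
    using P(1)[OF that(1)] polys_over_mono[OF alg.Rats_subset] rat.conjugate_algebraic[OF t(1) that(2)]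
    by (intro alg.poly_closed) (auto simp: algebraic_over_Rats)
  have vp: "ext_abs p (\<Prod>y\<in>D. poly (P y) s) = (\<Prod>y\<in>D. ext_abs p (poly (P y) s))" if "s \<in> ?R" "finite D" "D \<subseteq> C" for s D
    using that(2,3)
  proof (induction D rule: finite_induct)
    case (insert a D)
    then have "(\<Prod>y\<in>D. poly (P y) s) \<in> {x. algebraic x}" using RA that(1) by (intro alg.prod_closed) auto
    then show ?case using insert u.v_mult RA that(1) by auto
  qed simp
  have "max 1 (ext_abs p (poly Q s)) \<le> (\<Prod>y\<in>C. max 1 (ext_abs p (poly (P y) s)))" if s: "s \<in> ?R" for s
  proof -
    have "ext_abs p (poly Q s) = (\<Prod>y\<in>C. ext_abs p (poly (P y) s))"
      unfolding Q_def poly_prod using vp[OF s fin] by simp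
    also have "\<dots> \<le> (\<Prod>y\<in>C. max 1 (ext_abs p (poly (P y) s)))"
      using u.v_nonneg[OF RA] s by (intro prod_mono) auto
    finally show ?thesis using prod_ge_1[of C "\<lambda>y. max 1 (ext_abs p (poly (P y) s))"] by simp
  qed
  then have "(\<Prod>s\<in>?R. max 1 (ext_abs p (poly Q s))) \<le> (\<Prod>s\<in>?R. \<Prod>y\<in>C. max 1 (ext_abs p (poly (P y) s)))"
    by (intro prod_mono) auto
  also have "\<dots> = (\<Prod>y\<in>C. \<Prod>s\<in>?R. max 1 (ext_abs p (poly (P y) s)))" by (rule prod.swap)
  finally have "local_height p (\<Prod>C) \<le> (\<Prod>y\<in>C. \<Prod>s\<in>?R. max 1 (ext_abs p (poly (P y) s))) powr (1 / real (card ?R))"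
    unfolding Qt[symmetric] local_height_poly[OF talg Q] by (intro powr_mono2 prod_nonneg) auto
  also have "\<dots> = (\<Prod>y\<in>C. local_height p (poly (P y) t))"
    unfolding prod_powr_distrib[of _ C] using local_height_poly[OF talg P(1)] by (intro prod.cong) auto
  also have "\<dots> = (\<Prod>y\<in>C. local_height p x)"
    using P(2) C local_height_conjugate[OF x] by (intro prod.cong) auto
  finally show ?thesis by simp
qed

lemma weil_height_ge_1:
  assumes "algebraic t"
  shows "weil_height t \<ge> 1"
proof -
  let ?T = "{p \<in> rat_places. local_height p t \<noteq> 1}"
  have "weil_height t = (\<Prod>p\<in>?T. local_height p t)"
    by (rule weil_height_eq_prod[OF assms finite_local_height[OF assms]]) auto
  then show ?thesis using local_height_ge_1 by (simp add: prod_ge_1)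
qed

lemma weil_height_prod_le:
  assumes x: "algebraic x" and C: "C \<subseteq> conjugates \<rat> x" and b: "algebraic (\<Prod>C)"
  shows "weil_height (\<Prod>C) \<le> weil_height x ^ card C"
proof -
  let ?T = "{p \<in> rat_places. local_height p x \<noteq> 1} \<union> {p \<in> rat_places. local_height p (\<Prod>C) \<noteq> 1}"
  have T: "finite ?T" using finite_local_height x b by auto
  have "weil_height (\<Prod>C) = (\<Prod>p\<in>?T. local_height p (\<Prod>C))"
    by (rule weil_height_eq_prod[OF b T]) auto
  also have "\<dots> \<le> (\<Prod>p\<in>?T. local_height p x ^ card C)"
    using local_height_ge_1 local_height_prod_le[OF x C]
    by (intro prod_mono) (auto intro: order_trans[OF zero_le_one])
  also have "\<dots> = (\<Prod>p\<in>?T. local_height p x) ^ card C" by (simp add: prod_power_distrib)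
  also have "(\<Prod>p\<in>?T. local_height p x) = weil_height x"
    by (rule weil_height_eq_prod[OF x T, symmetric]) auto
  finally show ?thesis .
qed

section \<open>Kronecker's theorem\<close>

lemma rat_abs_le_1_imp_Ints:
  assumes "\<And>p. p \<in> rat_places \<Longrightarrow> p \<noteq> 0 \<Longrightarrow> rat_abs p q \<le> 1"
  shows "q \<in> \<int>"
proof (rule ccontr)
  assume q: "q \<notin> \<int>"
  obtain a b where ab: "quotient_of q = (a, b)" by (cases "quotient_of q")
  have b: "b > 0" "coprime a b" "q = of_int a / of_int b"
    using quotient_of_denom_pos[OF ab] quotient_of_coprime[OF ab] quotient_of_div[OF ab] by auto
  have "b \<noteq> 1" using q b(3) by auto
  then obtain r where r: "normalization_semidom_class.prime r" "r dvd b"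
    using prime_divisor_exists[of b] b(1) by auto
  define p where "p = nat r"
  have rp: "r = int p" using r(1) prime_ge_0_int[of r] by (simp add: p_def)
  have p: "normalization_semidom_class.prime p" using r(1) by (simp add: rp)
  have "\<not> int p dvd a"
  proof
    assume "int p dvd a"
    then have "is_unit (int p)" using r(2) b(2) rp by (metis coprime_common_divisor)
    then show False using p by (simp add: prime_nat_iff)
  qed
  then have "multiplicity (int p) a = 0" by (simp add: not_dvd_imp_multiplicity_0)
  moreover have "multiplicity (int p) b \<noteq> 0"
    using r(2) rp b(1) p by (simp add: multiplicity_eq_zero_iff prime_nat_iff)
  moreover have "q \<noteq> 0" using q by auto
  ultimately have "rat_abs p q = real p ^ multiplicity (int p) b" "multiplicity (int p) b > 0"
    using p ab by (auto simp: rat_abs_def padic_abs_def)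
  moreover have "real p ^ multiplicity (int p) b > 1"
    using calculation(2) prime_gt_1_nat[OF p] by (intro one_less_power) auto
  ultimately show False using assms[of p] p by (simp add: rat_places_def)
qed

lemma finite_polys_bounded:
  assumes "finite A"
  shows "finite {g :: complex poly. degree g \<le> d \<and> (\<forall>i. coeff g i \<in> A)}"
proof (rule finite_subset)
  show "{g :: complex poly. degree g \<le> d \<and> (\<forall>i. coeff g i \<in> A)} \<subseteq>
      (\<lambda>c. \<Sum>i\<le>d. monom (c i) i) ` (PiE {..d} (\<lambda>_. A))"
  proof
    fix g :: "complex poly" assume g: "g \<in> {g. degree g \<le> d \<and> (\<forall>i. coeff g i \<in> A)}"
    have "g = (\<Sum>i\<le>d. monom (restrict (coeff g) {..d} i) i)"
      by (rule poly_eqI) (use g in \<open>auto simp: coeff_sum coeff_eq_0\<close>)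
    moreover have "restrict (coeff g) {..d} \<in> PiE {..d} (\<lambda>_. A)" using g by auto
    ultimately show "g \<in> (\<lambda>c. \<Sum>i\<le>d. monom (c i) i) ` (PiE {..d} (\<lambda>_. A))" by blast
  qed
qed (use assms in \<open>auto intro!: finite_PiE\<close>)

text \<open>Each linear factor with root in the closed unit disc at most doubles the bound on the
  coefficients.\<close>

lemma norm_coeff_prod_linear_le:
  fixes f :: "'i \<Rightarrow> complex"
  assumes "finite I" "\<And>i. i \<in> I \<Longrightarrow> cmod (f i) \<le> 1"
  shows "cmod (coeff (\<Prod>i\<in>I. [:- f i, 1:]) n) \<le> 2 ^ card I"
  using assms
proof (induction I arbitrary: n rule: finite_induct)
  case (insert a I)
  let ?g = "\<Prod>i\<in>I. [:- f i, 1:]"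
  have IH: "cmod (coeff ?g n) \<le> 2 ^ card I" for n using insert by auto
  have "cmod (coeff ([:- f a, 1:] * ?g) n) \<le> cmod (f a) * cmod (coeff ?g n) + 2 ^ card I"
  proof (cases n)
    case 0
    then show ?thesis by (simp add: norm_mult)
  next
    case (Suc m)
    have "cmod (- f a * coeff ?g n + coeff ?g m) \<le> cmod (f a) * cmod (coeff ?g n) + cmod (coeff ?g m)"
      by (rule order_trans[OF norm_triangle_ineq]) (simp add: norm_mult)
    then show ?thesis using IH[of m] Suc by (simp add: add.commute)
  qed
  also have "\<dots> \<le> 1 * 2 ^ card I + 2 ^ card I"
    using insert.prems IH[of n] by (intro add_mono mult_mono) auto
  finally show ?case using insert.hyps by simp
qed (auto simp: coeff_pCons split: nat.splits)

text \<open>Kronecker's theorem: the powers of an element of height one are roots of finitely many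
  integral polynomials.\<close>

lemma weil_height_gt_1:
  assumes t: "algebraic t" "t \<noteq> 0" and nr: "\<not> (\<exists>n::nat. n > 0 \<and> t ^ n = 1)"
  shows "weil_height t > 1"
proof (rule ccontr)
  assume "\<not> ?thesis"
  then have H: "weil_height t = 1" using weil_height_ge_1[OF t(1)] by simp
  have alg: "algebraic_over \<rat> t" using t by (simp add: algebraic_over_Rats)
  let ?R = "conjugates \<rat> t"
  let ?T = "{p \<in> rat_places. local_height p t \<noteq> 1}"
  have "weil_height t = (\<Prod>p\<in>?T. local_height p t)"
    by (rule weil_height_eq_prod[OF t(1) finite_local_height[OF t(1)]]) auto
  then have "(\<Prod>p\<in>?T. local_height p t) = 1" using H by simp
  from prod_eq_1D[OF finite_local_height[OF t(1)] local_height_ge_1 this]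
  have "local_height p t = 1" if "p \<in> rat_places" for p using that by blast
  then have le1: "ext_abs p \<beta> \<le> 1" if "p \<in> rat_places" "\<beta> \<in> ?R" for p \<beta>
    using local_height_eq_1_iff[OF t(1)] that by blast
  have RA: "?R \<subseteq> {x. algebraic x}" using rat.conjugate_algebraic[OF alg] by (auto simp: algebraic_over_Rats)
  have finR: "finite ?R" by (rule rat.finite_conjugates[OF alg])
  \<comment> \<open>The characteristic polynomial of \<open>t ^ k\<close> over the rationals; its
    degree does not depend on \<open>k\<close>.\<close>
  define g where "g k = (\<Prod>\<beta>\<in>?R. [:- (\<beta> ^ k), 1:])" for k
  have gQ: "g k \<in> polys_over \<rat>" for k
    using rat.prod_conjugates_over[OF alg rat.polys_over_monom[OF rat.one_closed, of k]] by (simp add: g_def poly_monom)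
  have gZ: "coeff (g k) i \<in> \<int>" for k i
  proof -
    obtain q where q: "coeff (g k) i = of_rat q" by (rule Rats_cases[OF polys_overD[OF gQ[of k], of i]])
    \<comment> \<open>Rational and integral at every prime: the algebraic numbers of value at most 1
      form a ring that contains the conjugates and hence the coefficients.\<close>
    have "q \<in> \<int>"
    proof (rule rat_abs_le_1_imp_Ints)
      fix p assume p: "p \<in> rat_places" "p \<noteq> 0"
      interpret u: abs_field "{x. algebraic x}" "ext_abs p" by (rule abs_field_ext_abs[OF p(1)])
      let ?B = "{x. algebraic x \<and> ext_abs p x \<le> 1}"
      interpret B: complex_subring ?B
      proof
        show "1 \<in> ?B" by simp
        fix x y assume xy: "x \<in> ?B" "y \<in> ?B"
        then have A: "x \<in> {x. algebraic x}" "y \<in> {x. algebraic x}" by auto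
        have "ext_abs p x * ext_abs p y \<le> 1"
          using xy u.v_nonneg[OF A(2)] by (intro mult_le_one) auto
        then have "ext_abs p (x * y) \<le> 1" by (simp only: u.v_mult[OF A])
        then show "x * y \<in> ?B" using alg.mult_closed[OF A] by simp
        have "ext_abs p (x - y) \<le> max (ext_abs p x) (ext_abs p y)"
          using ext_abs_add[OF p, of x "- y"] A u.v_minus[OF A(2)] by simp
        also have "\<dots> \<le> 1" using xy by simp
        finally have "ext_abs p (x - y) \<le> 1" .
        then show "x - y \<in> ?B" using alg.diff_closed[OF A] by simp
      qed
      have "g k \<in> polys_over ?B" unfolding g_def
      proof (rule B.polys_over_prod)
        fix \<beta> assume "\<beta> \<in> ?R"
        then have "\<beta> \<in> ?B" using le1[OF p(1)] RA by blast
        then show "[:- (\<beta> ^ k), 1:] \<in> polys_over ?B"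
          unfolding B.polys_over_pCons
          using B.uminus_closed[OF B.power_closed] B.one_closed B.polys_over_0 by blast
      qed
      then have "ext_abs p (coeff (g k) i) \<le> 1" using polys_overD by blast
      then show "rat_abs p q \<le> 1" using ext_abs_of_rat[OF p(1)] q by simp
    qed
    then show ?thesis using q by (auto elim: Ints_cases)
  qed
  \<comment> \<open>The finite places make the coefficients integers and the infinite place bounds
    them, uniformly in \<open>k\<close>.\<close>
  define A where "A = (of_int ` {- (2 ^ card ?R)..2 ^ card ?R} :: complex set)"
  have gA: "coeff (g k) i \<in> A" for k i
  proof -
    obtain z where z: "coeff (g k) i = of_int z" by (rule Ints_cases[OF gZ[of k i]])
    have "0 \<in> rat_places" by (simp add: rat_places_def)
    then have "cmod (coeff (g k) i) \<le> 2 ^ card ?R" unfolding g_def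
      using le1[of 0] ext_abs_0[of 0] by (intro norm_coeff_prod_linear_le finR) (simp add: norm_power power_le_one)
    then have "real_of_int \<bar>z\<bar> \<le> real_of_int (2 ^ card ?R)" unfolding z by simp
    then have "\<bar>z\<bar> \<le> 2 ^ card ?R" by (simp only: of_int_le_iff)
    then show ?thesis unfolding A_def z by (intro imageI) auto
  qed
  have lg: "lead_coeff (g k) = 1" for k unfolding g_def lead_coeff_prod by simp
  \<comment> \<open>The zero polynomial is removed because every number is a root of it.\<close>
  define G where "G = {h :: complex poly. degree h \<le> card ?R \<and> (\<forall>i. coeff h i \<in> A)} - {0}"
  have finG: "finite G" unfolding G_def using finite_polys_bounded[of A] by (simp add: A_def)
  have gG: "g k \<in> G" for k
  proof -
    have "degree (g k) \<le> card ?R" unfolding g_def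
      using degree_prod_sum_le[OF finR, of "\<lambda>\<beta>. [:- (\<beta> ^ k), 1:]"] by simp
    then show ?thesis using gA lg[of k] by (auto simp: G_def)
  qed
  have "range (\<lambda>k. t ^ k) \<subseteq> (\<Union>h\<in>G. {z. poly h z = 0})"
  proof
    fix z assume "z \<in> range (\<lambda>k. t ^ k)"
    then obtain k where "z = t ^ k" by auto
    then have "poly (g k) z = 0" unfolding g_def poly_prod
      using finR rat.self_conjugate[OF alg] by (intro prod_zero) auto
    then show "z \<in> (\<Union>h\<in>G. {z. poly h z = 0})" using gG by blast
  qed
  moreover have "finite (\<Union>h\<in>G. {z. poly h z = 0})"
    using finG by (auto simp: G_def intro: poly_roots_finite)
  ultimately have "finite (range (\<lambda>k. t ^ k))" by (rule finite_subset)
  then have "\<not> inj (\<lambda>k::nat. t ^ k)" using finite_imageD infinite_UNIV_nat by blast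
  then obtain i j :: nat where "t ^ i = t ^ j" "i \<noteq> j" by (auto simp: inj_def)
  then obtain i j :: nat where ij: "t ^ i = t ^ j" "i < j" by (metis linorder_neqE_nat)
  have "t ^ i * t ^ (j - i) = t ^ j" using ij(2) by (simp flip: power_add)
  also have "\<dots> = t ^ i * 1" using ij(1) by simp
  finally have "t ^ i * t ^ (j - i) = t ^ i * 1" .
  moreover have "t ^ i \<noteq> 0" using t(2) by simp
  ultimately have "t ^ (j - i) = 1" using mult_left_cancel by blast
  then show False using nr ij(2) zero_less_diff by blast
qed

section \<open>Norms to the field generated by \<open>\<alpha>\<close> and the lower bound\<close>

theorem theorem1p1:
  fixes \<alpha> :: complex
  assumes "Polynomial.algebraic \<alpha>"
    and "\<alpha> \<noteq> 0"
    and "\<not> (\<exists>n::nat. n > 0 \<and> \<alpha> ^ n = 1)"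
  shows "metric_mahler_inf \<alpha> \<ge>
           Inf {weil_height \<gamma> | \<gamma>. \<gamma> \<in> adjoin_rat \<alpha> \<and> weil_height \<gamma> > 1}"
  unfolding metric_mahler_inf_def
proof (rule cInf_greatest)
  \<comment> \<open>The factorization with the single factor \<open>\<alpha>\<close> shows that the
    infimum is taken over a nonempty set.\<close>
  define a where "a n = (if n = 0 then \<alpha> else 1)" for n :: nat
  have "{n. a n \<noteq> 1} \<subseteq> {0}" by (auto simp: a_def)
  then have "finite {n. a n \<noteq> 1}" "Prod_any a = \<alpha>"
    using Prod_any.expand_superset[of "{0}" a] by (auto simp: a_def finite_subset)
  then have "a \<in> alg_seqs" "Prod_any a = \<alpha>" using assms by (auto simp: alg_seqs_def a_def)
  then show "{Max (range (\<lambda>n. mahler_measure_alg (a n))) | a. a \<in> alg_seqs \<and> Prod_any a = \<alpha>} \<noteq> {}" by blast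
next
  fix M assume "M \<in> {Max (range (\<lambda>n. mahler_measure_alg (a n))) | a. a \<in> alg_seqs \<and> Prod_any a = \<alpha>}"
  then obtain a where M: "M = Max (range (\<lambda>n. mahler_measure_alg (a n)))" and a: "a \<in> alg_seqs" "Prod_any a = \<alpha>"
    by blast
  have alga: "algebraic (a n)" for n using a(1) by (simp add: alg_seqs_def)
  define N where "N = {n. a n \<noteq> 1}"
  have finN: "finite N" using a(1) by (simp add: alg_seqs_def N_def)
  have prod: "(\<Prod>n\<in>N. a n) = \<alpha>" using a(2) by (simp add: N_def Prod_any.expand_set)
  let ?E = "adjoin \<rat> \<alpha>"
  have alg\<alpha>: "algebraic_over \<rat> \<alpha>" using assms by (simp add: algebraic_over_Rats)
  interpret E: complex_subfield ?E by (rule rat.subfield_adjoin[OF alg\<alpha>])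
  have QE: "polys_over \<rat> \<subseteq> polys_over ?E" by (rule polys_over_mono[OF rat.subset_adjoin])
  have algE: "algebraic_over ?E (a n)" for n
    using alga[of n] QE unfolding algebraic_over_Rats[symmetric] algebraic_over_def by blast
  define \<beta> where "\<beta> n = \<Prod>(conjugates ?E (a n))" for n
  have conj: "conjugates ?E (a n) \<subseteq> conjugates \<rat> (a n)" for n
  proof
    fix y assume "y \<in> conjugates ?E (a n)"
    then have "poly (min_poly \<rat> (a n)) y = 0"
      using E.conjugate_root[of "min_poly \<rat> (a n)" "a n" y] QE rat.min_poly_over rat.poly_min_poly alga[of n]
      by (auto simp: algebraic_over_Rats)
    then show "y \<in> conjugates \<rat> (a n)" by (simp add: conjugates_def)
  qed
  have \<beta>E: "\<beta> n \<in> ?E" for n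
  proof -
    \<comment> \<open>The product of the conjugates is the constant coefficient of the minimal
      polynomial up to sign.\<close>
    have "poly (min_poly ?E (a n)) 0 \<in> ?E" using E.min_poly_over[OF algE] by blast
    moreover have "poly (min_poly ?E (a n)) 0 = (- 1) ^ card (conjugates ?E (a n)) * \<beta> n"
      unfolding E.min_poly_eq_prod[OF algE] poly_prod \<beta>_def by (simp add: prod_uminus)
    ultimately have "(- 1) ^ card (conjugates ?E (a n)) * \<beta> n \<in> ?E" by simp
    then show ?thesis
      using E.uminus_closed[of "- \<beta> n"] by (cases "even (card (conjugates ?E (a n)))") auto
  qed
  have \<beta>alg: "algebraic (\<beta> n)" for n
    using rat.algebraic_over_adjoin[OF alg\<alpha> \<beta>E] by (simp add: algebraic_over_Rats)
  have \<beta>H: "weil_height (\<beta> n) \<le> mahler_measure_alg (a n)" for n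
  proof -
    have f: "finite (conjugates \<rat> (a n))" using rat.finite_conjugates alga by (simp add: algebraic_over_Rats)
    have "weil_height (\<beta> n) \<le> weil_height (a n) ^ card (conjugates ?E (a n))"
      using weil_height_prod_le[OF alga conj] \<beta>alg by (simp add: \<beta>_def)
    \<comment> \<open>There are no more conjugates over \<open>?E\<close> than over the rationals,
      and heights are at least 1, so the exponent may grow to the full degree.\<close>
    also have "\<dots> \<le> weil_height (a n) ^ card (conjugates \<rat> (a n))"
      using weil_height_ge_1[OF alga] card_mono[OF f conj] by (rule power_increasing[rotated])
    finally show ?thesis
      by (simp add: mahler_measure_alg_def adjoin_rat_eq[OF alga] field_degree_adjoin[OF alga])
  qed
  obtain t where t: "algebraic_over ?E t" "a ` N \<subseteq> adjoin ?E t"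
    using E.primitive_element[of "a ` N"] finN algE by auto
  have "\<forall>n. \<exists>P. n \<in> N \<longrightarrow> P \<in> polys_over ?E \<and> poly P t = a n" using t(2) by (force simp: adjoin_def)
  then obtain P where P: "\<And>n. n \<in> N \<Longrightarrow> P n \<in> polys_over ?E" "\<And>n. n \<in> N \<Longrightarrow> poly (P n) t = a n" by metis
  let ?R = "conjugates ?E t"
  have finR: "finite ?R" and cR: "card ?R > 0"
    using E.finite_conjugates[OF t(1)] E.self_conjugate[OF t(1)] by (auto simp: card_gt_0_iff)
  have "\<forall>n. \<exists>e. n \<in> N \<longrightarrow> (\<Prod>s\<in>?R. poly (P n) s) = \<beta> n ^ e \<and> e > 0"
  proof (intro allI)
    fix n
    show "\<exists>e. n \<in> N \<longrightarrow> (\<Prod>s\<in>?R. poly (P n) s) = \<beta> n ^ e \<and> e > 0"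
    proof (cases "n \<in> N")
      case True
      obtain e where e: "e > 0" "card ?R = e * card (conjugates ?E (poly (P n) t))"
        "\<And>f :: complex \<Rightarrow> complex. (\<Prod>s\<in>?R. f (poly (P n) s)) = (\<Prod>y\<in>conjugates ?E (poly (P n) t). f y) ^ e"
        by (rule E.conjugates_prod[OF t(1) P(1)[OF True], where 'a = complex]) blast
      then show ?thesis using e(3)[of "\<lambda>y. y"] P(2)[OF True] by (intro exI[of _ e]) (simp add: \<beta>_def)
    qed auto
  qed
  then obtain e where e: "\<And>n. n \<in> N \<Longrightarrow> (\<Prod>s\<in>?R. poly (P n) s) = \<beta> n ^ e n" "\<And>n. n \<in> N \<Longrightarrow> e n > 0" by metis
  \<comment> \<open>The factorization of \<open>\<alpha>\<close> is a polynomial relation for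
    \<open>t\<close> over \<open>?E\<close>, so it persists for every conjugate \<open>s\<close>;
    multiplying over all \<open>s\<close> gives the norm relation.\<close>
  have "(\<Prod>n\<in>N. poly (P n) s) = \<alpha>" if s: "s \<in> ?R" for s
  proof -
    have "poly ((\<Prod>n\<in>N. P n) - [:\<alpha>:]) s = 0"
    proof (rule E.conjugate_root[OF _ _ s])
      show "(\<Prod>n\<in>N. P n) - [:\<alpha>:] \<in> polys_over ?E"
        using P(1) rat.self_adjoin by (intro E.polys_over_diff E.polys_over_prod) auto
      show "poly ((\<Prod>n\<in>N. P n) - [:\<alpha>:]) t = 0" using P(2) prod by (simp add: poly_prod)
    qed
    then show ?thesis by (simp add: poly_prod)
  qed
  then have "\<alpha> ^ card ?R = (\<Prod>s\<in>?R. \<Prod>n\<in>N. poly (P n) s)" by simp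
  also have "\<dots> = (\<Prod>n\<in>N. \<beta> n ^ e n)" using e(1) by (subst prod.swap) simp
  finally have norm: "\<alpha> ^ card ?R = (\<Prod>n\<in>N. \<beta> n ^ e n)" .
  \<comment> \<open>Otherwise a common exponent \<open>m\<close> for all the norms makes a power of
    \<open>\<alpha>\<close> equal to 1.\<close>
  have "\<exists>n\<in>N. \<not> (\<exists>k::nat. k > 0 \<and> \<beta> n ^ k = 1)"
  proof (rule ccontr)
    assume "\<not> ?thesis"
    then have "\<forall>n. \<exists>k::nat. n \<in> N \<longrightarrow> k > 0 \<and> \<beta> n ^ k = 1" by blast
    then obtain k :: "nat \<Rightarrow> nat" where k: "\<And>n. n \<in> N \<Longrightarrow> k n > 0" "\<And>n. n \<in> N \<Longrightarrow> \<beta> n ^ k n = 1" by metis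
    define m where "m = (\<Prod>n\<in>N. k n)"
    have m: "m > 0" unfolding m_def using k(1) by (intro prod_pos) auto
    have "\<beta> n ^ m = 1" if "n \<in> N" for n
    proof -
      have "k n dvd m" unfolding m_def using finN that by (rule dvd_prodI)
      then show ?thesis using k(2)[OF that] by (auto simp: power_mult elim!: dvdE)
    qed
    then have "(\<alpha> ^ card ?R) ^ m = 1" unfolding norm
      by (simp add: prod_power_distrib power_mult[symmetric] mult.commute[of _ m]) (simp add: power_mult)
    then have "\<alpha> ^ (card ?R * m) = 1" by (simp add: power_mult)
    then show False using assms(3) cR m by (metis nat_0_less_mult_iff)
  qed
  then obtain n where n: "n \<in> N" "\<not> (\<exists>k::nat. k > 0 \<and> \<beta> n ^ k = 1)" by blast
  have "\<beta> n \<noteq> 0"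
  proof
    assume "\<beta> n = 0"
    then have "(\<Prod>n\<in>N. \<beta> n ^ e n) = 0" using n(1) finN e(2) by (intro prod_zero) auto
    then show False using norm assms(2) by simp
  qed
  then have H1: "weil_height (\<beta> n) > 1" using weil_height_gt_1[OF \<beta>alg] n(2) by blast
  have "bdd_below {weil_height \<gamma> | \<gamma>. \<gamma> \<in> adjoin_rat \<alpha> \<and> weil_height \<gamma> > 1}"
    by (rule bdd_belowI[of _ 1]) auto
  then have "Inf {weil_height \<gamma> | \<gamma>. \<gamma> \<in> adjoin_rat \<alpha> \<and> weil_height \<gamma> > 1} \<le> weil_height (\<beta> n)"
    using H1 \<beta>E[of n] adjoin_rat_eq[OF assms(1)] by (intro cInf_lower) auto
  also have "\<dots> \<le> mahler_measure_alg (a n)" by (rule \<beta>H)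
  also have "\<dots> \<le> M"
  proof -
    \<comment> \<open>Only the indices in \<open>N\<close> and the value at 1 occur, so the range is
      finite and \<open>Max\<close> is a true maximum.\<close>
    have "range (\<lambda>n. mahler_measure_alg (a n)) \<subseteq> insert (mahler_measure_alg 1) ((\<lambda>n. mahler_measure_alg (a n)) ` N)"
      by (auto simp: N_def)
    then have "finite (range (\<lambda>n. mahler_measure_alg (a n)))" using finN finite_subset by blast
    then show ?thesis unfolding M by (intro Max_ge) auto
  qed
  finally show "Inf {weil_height \<gamma> | \<gamma>. \<gamma> \<in> adjoin_rat \<alpha> \<and> weil_height \<gamma> > 1} \<le> M" .
qed

end
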